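(* Let $(w(t))_{t\ge0}$ be a standard one-dimensional Wiener process and let $\ell_w(u,t)$ be its local time at the point $u\in\mathbb{R}$ up to time $t$. The Clark representation formula for the local time of the Wiener process is $$\ell_w(u,t)=\int_0^tp_r(u)\,dr+\int_0^t\int_r^tp'_{s-r}(w(r)-u)\,ds\,dw(r).$$
   Context: $p_s(x)=(2\pi s)^{-1/2}\exp(-x^2/2s)$ and $p'_s(x)$ is its derivative with respect to $x$. The local time is the $L^2$-limit $\ell_w(u,t)=\lim_{\varepsilon\to0}\int_0^tp_\varepsilon(w(r)-u)\,dr$. The stochastic integral is the Itô integral: the Clark representation of a square integrable random variable $\alpha$ measurable with respect to $w$ on $[0,t]$ is the unique representation $\alpha=\mathbb{E}\alpha+\int_0^tv(r)\,dw(r)$ with $v$ a $w$-adapted process satisfying $\mathbb{E}\int_0^tv(r)^2dr<\infty$. *)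

theory Defs
  imports "HOL-Probability.Probability"
begin

section \<open>The Wiener process\<close>

text \<open>
  Time is \<^typ>\<open>real\<close>; values of the process at negative times are irrelevant.
  All paths are continuous, not just almost all of them: this makes
  \<open>(r, \<omega>) \<mapsto> w r \<omega>\<close> jointly measurable on \<open>[0,\<infinity>) \<times> \<Omega>\<close> without completing \<open>M\<close>.
\<close>

locale wiener_process = prob_space M for M :: "'a measure" +
  fixes w :: "real \<Rightarrow> 'a \<Rightarrow> real"
  assumes random_variable_w: "\<And>t. 0 \<le> t \<Longrightarrow> w t \<in> borel_measurable M"
    and start_zero: "AE \<omega> in M. w 0 \<omega> = 0"
    and independent_increments:
      "\<And>\<tau> n. 0 \<le> \<tau> 0 \<Longrightarrow> mono \<tau> \<Longrightarrow>
         indep_vars (\<lambda>_. borel) (\<lambda>i \<omega>. w (\<tau> (Suc i)) \<omega> - w (\<tau> i) \<omega>) {..<n::nat}"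
    and gaussian_increments:
      "\<And>s t. 0 \<le> s \<Longrightarrow> s < t \<Longrightarrow>
         distributed M lborel (\<lambda>\<omega>. w t \<omega> - w s \<omega>) (\<lambda>x. ennreal (normal_density 0 (sqrt (t - s)) x))"
    and continuous_paths: "\<And>\<omega>. \<omega> \<in> space M \<Longrightarrow> continuous_on {0..} (\<lambda>t. w t \<omega>)"

definition natural_filtration :: "'a measure \<Rightarrow> (real \<Rightarrow> 'a \<Rightarrow> real) \<Rightarrow> real \<Rightarrow> 'a measure" where
  "natural_filtration M w t =
     sigma (space M) {w r -` A \<inter> space M | r A. 0 \<le> r \<and> r \<le> t \<and> A \<in> sets borel}"

section \<open>Mean square convergence\<close>

definition square_integrable :: "'a measure \<Rightarrow> ('a \<Rightarrow> real) \<Rightarrow> bool" where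
  "square_integrable M f \<longleftrightarrow> f \<in> borel_measurable M \<and> integrable M (\<lambda>\<omega>. (f \<omega>)\<^sup>2)"

definition tendsto_L2 :: "'a measure \<Rightarrow> ('b \<Rightarrow> 'a \<Rightarrow> real) \<Rightarrow> ('a \<Rightarrow> real) \<Rightarrow> 'b filter \<Rightarrow> bool" where
  "tendsto_L2 M X Y F \<longleftrightarrow>
     square_integrable M Y \<and> (\<forall>\<^sub>F i in F. square_integrable M (X i)) \<and>
     ((\<lambda>i. \<integral>\<omega>. (X i \<omega> - Y \<omega>)\<^sup>2 \<partial>M) \<longlongrightarrow> 0) F"

section \<open>Local time\<close>

definition heat_kernel :: "real \<Rightarrow> real \<Rightarrow> real" where
  "heat_kernel s x = (2 * pi * s) powr (- 1 / 2) * exp (- x\<^sup>2 / (2 * s))"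

text \<open>
  Local time is determined up to a null set only; \<open>local_time\<close> selects a version.
\<close>

definition has_local_time ::
  "'a measure \<Rightarrow> (real \<Rightarrow> 'a \<Rightarrow> real) \<Rightarrow> real \<Rightarrow> real \<Rightarrow> ('a \<Rightarrow> real) \<Rightarrow> bool" where
  "has_local_time M w u t L \<longleftrightarrow>
     tendsto_L2 M (\<lambda>\<epsilon> \<omega>. LINT r:{0..t}|lborel. heat_kernel \<epsilon> (w r \<omega> - u)) L (at_right 0)"

definition local_time ::
  "'a measure \<Rightarrow> (real \<Rightarrow> 'a \<Rightarrow> real) \<Rightarrow> real \<Rightarrow> real \<Rightarrow> 'a \<Rightarrow> real" where
  "local_time M w u t = (SOME L. has_local_time M w u t L)"

section \<open>The Ito integral\<close>

definition mean_square :: "'a measure \<Rightarrow> real \<Rightarrow> (real \<Rightarrow> 'a \<Rightarrow> real) \<Rightarrow> ennreal" where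
  "mean_square M t v = (\<integral>\<^sup>+\<omega>. (\<integral>\<^sup>+r\<in>{0..t}. ennreal ((v r \<omega>)\<^sup>2) \<partial>lborel) \<partial>M)"

definition ito_integrand ::
  "'a measure \<Rightarrow> (real \<Rightarrow> 'a \<Rightarrow> real) \<Rightarrow> real \<Rightarrow> (real \<Rightarrow> 'a \<Rightarrow> real) \<Rightarrow> bool" where
  "ito_integrand M w t v \<longleftrightarrow>
     (\<lambda>(r, \<omega>). v r \<omega>) \<in> borel_measurable (restrict_space borel {0..t} \<Otimes>\<^sub>M M) \<and>
     (\<forall>r\<in>{0..t}. v r \<in> borel_measurable (natural_filtration M w r)) \<and>
     mean_square M t v < \<infinity>"

text \<open>
  \<open>has_simple_integral M w t V S\<close>: \<open>V\<close> is the step process with value \<open>\<xi> i\<close> on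
  \<open>(\<tau> i, \<tau> (i + 1)]\<close> for \<open>i < n\<close>, each \<open>\<xi> i\<close> being bounded and known at time \<open>\<tau> i\<close>,
  and \<open>S\<close> is its stochastic integral over \<open>[0,t]\<close>.
\<close>

definition has_simple_integral ::
  "'a measure \<Rightarrow> (real \<Rightarrow> 'a \<Rightarrow> real) \<Rightarrow> real \<Rightarrow> (real \<Rightarrow> 'a \<Rightarrow> real) \<Rightarrow> ('a \<Rightarrow> real) \<Rightarrow> bool" where
  "has_simple_integral M w t V S \<longleftrightarrow>
     (\<exists>(n::nat) \<tau> \<xi>.
        0 \<le> \<tau> 0 \<and> \<tau> n \<le> t \<and> (\<forall>i<n. \<tau> i \<le> \<tau> (Suc i)) \<and>
        (\<forall>i<n. \<xi> i \<in> borel_measurable (natural_filtration M w (\<tau> i)) \<and>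
               (\<exists>C. \<forall>\<omega>\<in>space M. \<bar>\<xi> i \<omega>\<bar> \<le> C)) \<and>
        V = (\<lambda>r \<omega>. \<Sum>i<n. \<xi> i \<omega> * indicator {\<tau> i<..\<tau> (Suc i)} r) \<and>
        S = (\<lambda>\<omega>. \<Sum>i<n. \<xi> i \<omega> * (w (\<tau> (Suc i)) \<omega> - w (\<tau> i) \<omega>)))"

definition has_ito_integral ::
  "'a measure \<Rightarrow> (real \<Rightarrow> 'a \<Rightarrow> real) \<Rightarrow> real \<Rightarrow> (real \<Rightarrow> 'a \<Rightarrow> real) \<Rightarrow> ('a \<Rightarrow> real) \<Rightarrow> bool" where
  "has_ito_integral M w t v I \<longleftrightarrow>
     ito_integrand M w t v \<and>
     (\<exists>V S. (\<forall>k::nat. has_simple_integral M w t (V k) (S k)) \<and>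
            (\<lambda>k. mean_square M t (\<lambda>r \<omega>. v r \<omega> - V k r \<omega>)) \<longlonglongrightarrow> 0 \<and>
            tendsto_L2 M S I sequentially)"

definition ito_integral ::
  "'a measure \<Rightarrow> (real \<Rightarrow> 'a \<Rightarrow> real) \<Rightarrow> real \<Rightarrow> (real \<Rightarrow> 'a \<Rightarrow> real) \<Rightarrow> 'a \<Rightarrow> real" where
  "ito_integral M w t v = (SOME I. has_ito_integral M w t v I)"

section \<open>The Clark representation\<close>

text \<open>
  An \<open>L\<^sup>2\<close>-limit is defined almost surely only, so measurability of \<open>\<alpha>\<close> with respect to
  \<open>w\<close> on \<open>[0,t]\<close> is understood up to a null set. For the same reason the integrand is unique
  up to almost-everywhere equality.
\<close>

definition clark_representation ::
  "'a measure \<Rightarrow> (real \<Rightarrow> 'a \<Rightarrow> real) \<Rightarrow> real \<Rightarrow> ('a \<Rightarrow> real) \<Rightarrow> (real \<Rightarrow> 'a \<Rightarrow> real) \<Rightarrow> bool" where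
  "clark_representation M w t \<alpha> v \<longleftrightarrow>
     square_integrable M \<alpha> \<and>
     (\<exists>\<beta> \<in> borel_measurable (natural_filtration M w t). AE \<omega> in M. \<alpha> \<omega> = \<beta> \<omega>) \<and>
     has_ito_integral M w t v (\<lambda>\<omega>. \<alpha> \<omega> - (\<integral>\<omega>'. \<alpha> \<omega>' \<partial>M)) \<and>
     (\<forall>v'. has_ito_integral M w t v' (\<lambda>\<omega>. \<alpha> \<omega> - (\<integral>\<omega>'. \<alpha> \<omega>' \<partial>M)) \<longrightarrow>
        (AE \<omega> in M. AE r in lborel. r \<in> {0..t} \<longrightarrow> v' r \<omega> = v r \<omega>))"

end

theory Submission
  imports Defs
begin

text \<open>
  Write \<open>p\<^sub>s\<close> for the heat kernel. The local time is the mean square limit, as \<open>\<epsilon> \<rightarrow> 0\<close>, of the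
  mollified occupation integrals \<open>X\<^sub>\<epsilon> = \<integral>\<^sub>0\<^sup>t p\<^sub>\<epsilon>(w(r) - u) dr\<close>, and for these the representation is
  nothing but Ito's formula for the potential
  \<open>F(T, x) = \<integral>\<^sub>0\<^sup>T p\<^bsub>\<epsilon>+\<sigma>\<^esub>(x) d\<sigma>\<close> along \<open>r \<mapsto> (t - r, w(r) - u)\<close>. Indeed \<open>F\<close> solves
  \<open>\<partial>\<^sub>T F = 1/2 \<partial>\<^sub>x\<^sup>2 F + p\<^sub>\<epsilon>\<close> and vanishes at \<open>T = 0\<close>, so the \<open>dr\<close> terms of the formula add up to
  \<open>- X\<^sub>\<epsilon>\<close> and what remains is
  \<open>X\<^sub>\<epsilon> = F(t, u) + \<integral>\<^sub>0\<^sup>t v\<^sub>\<epsilon>(r) dw(r)\<close> with \<open>v\<^sub>\<epsilon>(r) = \<integral>\<^sub>0\<^bsup>t-r\<^esup> p'\<^bsub>\<epsilon>+\<sigma>\<^esub>(w(r) - u) d\<sigma>\<close>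
  (\<open>occupation_ito\<close>). The formula is proved by hand along uniform grids. One step of \<open>F\<close> is expanded
  to second order (\<open>heat_potential_step\<close>); the heat equation integrates \<open>p''\<close> in time, so the
  coefficient of the square is an explicit difference of kernels. The compensated squares are
  orthogonal, hence their sum has variance of order \<open>1/n\<close> (\<open>martingale_sum_square\<close>); the Taylor
  remainders are small enough to be summed crudely (\<open>remainder_sum_square\<close>).

  Now let \<open>\<epsilon> \<rightarrow> 0\<close>. The integrands \<open>v\<^sub>\<epsilon>\<close> are bounded by one constant, uniformly in \<open>\<epsilon>\<close>
  (\<open>heat_gradient_bounded\<close>): the singularity of \<open>p'\<^sub>s(x)\<close> at the origin of space and time is integrable
  in time with a bound that does not depend on \<open>x\<close>. They also converge pointwise to the integrand
  \<open>v\<close> of the theorem, so they converge in mean square over \<open>[0,t] \<times> \<Omega>\<close>. Since the isometry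
  makes the stochastic integral continuous (\<open>ito_comparison\<close>) and the space of square integrable
  variables is complete (\<open>L2_complete\<close>), \<open>X\<^sub>\<epsilon>\<close> converges as well and its limit is
  \<open>\<integral>\<^sub>0\<^sup>t p\<^sub>r(u) dr + \<integral>\<^sub>0\<^sup>t v dw\<close> (\<open>local_time_ito\<close>). Thus the existence of local time comes out of the
  argument together with its representation. Completeness is applied inside the information available
  at time \<open>t\<close>, which makes the limit measurable with respect to the path up to \<open>t\<close>. The stochastic
  integral has mean zero, which identifies the expectation of local time, and the isometry, read from
  right to left, gives uniqueness of the integrand.
\<close>

section \<open>The heat kernel and its time integrals\<close>

definition heat_kernel_x :: "real \<Rightarrow> real \<Rightarrow> real" where
  "heat_kernel_x s x = - (x / s) * heat_kernel s x"

definition heat_kernel_xx :: "real \<Rightarrow> real \<Rightarrow> real" where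
  "heat_kernel_xx s x = (x\<^sup>2 / s\<^sup>2 - 1 / s) * heat_kernel s x"

definition heat_kernel_xxx :: "real \<Rightarrow> real \<Rightarrow> real" where
  "heat_kernel_xxx s x = (3 * x / s\<^sup>2 - x ^ 3 / s ^ 3) * heat_kernel s x"

text \<open>
  True for all \<open>s\<close>: at \<open>s = 0\<close> the kernel and the right-hand side vanish, because division by zero
  and powers of zero give zero. So the end point of the time integrals needs no separate treatment.
\<close>

lemma heat_kernel_DERIV: "(heat_kernel s has_real_derivative heat_kernel_x s x) (at x)"
proof -
  have "((\<lambda>x. (2 * pi * s) powr (- 1 / 2) * exp (- x\<^sup>2 / (2 * s))) has_real_derivative
      heat_kernel_x s x) (at x)"
    unfolding heat_kernel_x_def heat_kernel_def
    by (cases "s = 0") (auto intro!: derivative_eq_intros simp: field_simps power2_eq_square)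
  then show ?thesis unfolding heat_kernel_def[abs_def] .
qed

lemma deriv_heat_kernel: "deriv (heat_kernel s) x = heat_kernel_x s x"
  by (rule DERIV_imp_deriv) (rule heat_kernel_DERIV)

lemma heat_kernel_x_DERIV:
  assumes "0 < s"
  shows "(heat_kernel_x s has_real_derivative heat_kernel_xx s x) (at x)"
proof -
  have "((\<lambda>x. - (x / s) * heat_kernel s x) has_real_derivative heat_kernel_xx s x) (at x)"
    using assms
    by (auto intro!: derivative_eq_intros heat_kernel_DERIV
        simp: heat_kernel_xx_def heat_kernel_x_def field_simps power2_eq_square)
  then show ?thesis unfolding heat_kernel_x_def[abs_def] .
qed

lemma heat_kernel_xx_DERIV:
  assumes "0 < s"
  shows "(heat_kernel_xx s has_real_derivative heat_kernel_xxx s x) (at x)"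
proof -
  have "((\<lambda>x. (x\<^sup>2 / s\<^sup>2 - 1 / s) * heat_kernel s x) has_real_derivative heat_kernel_xxx s x) (at x)"
    using assms
    by (auto intro!: derivative_eq_intros heat_kernel_DERIV
        simp: heat_kernel_xxx_def heat_kernel_x_def field_simps power2_eq_square power3_eq_cube)
  then show ?thesis unfolding heat_kernel_xx_def[abs_def] .
qed

lemma heat_equation:
  assumes "0 < s"
  shows "((\<lambda>s. heat_kernel s x) has_real_derivative heat_kernel_xx s x / 2) (at s)"
proof -
  have "(2 * pi * s) powr (- 1 / 2 - 1) = (2 * pi * s) powr (- 1 / 2) / (2 * pi * s)"
    using assms by (subst powr_diff) simp
  then show ?thesis
    unfolding heat_kernel_def heat_kernel_xx_def using assms
    by (auto intro!: derivative_eq_intros simp: field_simps power2_eq_square)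
qed

lemma heat_kernel_even: "heat_kernel s (- x) = heat_kernel s x"
  by (simp add: heat_kernel_def)

lemma heat_kernel_measurable [measurable (raw)]:
  assumes [measurable]: "f \<in> borel_measurable N" "g \<in> borel_measurable N"
  shows "(\<lambda>z. heat_kernel (f z) (g z)) \<in> borel_measurable N"
  unfolding heat_kernel_def by measurable

lemma heat_kernel_x_measurable [measurable (raw)]:
  assumes [measurable]: "f \<in> borel_measurable N" "g \<in> borel_measurable N"
  shows "(\<lambda>z. heat_kernel_x (f z) (g z)) \<in> borel_measurable N"
  unfolding heat_kernel_x_def by measurable

lemma exp_minus_bounds:
  fixes y :: real
  assumes "0 \<le> y"
  shows "exp (- y) \<le> 1" "(1 + y) * exp (- y) \<le> 1" "y * exp (- y) \<le> 1" "y\<^sup>2 * exp (- y) \<le> 2"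
proof -
  have e: "1 + y + y\<^sup>2 / 2 \<le> exp y" using assms by (rule exp_lower_Taylor_quadratic)
  have i: "exp (- y) * exp y = 1" by (simp add: exp_minus)
  have *: "c * exp (- y) \<le> 1" if "c \<le> exp y" for c
    using mult_right_mono[OF that, of "exp (- y)"] i by (simp only: mult.commute) simp
  show "exp (- y) \<le> 1" using assms by simp
  show "(1 + y) * exp (- y) \<le> 1" using e zero_le_power2[of y] assms by (intro *) linarith
  show "y * exp (- y) \<le> 1" using e zero_le_power2[of y] assms by (intro *) linarith
  have "y\<^sup>2 / 2 * exp (- y) \<le> 1" using e assms by (intro *) linarith
  then show "y\<^sup>2 * exp (- y) \<le> 2" by simp
qed

text \<open>
  Away from time zero every derivative is a polynomial in \<open>x\<close> and \<open>1/s\<close> times the Gaussian, and the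
  Gaussian absorbs the powers of \<open>x\<close>. Odd powers are reduced to even ones by
  \<open>\<bar>x\<bar> \<le> 1 + x\<^sup>2\<close>, so that no square roots of \<open>s\<close> occur.
\<close>

lemma heat_kernel_derivatives_bounded:
  assumes \<epsilon>: "0 < \<epsilon>"
  obtains C where "0 \<le> C"
    "\<And>s x. \<epsilon> \<le> s \<Longrightarrow> \<bar>heat_kernel s x\<bar> \<le> C"
    "\<And>s x. \<epsilon> \<le> s \<Longrightarrow> \<bar>heat_kernel_x s x\<bar> \<le> C"
    "\<And>s x. \<epsilon> \<le> s \<Longrightarrow> \<bar>heat_kernel_xx s x\<bar> \<le> C"
    "\<And>s x. \<epsilon> \<le> s \<Longrightarrow> \<bar>heat_kernel_xxx s x\<bar> \<le> C"
proof -
  define B where "B = (2 * pi * \<epsilon>) powr (- 1 / 2)"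
  define K where "K = 1 / \<epsilon>"
  define C where "C = (3 + 14 * K + 5 * K\<^sup>2) * B"
  have K: "0 < K" and B: "0 \<le> B" using \<epsilon> by (auto simp: K_def B_def)
  have main: "\<bar>q * heat_kernel s x\<bar> \<le> C"
    if s: "\<epsilon> \<le> s" and q: "\<bar>q\<bar> * exp (- x\<^sup>2 / (2 * s)) \<le> 3 + 14 * (1/s) + 5 * (1/s)\<^sup>2" for q s x
  proof -
    have k: "0 < 1 / s" "1 / s \<le> K" using s \<epsilon> by (auto simp: K_def frac_le)
    have k2: "(1/s)\<^sup>2 \<le> K\<^sup>2" using k by (intro power_mono) auto
    have "(2 * pi * s) powr (- 1 / 2) \<le> B"
      unfolding B_def using s \<epsilon> by (intro powr_mono2') auto
    then have "\<bar>q\<bar> * exp (- x\<^sup>2 / (2 * s)) * (2 * pi * s) powr (- 1 / 2) \<le> (3 + 14 * (1/s) + 5 * (1/s)\<^sup>2) * B"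
      using k by (intro mult_mono q) (auto intro!: add_nonneg_nonneg)
    also have "\<dots> \<le> C" unfolding C_def using k k2 B by (intro mult_right_mono) linarith+
    finally show ?thesis by (simp add: heat_kernel_def abs_mult mult_ac)
  qed
  have e: "exp (- x\<^sup>2 / (2 * s)) \<le> 1" "x\<^sup>2 * exp (- x\<^sup>2 / (2 * s)) \<le> 2 * s"
    "x ^ 4 * exp (- x\<^sup>2 / (2 * s)) \<le> 8 * s\<^sup>2"
    "\<bar>x\<bar> * exp (- x\<^sup>2 / (2 * s)) \<le> 1 + 2 * s"
    "\<bar>x\<bar> ^ 3 * exp (- x\<^sup>2 / (2 * s)) \<le> 2 * s + 8 * s\<^sup>2" if s: "\<epsilon> \<le> s" for s x
  proof -
    have s0: "0 < s" using s \<epsilon> by simp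
    let ?y = "x\<^sup>2 / (2 * s)" and ?e = "exp (- x\<^sup>2 / (2 * s))"
    have y: "0 \<le> ?y" using s0 by simp
    note b = exp_minus_bounds[OF y]
    show 1: "?e \<le> 1" using b(1) by simp
    show 2: "x\<^sup>2 * ?e \<le> 2 * s" using b(3) s0 by (simp add: field_simps)
    have "x ^ 4 / (4 * s\<^sup>2) * ?e \<le> 2"
      using b(4) by (simp add: power_divide power_mult_distrib flip: power_mult)
    then show 3: "x ^ 4 * ?e \<le> 8 * s\<^sup>2" using s0 by (simp add: field_simps)
    have "\<bar>x\<bar> \<le> 1 + x\<^sup>2"
      using zero_le_power2[of "\<bar>x\<bar> - 1"] zero_le_power2[of x] by (simp add: power2_eq_square algebra_simps) 
    then have "\<bar>x\<bar> * ?e \<le> (1 + x\<^sup>2) * ?e" by (rule mult_right_mono) simp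
    then show "\<bar>x\<bar> * ?e \<le> 1 + 2 * s" using 1 2 unfolding distrib_right mult_1 by linarith
    have "\<bar>x\<bar> ^ 3 = x\<^sup>2 * \<bar>x\<bar>" by (simp add: power3_eq_cube power2_eq_square)
    also have "\<dots> \<le> x\<^sup>2 * (1 + x\<^sup>2)" using \<open>\<bar>x\<bar> \<le> 1 + x\<^sup>2\<close> by (intro mult_left_mono) auto
    also have "\<dots> = x\<^sup>2 + x ^ 4" by (simp add: algebra_simps power_numeral_reduce power2_eq_square)
    finally have "\<bar>x\<bar> ^ 3 * ?e \<le> (x\<^sup>2 + x ^ 4) * ?e" by (rule mult_right_mono) simp
    then show "\<bar>x\<bar> ^ 3 * ?e \<le> 2 * s + 8 * s\<^sup>2" using 2 3 unfolding distrib_right by linarith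
  qed
  show thesis
  proof (rule that[of C])
    show "0 \<le> C" using K B by (simp add: C_def)
    fix s x :: real assume s: "\<epsilon> \<le> s"
    have s0: "0 < s" using s \<epsilon> by simp
    define k where "k = 1 / s"
    have k: "0 < k" "s * k = 1" using s0 by (auto simp: k_def)
    let ?e = "exp (- x\<^sup>2 / (2 * s))"
    note e = e[OF s, of x]
    have e0: "0 \<le> ?e" by simp
    have nn: "0 \<le> k" "0 \<le> k\<^sup>2" using k by auto
    show "\<bar>heat_kernel s x\<bar> \<le> C"
    proof -
      have "\<bar>1\<bar> * ?e \<le> 3 + 14 * k + 5 * k\<^sup>2" using e(1) nn unfolding abs_one mult_1 by linarith
      then show ?thesis using main[OF s, of 1 x] unfolding k_def by simp
    qed
    have "\<bar>x / s\<bar> * ?e = k * (\<bar>x\<bar> * ?e)" using s0 by (simp add: k_def)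
    also have "\<dots> \<le> k * (1 + 2 * s)" by (rule mult_left_mono[OF e(4) nn(1)])
    also have "\<dots> = k + 2" using k by (simp add: algebra_simps)
    finally have "\<bar>x / s\<bar> * ?e \<le> 3 + 14 * k + 5 * k\<^sup>2" using nn by linarith
    then show "\<bar>heat_kernel_x s x\<bar> \<le> C"
      using main[OF s, of "- (x / s)" x] unfolding heat_kernel_x_def k_def by simp
    have "\<bar>x\<^sup>2 / s\<^sup>2 - 1 / s\<bar> \<le> k\<^sup>2 * x\<^sup>2 + k"
      using s0 by (intro order_trans[OF abs_triangle_ineq4]) (simp add: k_def power_divide)
    then have "\<bar>x\<^sup>2 / s\<^sup>2 - 1 / s\<bar> * ?e \<le> (k\<^sup>2 * x\<^sup>2 + k) * ?e" by (rule mult_right_mono[OF _ e0])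
    also have "\<dots> = k\<^sup>2 * (x\<^sup>2 * ?e) + k * ?e" by (simp add: algebra_simps)
    also have "\<dots> \<le> k\<^sup>2 * (2 * s) + k * 1" by (intro add_mono mult_left_mono e nn)
    also have "\<dots> = 3 * k" using k by (simp add: power2_eq_square algebra_simps)
    finally have "\<bar>x\<^sup>2 / s\<^sup>2 - 1 / s\<bar> * ?e \<le> 3 + 14 * k + 5 * k\<^sup>2" using nn by linarith
    then show "\<bar>heat_kernel_xx s x\<bar> \<le> C"
      using main[OF s, of "x\<^sup>2 / s\<^sup>2 - 1 / s" x] unfolding heat_kernel_xx_def k_def by simp
    have "\<bar>3 * x / s\<^sup>2 - x ^ 3 / s ^ 3\<bar> \<le> 3 * k\<^sup>2 * \<bar>x\<bar> + k ^ 3 * \<bar>x\<bar> ^ 3"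
      using s0 by (intro order_trans[OF abs_triangle_ineq4]) (simp add: k_def power_divide power_abs abs_mult)
    then have "\<bar>3 * x / s\<^sup>2 - x ^ 3 / s ^ 3\<bar> * ?e \<le> (3 * k\<^sup>2 * \<bar>x\<bar> + k ^ 3 * \<bar>x\<bar> ^ 3) * ?e"
      by (rule mult_right_mono[OF _ e0])
    also have "\<dots> = 3 * k\<^sup>2 * (\<bar>x\<bar> * ?e) + k ^ 3 * (\<bar>x\<bar> ^ 3 * ?e)" by (simp add: algebra_simps)
    also have "\<dots> \<le> 3 * k\<^sup>2 * (1 + 2 * s) + k ^ 3 * (2 * s + 8 * s\<^sup>2)"
      using k by (intro add_mono mult_left_mono e) auto
    also have "\<dots> = 3 * k\<^sup>2 + 6 * k * (s * k) + 2 * k\<^sup>2 * (s * k) + 8 * k * (s * k) * (s * k)"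
      by (simp add: power2_eq_square power3_eq_cube algebra_simps)
    also have "\<dots> = 5 * k\<^sup>2 + 14 * k" using k(2) by simp
    finally have "\<bar>3 * x / s\<^sup>2 - x ^ 3 / s ^ 3\<bar> * ?e \<le> 3 + 14 * k + 5 * k\<^sup>2" using nn by linarith
    then show "\<bar>heat_kernel_xxx s x\<bar> \<le> C"
      using main[OF s, of "3 * x / s\<^sup>2 - x ^ 3 / s ^ 3" x] unfolding heat_kernel_xxx_def k_def by simp
  qed
qed

lemma heat_kernel_taylor:
  assumes s: "0 < s" and C: "\<And>x. \<bar>heat_kernel_xxx s x\<bar> \<le> C"
  shows "\<bar>heat_kernel s (x + d) - heat_kernel s x - heat_kernel_x s x * d - heat_kernel_xx s x / 2 * d\<^sup>2\<bar>
    \<le> C * \<bar>d\<bar> ^ 3"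
proof -
  define diff where "diff m = (\<lambda>y. (if m = 0 then heat_kernel s (x + y) else if m = 1 then heat_kernel_x s (x + y)
    else if m = 2 then heat_kernel_xx s (x + y) else heat_kernel_xxx s (x + y)))" for m :: nat
  have "((\<lambda>y. f (x + y)) has_real_derivative f' (x + y)) (at y)"
    if "\<And>z. (f has_real_derivative f' z) (at z)" for f f' :: "real \<Rightarrow> real" and y
    using DERIV_shift[of f "f' (x + y)" y x] that by (simp add: add.commute)
  note shift = this
  have "DERIV (diff m) y :> diff (Suc m) y" if "m < 3" for m y
  proof -
    have "m = 0 \<or> m = 1 \<or> m = 2" using that by arith
    then show ?thesis
      by (elim disjE) (auto simp: diff_def intro!: shift heat_kernel_DERIV heat_kernel_x_DERIV[OF s] heat_kernel_xx_DERIV[OF s])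
  qed
  then obtain \<theta> where
    "heat_kernel s (x + d) = (\<Sum>m<3. diff m 0 / fact m * d ^ m) + diff 3 \<theta> / fact 3 * d ^ 3"
    using Maclaurin_bi_le[of diff "\<lambda>y. heat_kernel s (x + y)" 3 d] by (auto simp: diff_def)
  then have "\<bar>heat_kernel s (x + d) - heat_kernel s x - heat_kernel_x s x * d - heat_kernel_xx s x / 2 * d\<^sup>2\<bar>
      = \<bar>heat_kernel_xxx s (x + \<theta>)\<bar> / 6 * \<bar>d\<bar> ^ 3"
    by (simp add: diff_def eval_nat_numeral abs_mult power_abs)
  also have "\<dots> \<le> C * \<bar>d\<bar> ^ 3"
    using C[of "x + \<theta>"] by (intro mult_right_mono) auto
  finally show ?thesis .
qed

text \<open>
  The expected occupation density at \<open>x\<close> of a Wiener path up to time \<open>T\<close>, mollified at scale \<open>\<epsilon>\<close>.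
  Its spatial derivative is represented by the time integral of the derivatives; at \<open>\<epsilon> = 0\<close> this is the integrand
  of the Clark formula.
\<close>

definition heat_potential :: "real \<Rightarrow> real \<Rightarrow> real \<Rightarrow> real" where
  "heat_potential \<epsilon> T x = (LINT \<sigma>:{0..T}|lborel. heat_kernel (\<epsilon> + \<sigma>) x)"

definition heat_gradient :: "real \<Rightarrow> real \<Rightarrow> real \<Rightarrow> real" where
  "heat_gradient \<epsilon> T x = (LINT \<sigma>:{0..T}|lborel. heat_kernel_x (\<epsilon> + \<sigma>) x)"

lemma heat_kernel_x_time_integral:
  "(LINT s:{r..t}|lborel. deriv (heat_kernel (s - r)) x) = heat_gradient 0 (t - r) x"
proof -
  have "(LINT s:{r..t}|lborel. deriv (heat_kernel (s - r)) x)
      = (LINT \<sigma>|lborel. indicator {r..t} (r + 1 * \<sigma>) *\<^sub>R deriv (heat_kernel (r + 1 * \<sigma> - r)) x)"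
    unfolding set_lebesgue_integral_def by (subst lborel_integral_real_affine[of 1 _ r]) simp_all
  also have "\<dots> = heat_gradient 0 (t - r) x"
    unfolding set_lebesgue_integral_def heat_gradient_def deriv_heat_kernel
    by (rule Bochner_Integration.integral_cong) (auto simp: indicator_def)
  finally show ?thesis .
qed

lemma heat_gradient_measurable [measurable (raw)]:
  assumes [measurable]: "f \<in> borel_measurable N" "g \<in> borel_measurable N"
  shows "(\<lambda>z. heat_gradient \<epsilon> (f z) (g z)) \<in> borel_measurable N"
proof -
  have "(\<lambda>z. \<integral>\<sigma>. (if 0 \<le> \<sigma> \<and> \<sigma> \<le> f z then heat_kernel_x (\<epsilon> + \<sigma>) (g z) else 0) \<partial>lborel) \<in> borel_measurable N"
    by measurable
  moreover have "indicator {0..T} \<sigma> *\<^sub>R heat_kernel_x (\<epsilon> + \<sigma>) x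
      = (if 0 \<le> \<sigma> \<and> \<sigma> \<le> T then heat_kernel_x (\<epsilon> + \<sigma>) x else 0)" for T \<sigma> x
    by (auto simp: indicator_def)
  ultimately show ?thesis
    by (simp add: heat_gradient_def set_lebesgue_integral_def)
qed

lemma set_integral_bound_const:
  fixes f :: "real \<Rightarrow> real"
  assumes "a \<le> b" and f: "set_integrable lborel {a..b} f" and C: "\<And>x. a \<le> x \<Longrightarrow> x \<le> b \<Longrightarrow> \<bar>f x\<bar> \<le> C"
  shows "\<bar>LINT x:{a..b}|lborel. f x\<bar> \<le> C * (b - a)"
proof -
  have "\<bar>LINT x:{a..b}|lborel. f x\<bar> \<le> (LINT x:{a..b}|lborel. \<bar>f x\<bar>)"
    using set_integral_norm_bound[OF f] by simp
  also have "\<dots> \<le> (LINT x:{a..b}|lborel. C)"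
    by (rule set_integral_mono)
      (use set_integrable_abs[OF f] C in \<open>auto intro: borel_integrable_atLeastAtMost' continuous_on_const\<close>)
  also have "\<dots> = C * (b - a)" using assms(1) by (simp add: set_lebesgue_integral_def)
  finally show ?thesis .
qed

lemma DERIV_shift_time:
  assumes "\<And>s. 0 < s \<Longrightarrow> (f has_real_derivative f' s) (at s)" "0 < \<epsilon> + \<sigma>"
  shows "((\<lambda>\<sigma>. f (\<epsilon> + \<sigma>)) has_real_derivative f' (\<epsilon> + \<sigma>)) (at \<sigma>)"
  using DERIV_shift[of f "f' (\<epsilon> + \<sigma>)" \<sigma> \<epsilon>] assms by (simp add: add.commute)

lemma split_time_integral:
  fixes f :: "real \<Rightarrow> real"
  assumes "0 \<le> T'" "T' \<le> T" "continuous_on {0..T} f"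
  shows "(LINT \<sigma>:{0..T}|lborel. f \<sigma>) = (LINT \<sigma>:{0..T'}|lborel. f \<sigma>) + (LINT \<sigma>:{T'..T}|lborel. f \<sigma>)"
proof -
  have i: "set_integrable lborel {0..T} f" by (rule borel_integrable_atLeastAtMost') (rule assms)
  have "{0..T} = {0..T'} \<union> {T'..T}" using assms by auto
  moreover have "AE x in lborel. \<not> (x \<in> {0..T'} \<and> x \<in> {T'..T})"
    using AE_lborel_singleton[of T'] by eventually_elim auto
  ultimately show ?thesis
    using assms by (simp only:) (intro set_integral_Un_AE; auto intro: set_integrable_subset[OF i])
qed

context
  fixes \<epsilon> :: real
  assumes \<epsilon>: "0 < \<epsilon>"
begin

lemma heat_kernel_time_continuous:
  assumes "0 \<le> a"
  shows "continuous_on {a..b} (\<lambda>\<sigma>. heat_kernel (\<epsilon> + \<sigma>) x)"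
    "continuous_on {a..b} (\<lambda>\<sigma>. heat_kernel_x (\<epsilon> + \<sigma>) x)"
    "continuous_on {a..b} (\<lambda>\<sigma>. heat_kernel_xx (\<epsilon> + \<sigma>) x)"
proof -
  show *: "continuous_on {a..b} (\<lambda>\<sigma>. heat_kernel (\<epsilon> + \<sigma>) x)"
    by (rule continuous_at_imp_continuous_on)
      (use \<epsilon> assms in \<open>auto intro!: DERIV_isCont[OF DERIV_shift_time[OF heat_equation]]\<close>)
  show "continuous_on {a..b} (\<lambda>\<sigma>. heat_kernel_x (\<epsilon> + \<sigma>) x)"
    "continuous_on {a..b} (\<lambda>\<sigma>. heat_kernel_xx (\<epsilon> + \<sigma>) x)"
    unfolding heat_kernel_x_def heat_kernel_xx_def
    by (intro continuous_intros *; use \<epsilon> assms in auto)+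
qed

lemma heat_kernel_time_integrable:
  assumes "0 \<le> a"
  shows "set_integrable lborel {a..b} (\<lambda>\<sigma>. heat_kernel (\<epsilon> + \<sigma>) x)"
    "set_integrable lborel {a..b} (\<lambda>\<sigma>. heat_kernel_x (\<epsilon> + \<sigma>) x)"
    "set_integrable lborel {a..b} (\<lambda>\<sigma>. heat_kernel_xx (\<epsilon> + \<sigma>) x)"
  using heat_kernel_time_continuous[OF assms] by (auto intro!: borel_integrable_atLeastAtMost')

text \<open>
  By the heat equation the integrand is a time derivative. This replaces the second spatial derivative
  of the potential by a difference of kernels, and in particular no differentiation under the
  integral is ever needed.
\<close>

lemma heat_kernel_xx_time_integral:
  assumes "0 \<le> T"
  shows "(LINT \<sigma>:{0..T}|lborel. heat_kernel_xx (\<epsilon> + \<sigma>) x / 2) = heat_kernel (\<epsilon> + T) x - heat_kernel \<epsilon> x"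
proof -
  have "(LINT \<sigma>:{0..T}|lborel. heat_kernel_xx (\<epsilon> + \<sigma>) x / 2)
      = heat_kernel (\<epsilon> + T) x - heat_kernel (\<epsilon> + 0) x"
    unfolding set_lebesgue_integral_def
  proof (rule integral_FTC_atLeastAtMost[OF assms])
    fix \<sigma> assume "0 \<le> \<sigma>" "\<sigma> \<le> T"
    then have "((\<lambda>\<sigma>. heat_kernel (\<epsilon> + \<sigma>) x) has_real_derivative heat_kernel_xx (\<epsilon> + \<sigma>) x / 2) (at \<sigma> within {0..T})"
      using \<epsilon> by (intro DERIV_subset[OF DERIV_shift_time[OF heat_equation]]) auto
    then show "((\<lambda>\<sigma>. heat_kernel (\<epsilon> + \<sigma>) x) has_vector_derivative heat_kernel_xx (\<epsilon> + \<sigma>) x / 2) (at \<sigma> within {0..T})"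
      by (simp add: has_real_derivative_iff_has_vector_derivative)
  qed (intro continuous_intros heat_kernel_time_continuous, simp_all)
  then show ?thesis by simp
qed

lemma heat_kernel_lipschitz:
  assumes C: "\<And>s x. \<epsilon> \<le> s \<Longrightarrow> \<bar>heat_kernel_x s x\<bar> \<le> C" "\<And>s x. \<epsilon> \<le> s \<Longrightarrow> \<bar>heat_kernel_xx s x\<bar> \<le> C"
    and s: "\<epsilon> \<le> s" "\<epsilon> \<le> s'"
  shows "\<bar>heat_kernel s x - heat_kernel s' x'\<bar> \<le> C * (\<bar>s - s'\<bar> + \<bar>x - x'\<bar>)"
    and "\<bar>heat_kernel_x s x - heat_kernel_x s x'\<bar> \<le> C * \<bar>x - x'\<bar>"
proof -
  have "norm (heat_kernel s x - heat_kernel s x') \<le> C * norm (x - x')"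
    by (rule field_differentiable_bound[where S=UNIV]) (use C s in \<open>auto intro: heat_kernel_DERIV\<close>)
  moreover have "norm (heat_kernel s x' - heat_kernel s' x') \<le> C * norm (s - s')"
  proof (rule field_differentiable_bound[where S="{\<epsilon>..}"])
    fix z assume z: "z \<in> {\<epsilon>..}"
    then show "((\<lambda>s. heat_kernel s x') has_real_derivative heat_kernel_xx z x' / 2) (at z within {\<epsilon>..})"
      using \<epsilon> by (intro DERIV_subset[OF heat_equation]) auto
    show "norm (heat_kernel_xx z x' / 2) \<le> C"
      using C(2)[of z x'] z by simp
  qed (use s in auto)
  ultimately show "\<bar>heat_kernel s x - heat_kernel s' x'\<bar> \<le> C * (\<bar>s - s'\<bar> + \<bar>x - x'\<bar>)"
    unfolding real_norm_def distrib_left by linarith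
  have "norm (heat_kernel_x s x - heat_kernel_x s x') \<le> C * norm (x - x')"
    by (rule field_differentiable_bound[where S=UNIV])
      (use C s \<epsilon> in \<open>auto intro: heat_kernel_x_DERIV\<close>)
  then show "\<bar>heat_kernel_x s x - heat_kernel_x s x'\<bar> \<le> C * \<bar>x - x'\<bar>" by simp
qed

lemma heat_gradient_lipschitz:
  assumes C: "\<And>s x. \<epsilon> \<le> s \<Longrightarrow> \<bar>heat_kernel_x s x\<bar> \<le> C" "\<And>s x. \<epsilon> \<le> s \<Longrightarrow> \<bar>heat_kernel_xx s x\<bar> \<le> C"
    and T: "0 \<le> T'" "T' \<le> T"
  shows "\<bar>heat_gradient \<epsilon> T x - heat_gradient \<epsilon> T' x'\<bar> \<le> C * (T - T') + C * \<bar>x - x'\<bar> * T'"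
proof -
  have "heat_gradient \<epsilon> T x - heat_gradient \<epsilon> T' x'
      = (LINT \<sigma>:{T'..T}|lborel. heat_kernel_x (\<epsilon> + \<sigma>) x)
        + (LINT \<sigma>:{0..T'}|lborel. heat_kernel_x (\<epsilon> + \<sigma>) x - heat_kernel_x (\<epsilon> + \<sigma>) x')"
    unfolding heat_gradient_def
    by (subst split_time_integral[OF T heat_kernel_time_continuous(2)], simp,
        subst set_integral_diff) (auto intro: heat_kernel_time_integrable)
  moreover have "\<bar>LINT \<sigma>:{T'..T}|lborel. heat_kernel_x (\<epsilon> + \<sigma>) x\<bar> \<le> C * (T - T')"
    by (rule set_integral_bound_const) (use T C \<epsilon> in \<open>auto intro: heat_kernel_time_integrable\<close>)
  moreover have "\<bar>LINT \<sigma>:{0..T'}|lborel. heat_kernel_x (\<epsilon> + \<sigma>) x - heat_kernel_x (\<epsilon> + \<sigma>) x'\<bar>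
      \<le> C * \<bar>x - x'\<bar> * (T' - 0)"
    by (rule set_integral_bound_const)
      (use T C \<epsilon> in \<open>auto intro!: heat_kernel_time_integrable heat_kernel_lipschitz(2)\<close>)
  ultimately show ?thesis by simp
qed

text \<open>
  One step of Ito's formula: remaining time decreases by \<open>h\<close> while the position moves by \<open>d\<close>. The first-order
  term of the change in time, \<open>- p\<^bsub>\<epsilon>+T\<^esub>(x) h\<close>, is split as
  \<open>- (p\<^bsub>\<epsilon>+T\<^esub>(x) - p\<^sub>\<epsilon>(x)) h - p\<^sub>\<epsilon>(x) h\<close>: its first part compensates the square of the
  displacement, its second part is the increment of the occupation integral.
\<close>

lemma heat_potential_step:
  assumes C: "\<And>s x. \<epsilon> \<le> s \<Longrightarrow> \<bar>heat_kernel_x s x\<bar> \<le> C"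
    "\<And>s x. \<epsilon> \<le> s \<Longrightarrow> \<bar>heat_kernel_xx s x\<bar> \<le> C" "\<And>s x. \<epsilon> \<le> s \<Longrightarrow> \<bar>heat_kernel_xxx s x\<bar> \<le> C"
    and h: "0 \<le> h" "h \<le> T"
  shows "\<bar>heat_potential \<epsilon> (T - h) (x + d) - heat_potential \<epsilon> T x - heat_gradient \<epsilon> T x * d + heat_kernel \<epsilon> x * h
      - (heat_kernel (\<epsilon> + T) x - heat_kernel \<epsilon> x) * (d\<^sup>2 - h)\<bar>
    \<le> C * (h\<^sup>2 + h * \<bar>d\<bar> + T * \<bar>d\<bar> ^ 3)"
proof -
  have T: "0 \<le> T" using h by simp
  note int = heat_kernel_time_integrable[OF order_refl]
  let ?y = "x + d"
  let ?tail = "LINT \<sigma>:{T - h..T}|lborel. heat_kernel (\<epsilon> + \<sigma>) ?y - heat_kernel (\<epsilon> + T) x"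
  let ?rest = "LINT \<sigma>:{0..T}|lborel. heat_kernel (\<epsilon> + \<sigma>) ?y - heat_kernel (\<epsilon> + \<sigma>) x - heat_kernel_x (\<epsilon> + \<sigma>) x * d
    - heat_kernel_xx (\<epsilon> + \<sigma>) x / 2 * d\<^sup>2"
  have "heat_potential \<epsilon> T ?y - heat_potential \<epsilon> (T - h) ?y = (LINT \<sigma>:{T - h..T}|lborel. heat_kernel (\<epsilon> + \<sigma>) ?y)"
    unfolding heat_potential_def
    by (subst split_time_integral[of "T - h" T]) (use h in \<open>auto intro: heat_kernel_time_continuous\<close>)
  also have "\<dots> = ?tail + heat_kernel (\<epsilon> + T) x * h"
    using h by (subst set_integral_diff) (auto intro: heat_kernel_time_integrable borel_integrable_atLeastAtMost' simp: set_lebesgue_integral_def)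
  finally have 1: "heat_potential \<epsilon> (T - h) ?y = heat_potential \<epsilon> T ?y - ?tail - heat_kernel (\<epsilon> + T) x * h" by simp
  have "?rest = heat_potential \<epsilon> T ?y - heat_potential \<epsilon> T x - heat_gradient \<epsilon> T x * d
      - (LINT \<sigma>:{0..T}|lborel. heat_kernel_xx (\<epsilon> + \<sigma>) x / 2) * d\<^sup>2"
    unfolding heat_potential_def heat_gradient_def using int by simp
  then have 2: "heat_potential \<epsilon> T ?y - heat_potential \<epsilon> T x = heat_gradient \<epsilon> T x * d
      + (heat_kernel (\<epsilon> + T) x - heat_kernel \<epsilon> x) * d\<^sup>2 + ?rest"
    by (simp only: heat_kernel_xx_time_integral[OF T])
  have b1: "\<bar>?tail\<bar> \<le> C * (h + \<bar>d\<bar>) * (T - (T - h))"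
  proof (rule set_integral_bound_const)
    fix \<sigma> assume \<sigma>: "T - h \<le> \<sigma>" "\<sigma> \<le> T"
    then have "\<bar>heat_kernel (\<epsilon> + \<sigma>) ?y - heat_kernel (\<epsilon> + T) x\<bar> \<le> C * (\<bar>\<epsilon> + \<sigma> - (\<epsilon> + T)\<bar> + \<bar>?y - x\<bar>)"
      using h by (intro heat_kernel_lipschitz C) auto
    also have "\<dots> \<le> C * (h + \<bar>d\<bar>)"
      using \<sigma> h order_trans[OF abs_ge_zero C(1)[of \<epsilon> x]] by (intro mult_left_mono add_mono) auto
    finally show "\<bar>heat_kernel (\<epsilon> + \<sigma>) ?y - heat_kernel (\<epsilon> + T) x\<bar> \<le> C * (h + \<bar>d\<bar>)" .
  next
    show "set_integrable lborel {T - h..T} (\<lambda>\<sigma>. heat_kernel (\<epsilon> + \<sigma>) ?y - heat_kernel (\<epsilon> + T) x)"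
      using h by (intro set_integral_diff(1) heat_kernel_time_integrable(1) borel_integrable_atLeastAtMost') auto
  qed (use h in simp)
  have b2: "\<bar>?rest\<bar> \<le> C * \<bar>d\<bar> ^ 3 * (T - 0)"
  proof (rule set_integral_bound_const[OF T])
    fix \<sigma> :: real assume "0 \<le> \<sigma>"
    then show "\<bar>heat_kernel (\<epsilon> + \<sigma>) ?y - heat_kernel (\<epsilon> + \<sigma>) x - heat_kernel_x (\<epsilon> + \<sigma>) x * d
        - heat_kernel_xx (\<epsilon> + \<sigma>) x / 2 * d\<^sup>2\<bar> \<le> C * \<bar>d\<bar> ^ 3"
      using \<epsilon> C(3)[of "\<epsilon> + \<sigma>"] by (intro heat_kernel_taylor) auto
  qed (use int in auto)
  have "heat_potential \<epsilon> (T - h) ?y - heat_potential \<epsilon> T x - heat_gradient \<epsilon> T x * d + heat_kernel \<epsilon> x * h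
      - (heat_kernel (\<epsilon> + T) x - heat_kernel \<epsilon> x) * (d\<^sup>2 - h) = ?rest - ?tail"
    using 1 2 by (simp add: algebra_simps)
  also have "\<bar>\<dots>\<bar> \<le> C * \<bar>d\<bar> ^ 3 * (T - 0) + C * (h + \<bar>d\<bar>) * (T - (T - h))"
    using b1 b2 by linarith
  also have "\<dots> = C * (h\<^sup>2 + h * \<bar>d\<bar> + T * \<bar>d\<bar> ^ 3)" by (simp add: algebra_simps power2_eq_square)
  finally show ?thesis .
qed

text \<open>
  The exact value of \<open>\<integral>\<^sub>0\<^sup>\<infinity> \<bar>p'\<^sub>s(x)\<bar> ds\<close> is \<open>1\<close> for every \<open>x \<noteq> 0\<close>, by the scaling of the kernel. Any bound
  independent of \<open>x\<close> and \<open>\<epsilon>\<close> serves, and \<open>exp(-y) \<le> 1/(1 + y)\<close> turns the integrand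
  into the derivative of an arc tangent.
\<close>

lemma heat_gradient_bounded:
  shows "\<bar>heat_gradient \<epsilon> T x\<bar> \<le> sqrt pi"
proof (cases "x = 0 \<or> T < 0")
  case True
  then show ?thesis by (auto simp: heat_gradient_def heat_kernel_x_def set_lebesgue_integral_def)
next
  case False
  then have x: "x \<noteq> 0" and T: "0 \<le> T" by auto
  \<comment> \<open>\<open>D\<close> dominates the kernel derivative and has the bounded primitive \<open>A\<close>.\<close>
  define D where "D s = 2 / sqrt pi * (\<bar>x\<bar> / ((x\<^sup>2 + 2 * s) * sqrt (2 * s)))" for s
  define A where "A s = 2 / sqrt pi * arctan (sqrt (2 * s) / \<bar>x\<bar>)" for s
  have bound: "\<bar>heat_kernel_x s x\<bar> \<le> D s" if s: "0 < s" for s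
  proof -
    have "(1 + x\<^sup>2 / (2 * s)) * exp (- (x\<^sup>2 / (2 * s))) \<le> 1"
      using s by (intro exp_minus_bounds(2)) simp
    moreover have "0 < 1 + x\<^sup>2 / (2 * s)" using s by (simp add: add_pos_nonneg)
    ultimately have "exp (- x\<^sup>2 / (2 * s)) \<le> 1 / (1 + x\<^sup>2 / (2 * s))"
      by (simp add: pos_le_divide_eq mult.commute)
    also have "1 / (1 + x\<^sup>2 / (2 * s)) = 2 * s / (x\<^sup>2 + 2 * s)"
      using s by (simp add: field_simps)
    finally have e: "exp (- x\<^sup>2 / (2 * s)) \<le> 2 * s / (x\<^sup>2 + 2 * s)" .
    have p: "(2 * pi * s) powr (- 1 / 2) = 1 / (sqrt pi * sqrt (2 * s))"
      using s by (simp add: powr_minus_divide powr_half_sqrt real_sqrt_mult mult_ac)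
    have "\<bar>heat_kernel_x s x\<bar> = \<bar>x\<bar> / s * (1 / (sqrt pi * sqrt (2 * s))) * exp (- x\<^sup>2 / (2 * s))"
      unfolding heat_kernel_x_def heat_kernel_def p using s by (simp add: abs_mult)
    also have "\<dots> \<le> \<bar>x\<bar> / s * (1 / (sqrt pi * sqrt (2 * s))) * (2 * s / (x\<^sup>2 + 2 * s))"
      using s by (intro mult_left_mono e) auto
    also have "\<dots> = D s" unfolding D_def using s by (simp add: field_simps)
    finally show ?thesis .
  qed
  have deriv: "(A has_real_derivative D s) (at s)" if s: "0 < s" for s
  proof -
    have nz: "x\<^sup>2 + 2 * s \<noteq> 0" using s by (simp add: add_nonneg_pos less_imp_neq[symmetric])
    have "((\<lambda>s. sqrt (2 * s)) has_real_derivative inverse (sqrt (2 * s))) (at s)"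
      using s by (auto intro!: derivative_eq_intros simp: field_simps)
    from DERIV_cmult[OF DERIV_chain2[OF DERIV_arctan DERIV_cdivide[OF this, of "\<bar>x\<bar>"]], of "2 / sqrt pi"]
    have "(A has_real_derivative
        2 / sqrt pi * (inverse (1 + (sqrt (2 * s) / \<bar>x\<bar>)\<^sup>2) * (inverse (sqrt (2 * s)) / \<bar>x\<bar>))) (at s)"
      unfolding A_def .
    also have "inverse (1 + (sqrt (2 * s) / \<bar>x\<bar>)\<^sup>2) = x\<^sup>2 / (x\<^sup>2 + 2 * s)"
      using s x nz by (simp add: power_divide field_simps)
    also have "x\<^sup>2 / (x\<^sup>2 + 2 * s) * (inverse (sqrt (2 * s)) / \<bar>x\<bar>) = \<bar>x\<bar> / ((x\<^sup>2 + 2 * s) * sqrt (2 * s))"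
    proof -
      have "z * z / N * (inverse q / z) = z / (N * q)" if "z \<noteq> 0" for z N q :: real
        using that by (simp add: divide_inverse)
      from this[of "\<bar>x\<bar>"] show ?thesis using x by (simp add: power2_eq_square)
    qed
    finally show ?thesis unfolding D_def .
  qed
  have contD: "continuous_on {0..T} (\<lambda>\<sigma>. D (\<epsilon> + \<sigma>))"
    unfolding D_def
    by (intro continuous_intros) (use \<epsilon> x in \<open>auto simp: add_nonneg_eq_0_iff\<close>)
  have "\<bar>heat_gradient \<epsilon> T x\<bar> \<le> (LINT \<sigma>:{0..T}|lborel. \<bar>heat_kernel_x (\<epsilon> + \<sigma>) x\<bar>)"
    unfolding heat_gradient_def using set_integral_norm_bound[OF heat_kernel_time_integrable(2)[OF order_refl]] by simp
  also have "\<dots> \<le> (LINT \<sigma>:{0..T}|lborel. D (\<epsilon> + \<sigma>))"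
  proof (rule set_integral_mono)
    show "set_integrable lborel {0..T} (\<lambda>\<sigma>. \<bar>heat_kernel_x (\<epsilon> + \<sigma>) x\<bar>)"
      by (intro set_integrable_abs heat_kernel_time_integrable order_refl)
    show "set_integrable lborel {0..T} (\<lambda>\<sigma>. D (\<epsilon> + \<sigma>))"
      by (rule borel_integrable_atLeastAtMost'[OF contD])
  qed (use \<epsilon> bound in auto)
  also have "\<dots> = A (\<epsilon> + T) - A (\<epsilon> + 0)"
    unfolding set_lebesgue_integral_def
  proof (rule integral_FTC_atLeastAtMost[OF T _ contD])
    fix \<sigma> assume "0 \<le> \<sigma>" "\<sigma> \<le> T"
    then have "((\<lambda>\<sigma>. A (\<epsilon> + \<sigma>)) has_real_derivative D (\<epsilon> + \<sigma>)) (at \<sigma> within {0..T})"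
      using \<epsilon> by (intro DERIV_subset[OF DERIV_shift_time[OF deriv]]) auto
    then show "((\<lambda>\<sigma>. A (\<epsilon> + \<sigma>)) has_vector_derivative D (\<epsilon> + \<sigma>)) (at \<sigma> within {0..T})"
      by (simp add: has_real_derivative_iff_has_vector_derivative)
  qed
  also have "\<dots> \<le> 2 / sqrt pi * (pi / 2)"
  proof -
    have "0 \<le> A \<epsilon>" unfolding A_def using \<epsilon> by simp
    moreover have "A (\<epsilon> + T) \<le> 2 / sqrt pi * (pi / 2)"
      unfolding A_def by (intro mult_left_mono less_imp_le[OF arctan_ubound]) simp
    ultimately show ?thesis by simp
  qed
  also have "\<dots> = sqrt pi" by (simp add: real_div_sqrt)
  finally show ?thesis .
qed

end

text \<open>
  Off the origin the Gaussian beats the singularity at time zero. This provides the dominating function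
  for \<open>\<epsilon> \<rightarrow> 0\<close> at a fixed \<open>x \<noteq> 0\<close>.
\<close>

lemma heat_kernel_x_bound_away:
  assumes x: "x \<noteq> 0" and s: "0 < s"
  shows "\<bar>heat_kernel_x s x\<bar> \<le> 8 / \<bar>x\<bar> ^ 3 * sqrt s"
proof -
  let ?e = "exp (- x\<^sup>2 / (2 * s))"
  have "(x\<^sup>2 / (2 * s))\<^sup>2 * exp (- (x\<^sup>2 / (2 * s))) \<le> 2"
    using s by (intro exp_minus_bounds(4)) simp
  then have e: "\<bar>x\<bar> ^ 4 * ?e \<le> 8 * s\<^sup>2"
    using s by (simp add: field_simps power_numeral_reduce power2_eq_square)
  have p: "(2 * pi * s) powr (- 1 / 2) \<le> s powr (- 1 / 2)"
  proof (rule powr_mono2')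
    have "1 * s \<le> (2 * pi) * s" using s pi_ge_two by (intro mult_right_mono) auto
    then show "s \<le> 2 * pi * s" by simp
  qed (use s in auto)
  also have "s powr (- 1 / 2) = 1 / sqrt s"
    using s by (simp add: powr_minus_divide powr_half_sqrt)
  finally have p: "(2 * pi * s) powr (- 1 / 2) \<le> 1 / sqrt s" .
  have "\<bar>x\<bar> ^ 3 * \<bar>heat_kernel_x s x\<bar> = (\<bar>x\<bar> ^ 4 * ?e) / s * (2 * pi * s) powr (- 1 / 2)"
    unfolding heat_kernel_x_def heat_kernel_def using s
    by (simp add: abs_mult power_numeral_reduce)
  also have "\<dots> \<le> (8 * s\<^sup>2) / s * (1 / sqrt s)"
    using s by (intro mult_mono p divide_right_mono e) auto
  also have "\<dots> = 8 * (s / sqrt s)" using s by (simp add: power2_eq_square)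
  also have "s / sqrt s = sqrt s" using s by (simp add: real_div_sqrt)
  finally show ?thesis using x by (simp add: field_simps)
qed

lemma heat_gradient_tendsto:
  assumes e: "\<And>k. 0 < e k" "e \<longlonglongrightarrow> 0"
  shows "(\<lambda>k. heat_gradient (e k) T x) \<longlonglongrightarrow> heat_gradient 0 T x"
proof (cases "x = 0")
  case True
  then show ?thesis by (simp add: heat_gradient_def heat_kernel_x_def set_lebesgue_integral_def)
next
  case False
  obtain E where E: "\<And>k. \<bar>e k\<bar> \<le> E"
    using convergent_imp_Bseq[OF convergentI[OF e(2)]] by (auto simp: Bseq_def)
  define K where "K = 8 / \<bar>x\<bar> ^ 3 * sqrt (E + T)"
  show ?thesis
    unfolding heat_gradient_def set_lebesgue_integral_def
  proof (rule integral_dominated_convergence)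
    show "integrable lborel (\<lambda>\<sigma>. indicator {0..T} \<sigma> * K)"
      by (intro integrable_mult_left integrable_real_indicator) (auto simp: emeasure_lborel_Icc_eq)
    have "isCont (\<lambda>s. heat_kernel_x s x) \<sigma>" if "0 < \<sigma>" for \<sigma>
      unfolding heat_kernel_x_def using that
      by (intro continuous_intros DERIV_isCont[OF heat_equation]) auto
    then have "(\<lambda>k. heat_kernel_x (e k + \<sigma>) x) \<longlonglongrightarrow> heat_kernel_x (0 + \<sigma>) x" if "0 < \<sigma>" for \<sigma>
      using that by (intro isCont_tendsto_compose[of _ "\<lambda>s. heat_kernel_x s x"] tendsto_intros e) auto
    then have "(\<lambda>k. indicator {0..T} \<sigma> *\<^sub>R heat_kernel_x (e k + \<sigma>) x)
        \<longlonglongrightarrow> indicator {0..T} \<sigma> *\<^sub>R heat_kernel_x (0 + \<sigma>) x" if "\<sigma> \<noteq> 0" for \<sigma>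
      using that by (cases "0 < \<sigma>") (auto intro!: tendsto_intros)
    then show "AE \<sigma> in lborel. (\<lambda>k. indicator {0..T} \<sigma> *\<^sub>R heat_kernel_x (e k + \<sigma>) x)
        \<longlonglongrightarrow> indicator {0..T} \<sigma> *\<^sub>R heat_kernel_x (0 + \<sigma>) x"
      by (intro eventually_mono[OF AE_lborel_singleton[of 0]])
    show "AE \<sigma> in lborel. norm (indicator {0..T} \<sigma> *\<^sub>R heat_kernel_x (e k + \<sigma>) x) \<le> indicator {0..T} \<sigma> * K" for k
    proof (rule AE_I2)
      fix \<sigma> :: real
      have "\<bar>heat_kernel_x (e k + \<sigma>) x\<bar> \<le> K" if "0 \<le> \<sigma>" "\<sigma> \<le> T"
      proof -
        have "0 < e k + \<sigma>" using e(1)[of k] that by simp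
        from heat_kernel_x_bound_away[OF False this]
        have "\<bar>heat_kernel_x (e k + \<sigma>) x\<bar> \<le> 8 / \<bar>x\<bar> ^ 3 * sqrt (e k + \<sigma>)" .
        also have "\<dots> \<le> K"
          unfolding K_def using E[of k] that by (intro mult_left_mono real_sqrt_le_mono) auto
        finally show ?thesis .
      qed
      then show "norm (indicator {0..T} \<sigma> *\<^sub>R heat_kernel_x (e k + \<sigma>) x) \<le> indicator {0..T} \<sigma> * K"
        by (auto simp: indicator_def)
    qed
  qed measurable
qed

lemma heat_potential_tendsto:
  assumes e: "\<And>k. 0 < e k" "e \<longlonglongrightarrow> 0" and T: "0 \<le> T"
  shows "(\<lambda>k. heat_potential (e k) T x) \<longlonglongrightarrow> (LINT \<sigma>:{0..T}|lborel. heat_kernel \<sigma> x)"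
proof -
  have lim: "(\<lambda>k. LINT \<sigma>|lborel. indicator {0..T} \<sigma> *\<^sub>R heat_kernel (e k + \<sigma>) x)
    \<longlonglongrightarrow> (LINT \<sigma>|lborel. indicator {0..T} \<sigma> *\<^sub>R heat_kernel (0 + \<sigma>) x)"
  proof (rule integral_dominated_convergence)
    have "(\<integral>\<^sup>+\<sigma>. ennreal (\<sigma> powr (- 1 / 2)) * indicator {0..T} \<sigma> \<partial>lborel)
        = ennreal (T powr (- 1 / 2 + 1) / (- 1 / 2 + 1))"
      by (rule nn_integral_has_integral_lebesgue'[OF _ has_integral_powr_from_0]) (use T in auto)
    moreover have "(\<integral>\<^sup>+\<sigma>. ennreal (indicator {0..T} \<sigma> * \<sigma> powr (- 1 / 2)) \<partial>lborel)
        = (\<integral>\<^sup>+\<sigma>. ennreal (\<sigma> powr (- 1 / 2)) * indicator {0..T} \<sigma> \<partial>lborel)"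
      by (intro nn_integral_cong) (auto simp: indicator_def)
    ultimately show "integrable lborel (\<lambda>\<sigma>. indicator {0..T} \<sigma> * \<sigma> powr (- 1 / 2))"
      by (intro integrableI_nonneg) auto
    have "(\<lambda>k. heat_kernel (e k + \<sigma>) x) \<longlonglongrightarrow> heat_kernel (0 + \<sigma>) x" if "0 < \<sigma>" for \<sigma>
    proof (rule isCont_tendsto_compose[of _ "\<lambda>s. heat_kernel s x"])
      show "isCont (\<lambda>s. heat_kernel s x) (0 + \<sigma>)" using that by (intro DERIV_isCont[OF heat_equation]) simp
      show "(\<lambda>k. e k + \<sigma>) \<longlonglongrightarrow> 0 + \<sigma>" by (intro tendsto_intros e)
    qed
    then have "(\<lambda>k. indicator {0..T} \<sigma> *\<^sub>R heat_kernel (e k + \<sigma>) x)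
        \<longlonglongrightarrow> indicator {0..T} \<sigma> *\<^sub>R heat_kernel (0 + \<sigma>) x" if "\<sigma> \<noteq> 0" for \<sigma>
      using that by (cases "0 < \<sigma>") (auto intro!: tendsto_intros)
    then show "AE \<sigma> in lborel. (\<lambda>k. indicator {0..T} \<sigma> *\<^sub>R heat_kernel (e k + \<sigma>) x)
        \<longlonglongrightarrow> indicator {0..T} \<sigma> *\<^sub>R heat_kernel (0 + \<sigma>) x"
      by (intro eventually_mono[OF AE_lborel_singleton[of 0]])
    have "norm (indicator {0..T} \<sigma> *\<^sub>R heat_kernel (e k + \<sigma>) x) \<le> indicator {0..T} \<sigma> * \<sigma> powr (- 1 / 2)"
      if "\<sigma> \<noteq> 0" for \<sigma> k
    proof (cases "0 < \<sigma>")
      case True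
      have "1 * \<sigma> \<le> (2 * pi) * (e k + \<sigma>)"
        using True e(1)[of k] pi_ge_two by (intro mult_mono) auto
      then have "(2 * pi * (e k + \<sigma>)) powr (- 1 / 2) \<le> \<sigma> powr (- 1 / 2)"
        using True by (intro powr_mono2') auto
      moreover have "exp (- x\<^sup>2 / (2 * (e k + \<sigma>))) \<le> 1" using True e(1)[of k] by simp
      ultimately have "(2 * pi * (e k + \<sigma>)) powr (- 1 / 2) * exp (- x\<^sup>2 / (2 * (e k + \<sigma>))) \<le> \<sigma> powr (- 1 / 2) * 1"
        by (intro mult_mono) auto
      then show ?thesis by (simp add: heat_kernel_def indicator_def)
    qed (use that in auto)
    then show "AE \<sigma> in lborel. norm (indicator {0..T} \<sigma> *\<^sub>R heat_kernel (e k + \<sigma>) x)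
        \<le> indicator {0..T} \<sigma> * \<sigma> powr (- 1 / 2)" for k
      by (intro eventually_mono[OF AE_lborel_singleton[of 0]])
  qed measurable
  then show ?thesis by (simp add: heat_potential_def set_lebesgue_integral_def)
qed

section \<open>Mean square distance\<close>

text \<open>
  Kept in the extended reals, so that no integrability has to be carried along; the same
  functional serves for random variables and for processes.
\<close>

definition sq_norm :: "'a measure \<Rightarrow> ('a \<Rightarrow> real) \<Rightarrow> ennreal" where
  "sq_norm N f = (\<integral>\<^sup>+x. ennreal ((f x)\<^sup>2) \<partial>N)"

text \<open>
  The constant \<open>2\<close> avoids square roots. All later arguments only need distances up to a fixed factor.
\<close>

lemma sq_norm_add_le:
  assumes [measurable]: "f \<in> borel_measurable N" "g \<in> borel_measurable N"
  shows "sq_norm N (\<lambda>x. f x + g x) \<le> 2 * sq_norm N f + 2 * sq_norm N g"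
proof -
  have "sq_norm N (\<lambda>x. f x + g x)
      \<le> (\<integral>\<^sup>+x. 2 * ennreal ((f x)\<^sup>2) + 2 * ennreal ((g x)\<^sup>2) \<partial>N)"
    unfolding sq_norm_def
  proof (rule nn_integral_mono)
    fix x
    have "(f x + g x)\<^sup>2 \<le> 2 * (f x)\<^sup>2 + 2 * (g x)\<^sup>2"
      using zero_le_power2[of "f x - g x"] by (simp add: power2_eq_square algebra_simps)
    then have "ennreal ((f x + g x)\<^sup>2) \<le> ennreal (2 * (f x)\<^sup>2 + 2 * (g x)\<^sup>2)"
      by (rule ennreal_leI)
    then show "ennreal ((f x + g x)\<^sup>2) \<le> 2 * ennreal ((f x)\<^sup>2) + 2 * ennreal ((g x)\<^sup>2)"
      by (simp add: ennreal_plus ennreal_mult)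
  qed
  also have "\<dots> = 2 * sq_norm N f + 2 * sq_norm N g"
    unfolding sq_norm_def by (simp add: nn_integral_add nn_integral_cmult)
  finally show ?thesis .
qed

lemma sq_norm_minus: "sq_norm N (\<lambda>x. - f x) = sq_norm N f"
  by (simp add: sq_norm_def)

lemma sq_norm_diff_commute: "sq_norm N (\<lambda>x. f x - g x) = sq_norm N (\<lambda>x. g x - f x)"
  by (simp add: sq_norm_def power2_commute)

lemma sq_norm_triangle:
  assumes [measurable]: "f \<in> borel_measurable N" "g \<in> borel_measurable N" "h \<in> borel_measurable N"
  shows "sq_norm N (\<lambda>x. f x - h x) \<le> 2 * sq_norm N (\<lambda>x. f x - g x) + 2 * sq_norm N (\<lambda>x. g x - h x)"
  using sq_norm_add_le[of "\<lambda>x. f x - g x" N "\<lambda>x. g x - h x"] by simp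

lemma sq_norm_cong_AE:
  assumes "AE x in N. f x = g x"
  shows "sq_norm N f = sq_norm N g"
  unfolding sq_norm_def by (rule nn_integral_cong_AE) (use assms in auto)

lemma square_integrable_iff:
  "square_integrable N f \<longleftrightarrow> f \<in> borel_measurable N \<and> sq_norm N f < \<infinity>"
  unfolding square_integrable_def sq_norm_def
  by (auto simp: integrable_iff_bounded)

lemma sq_norm_eq_integral:
  assumes "square_integrable N f"
  shows "sq_norm N f = ennreal (\<integral>x. (f x)\<^sup>2 \<partial>N)"
  using assms unfolding square_integrable_def sq_norm_def
  by (intro nn_integral_eq_integral) auto

lemma square_integrable_diff:
  assumes "square_integrable N f" "square_integrable N g"
  shows "square_integrable N (\<lambda>x. f x - g x)"
proof -
  have "sq_norm N (\<lambda>x. f x - g x) \<le> 2 * sq_norm N f + 2 * sq_norm N (\<lambda>x. - g x)"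
    using sq_norm_add_le[of f N "\<lambda>x. - g x"] assms by (simp add: square_integrable_iff)
  also have "\<dots> < \<infinity>"
    using assms by (simp add: square_integrable_iff sq_norm_minus ennreal_mult_less_top)
  finally show ?thesis using assms by (auto simp: square_integrable_iff)
qed

lemma square_integrable_bounded:
  assumes "finite_measure N" "f \<in> borel_measurable N" "\<And>x. x \<in> space N \<Longrightarrow> \<bar>f x\<bar> \<le> C"
  shows "square_integrable N f"
proof -
  interpret finite_measure N by fact
  have "\<bar>(f x)\<^sup>2\<bar> \<le> C\<^sup>2" if "x \<in> space N" for x
    using power_mono[OF assms(3)[OF that], of 2] by simp
  then show ?thesis
    unfolding square_integrable_def using assms(2)
    by (auto intro!: integrable_const_bound[where B="C\<^sup>2"])
qed

lemma tendsto_L2_iff: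
  assumes "square_integrable N Y" "\<forall>\<^sub>F i in F. square_integrable N (X i)"
  shows "tendsto_L2 N X Y F \<longleftrightarrow> ((\<lambda>i. sq_norm N (\<lambda>x. X i x - Y x)) \<longlongrightarrow> 0) F"
proof -
  have "\<forall>\<^sub>F i in F. sq_norm N (\<lambda>x. X i x - Y x) = ennreal (\<integral>x. (X i x - Y x)\<^sup>2 \<partial>N)"
    using assms(2)
    by eventually_elim (use assms(1) in \<open>simp add: sq_norm_eq_integral square_integrable_diff\<close>)
  then have "((\<lambda>i. sq_norm N (\<lambda>x. X i x - Y x)) \<longlongrightarrow> 0) F
      \<longleftrightarrow> ((\<lambda>i. ennreal (\<integral>x. (X i x - Y x)\<^sup>2 \<partial>N)) \<longlongrightarrow> ennreal 0) F"
    by (subst filterlim_cong[OF refl refl]) (auto elim: eventually_mono)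
  also have "\<dots> \<longleftrightarrow> ((\<lambda>i. \<integral>x. (X i x - Y x)\<^sup>2 \<partial>N) \<longlongrightarrow> 0) F"
    by (rule tendsto_ennreal_iff) auto
  finally show ?thesis using assms by (simp add: tendsto_L2_def)
qed

lemma tendsto_L2_D:
  assumes "tendsto_L2 N X Y F"
  shows "square_integrable N Y" "\<forall>\<^sub>F i in F. square_integrable N (X i)"
    "((\<lambda>i. sq_norm N (\<lambda>x. X i x - Y x)) \<longlongrightarrow> 0) F"
  using assms tendsto_L2_iff[of N Y X F] by (auto simp: tendsto_L2_def)

lemma sq_norm_0_iff:
  assumes [measurable]: "f \<in> borel_measurable N"
  shows "sq_norm N f = 0 \<longleftrightarrow> (AE x in N. f x = 0)"
  unfolding sq_norm_def by (subst nn_integral_0_iff_AE) auto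

lemma tendsto_0_ennreal_le:
  fixes f g :: "'b \<Rightarrow> ennreal"
  assumes "(g \<longlongrightarrow> 0) F" "\<forall>\<^sub>F i in F. f i \<le> g i"
  shows "(f \<longlongrightarrow> 0) F"
  by (rule tendsto_sandwich[OF _ assms(2) tendsto_const assms(1)]) auto

lemma tendsto_0_combine:
  fixes f g :: "'b \<Rightarrow> ennreal"
  assumes "(f \<longlongrightarrow> 0) F" "(g \<longlongrightarrow> 0) F"
  shows "((\<lambda>i. 2 * f i + 2 * g i) \<longlongrightarrow> 0) F"
  using tendsto_add[OF ennreal_tendsto_cmult[of 2, OF _ assms(1)] ennreal_tendsto_cmult[of 2, OF _ assms(2)]]
  by simp

lemma tendsto_L2_unique:
  assumes X: "tendsto_L2 N X Y F" and X': "tendsto_L2 N X Y' F" and F: "F \<noteq> bot"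
  shows "AE x in N. Y x = Y' x"
proof -
  note m = tendsto_L2_D[OF X] tendsto_L2_D[OF X']
  have [measurable]: "Y \<in> borel_measurable N" "Y' \<in> borel_measurable N"
    using m by (auto simp: square_integrable_iff)
  have "\<forall>\<^sub>F i in F. sq_norm N (\<lambda>x. Y x - Y' x)
      \<le> 2 * sq_norm N (\<lambda>x. X i x - Y x) + 2 * sq_norm N (\<lambda>x. X i x - Y' x)"
    using m(2)
  proof eventually_elim
    case (elim i)
    then have [measurable]: "X i \<in> borel_measurable N" by (simp add: square_integrable_iff)
    show ?case
      using sq_norm_triangle[of Y N "X i" Y'] by (simp add: sq_norm_diff_commute[of N Y "X i"])
  qed
  then have "((\<lambda>i. sq_norm N (\<lambda>x. Y x - Y' x)) \<longlongrightarrow> 0) F"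
    by (rule tendsto_0_ennreal_le[OF tendsto_0_combine[OF m(3) m(6)]])
  then have "sq_norm N (\<lambda>x. Y x - Y' x) = 0"
    using tendsto_const_iff[OF F] by blast
  then show ?thesis by (subst (asm) sq_norm_0_iff) auto
qed

lemma tendsto_L2_cong_limit:
  assumes "tendsto_L2 N X Y F" "AE x in N. Y x = Y' x" "Y' \<in> borel_measurable N"
  shows "tendsto_L2 N X Y' F"
proof -
  note m = tendsto_L2_D[OF assms(1)]
  have "sq_norm N Y' = sq_norm N Y" "\<And>i. sq_norm N (\<lambda>x. X i x - Y' x) = sq_norm N (\<lambda>x. X i x - Y x)"
    by (rule sq_norm_cong_AE, use assms(2) in auto)+
  then show ?thesis
    using m assms(3) by (subst tendsto_L2_iff) (auto simp: square_integrable_iff)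
qed

lemma (in finite_measure) integrable_square_integrable:
  assumes "square_integrable M f"
  shows "integrable M f"
  using assms unfolding square_integrable_def by (blast intro: square_integrable_imp_integrable)

lemma (in prob_space) tendsto_L2_expectation:
  assumes "tendsto_L2 M X Y F"
  shows "((\<lambda>i. expectation (X i)) \<longlongrightarrow> expectation Y) F"
proof -
  note m = tendsto_L2_D[OF assms]
  have "\<forall>\<^sub>F i in F. (expectation (X i) - expectation Y)\<^sup>2 \<le> expectation (\<lambda>x. (X i x - Y x)\<^sup>2)"
    using m(2)
  proof eventually_elim
    case (elim i)
    have d: "square_integrable M (\<lambda>x. X i x - Y x)"
      by (rule square_integrable_diff) (use elim m in auto)
    have "expectation (X i) - expectation Y = expectation (\<lambda>x. X i x - Y x)"
      using integrable_square_integrable elim m(1) by simp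
    moreover have "variance (\<lambda>x. X i x - Y x) \<ge> 0"
      by (rule variance_positive)
    moreover have "variance (\<lambda>x. X i x - Y x)
        = expectation (\<lambda>x. (X i x - Y x)\<^sup>2) - (expectation (\<lambda>x. X i x - Y x))\<^sup>2"
      using variance_eq d integrable_square_integrable[OF d] by (simp add: square_integrable_def)
    ultimately show ?case by simp
  qed
  moreover have "((\<lambda>i. expectation (\<lambda>x. (X i x - Y x)\<^sup>2)) \<longlongrightarrow> 0) F"
    using assms by (simp add: tendsto_L2_def)
  ultimately have "((\<lambda>i. (expectation (X i) - expectation Y)\<^sup>2) \<longlongrightarrow> 0) F"
    using tendsto_sandwich[of "\<lambda>_. 0" "\<lambda>i. (expectation (X i) - expectation Y)\<^sup>2" F
      "\<lambda>i. expectation (\<lambda>x. (X i x - Y x)\<^sup>2)" 0] by simp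
  then have "((\<lambda>i. \<bar>expectation (X i) - expectation Y\<bar>) \<longlongrightarrow> 0) F"
    using tendsto_real_sqrt[of "\<lambda>i. (expectation (X i) - expectation Y)\<^sup>2" 0 F] by simp
  then show ?thesis
    by (simp add: tendsto_rabs_zero_iff LIM_zero_iff)
qed

lemma sq_norm_bounded_convergence:
  assumes N: "finite_measure N" and [measurable]: "\<And>k::nat. f k \<in> borel_measurable N" "g \<in> borel_measurable N"
    and C: "\<And>k x. x \<in> space N \<Longrightarrow> \<bar>f k x\<bar> \<le> C"
    and lim: "AE x in N. (\<lambda>k. f k x) \<longlonglongrightarrow> g x"
  shows "(\<lambda>k. sq_norm N (\<lambda>x. f k x - g x)) \<longlonglongrightarrow> 0"
proof -
  interpret finite_measure N by fact
  have "(\<lambda>k. \<integral>\<^sup>+x. ennreal ((f k x - g x)\<^sup>2) \<partial>N) \<longlonglongrightarrow> (\<integral>\<^sup>+x. 0 \<partial>N)"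
  proof (rule nn_integral_dominated_convergence[where w="\<lambda>_. ennreal ((2 * C)\<^sup>2)"])
    show "(\<integral>\<^sup>+x. ennreal ((2 * C)\<^sup>2) \<partial>N) < \<infinity>"
      by (simp add: emeasure_eq_measure ennreal_mult_less_top)
    show "AE x in N. ennreal ((f k x - g x)\<^sup>2) \<le> ennreal ((2 * C)\<^sup>2)" for k
      using lim AE_space
    proof eventually_elim
      case (elim x)
      have "\<bar>g x\<bar> \<le> C"
        by (rule LIMSEQ_le_const2[OF tendsto_rabs[OF elim(1)]]) (use C elim in auto)
      with C[OF elim(2), of k] have "\<bar>f k x - g x\<bar> \<le> \<bar>2 * C\<bar>" by simp
      then show ?case unfolding abs_le_square_iff by (rule ennreal_leI)
    qed
    show "AE x in N. (\<lambda>k. ennreal ((f k x - g x)\<^sup>2)) \<longlonglongrightarrow> 0"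
      using lim
    proof eventually_elim
      case (elim x)
      have "(\<lambda>k. (f k x - g x)\<^sup>2) \<longlonglongrightarrow> (g x - g x)\<^sup>2" by (intro tendsto_intros elim)
      then have "(\<lambda>k. ennreal ((f k x - g x)\<^sup>2)) \<longlonglongrightarrow> ennreal ((g x - g x)\<^sup>2)" by (rule tendsto_ennrealI)
      then show ?case by simp
    qed
  qed measurable
  then show ?thesis by (simp add: sq_norm_def)
qed

lemma summable_increments_convergent:
  fixes a :: "nat \<Rightarrow> real"
  assumes "summable (\<lambda>k. \<bar>a k - a (Suc k)\<bar>)"
  shows "convergent a"
proof -
  have "summable (\<lambda>k. a k - a (Suc k))"
    by (rule summable_rabs_cancel) (rule assms)
  then have "summable (\<lambda>k. - (a k - a (Suc k)))"
    by (rule summable_minus)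
  then have "convergent (\<lambda>n. \<Sum>k<n. a (Suc k) - a k)"
    unfolding minus_diff_eq summable_iff_convergent .
  moreover have "(\<lambda>n. \<Sum>k<n. a (Suc k) - a k) = (\<lambda>n. a n - a 0)"
    by (rule ext) (rule sum_lessThan_telescope)
  ultimately have "convergent (\<lambda>n. a n - a 0)" by simp
  from convergent_add[OF this convergent_const[of "a 0"]] show ?thesis by simp
qed

text \<open>
  Along a fast subsequence the increments are summable in mean, hence almost surely, which yields a
  pointwise limit; Fatou's lemma turns it into a mean square limit of the whole sequence. Taking pointwise limits
  keeps the variable measurable with respect to the smaller \<open>\<sigma>\<close>-algebra \<open>N\<close>.
\<close>

lemma (in prob_space) L2_complete:
  fixes X :: "nat \<Rightarrow> 'a \<Rightarrow> real" and c :: "nat \<Rightarrow> ennreal"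
  assumes sub: "subalgebra M N"
    and X: "\<And>n. X n \<in> borel_measurable N" "\<And>n. square_integrable M (X n)"
    and Cauchy: "\<And>n m. n \<le> m \<Longrightarrow> sq_norm M (\<lambda>x. X n x - X m x) \<le> c n" and c: "c \<longlonglongrightarrow> 0"
  obtains Y where "Y \<in> borel_measurable N" "tendsto_L2 M X Y sequentially"
proof -
  have [measurable]: "X n \<in> borel_measurable M" for n
    using X(2)[of n] unfolding square_integrable_iff by blast
  have "\<exists>n. \<forall>m\<ge>n. c m < ennreal ((1/4) ^ k)" for k
  proof -
    have "\<forall>\<^sub>F m in sequentially. c m < ennreal ((1/4) ^ k)"
      by (rule order_tendstoD(2)[OF c]) simp
    then show ?thesis by (simp add: eventually_sequentially)
  qed
  then obtain q where q: "\<And>k m. m \<ge> q k \<Longrightarrow> c m < ennreal ((1/4) ^ k)"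
    by metis
  \<comment> \<open>the summand \<open>k\<close> makes the subsequence eventually exceed any given index\<close>
  define r where "r k = k + (\<Sum>i\<le>k. q i)" for k
  have r_ge: "r k \<ge> q k" "r k \<ge> k" for k
    unfolding r_def using member_le_sum[of k "{..k}" q] by auto
  have r_mono: "r k \<le> r (Suc k)" for k unfolding r_def by simp
  have r_small: "sq_norm M (\<lambda>x. X (r k) x - X (r (Suc k)) x) \<le> ennreal ((1/4) ^ k)" for k
    using Cauchy[OF r_mono[of k]] q[OF r_ge(1)[of k]] by (meson less_imp_le order_trans)
  \<comment> \<open>the inequality of arithmetic and geometric means trades the square for the absolute value\<close>
  have L1: "(\<integral>\<^sup>+x. ennreal \<bar>X (r k) x - X (r (Suc k)) x\<bar> \<partial>M) \<le> 2 * ennreal ((1/2) ^ k)" for k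
  proof -
    have "\<bar>d\<bar> \<le> (1/2)^k + 2^k * d\<^sup>2" for d :: real
    proof -
      have "2 * \<bar>d\<bar> \<le> (1/2)^k + 2^k * d\<^sup>2"
      proof -
        have "0 \<le> 2^k * ((1/2)^k - \<bar>d\<bar>)\<^sup>2" by simp
        also have "\<dots> = (1/2)^k + 2^k * d\<^sup>2 - 2 * \<bar>d\<bar>"
          by (simp add: power2_eq_square algebra_simps power_one_over)
        finally show ?thesis by simp
      qed
      moreover have "(1/2)^k + 2^k * d\<^sup>2 \<ge> 0" by simp
      ultimately show ?thesis by simp
    qed
    then have "(\<integral>\<^sup>+x. ennreal \<bar>X (r k) x - X (r (Suc k)) x\<bar> \<partial>M)
      \<le> (\<integral>\<^sup>+x. ennreal ((1/2)^k) + ennreal (2^k) * ennreal ((X (r k) x - X (r (Suc k)) x)\<^sup>2) \<partial>M)"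
      by (intro nn_integral_mono)
        (simp add: ennreal_leI flip: ennreal_mult ennreal_plus)
    also have "\<dots> = ennreal ((1/2)^k) + ennreal (2^k) * sq_norm M (\<lambda>x. X (r k) x - X (r (Suc k)) x)"
      by (simp add: nn_integral_add nn_integral_cmult emeasure_space_1 sq_norm_def)
    also have "\<dots> \<le> ennreal ((1/2)^k) + ennreal (2^k) * ennreal ((1/4) ^ k)"
      by (intro add_left_mono mult_left_mono r_small) auto
    also have "ennreal (2^k) * ennreal ((1/4) ^ k) = ennreal ((1/2)^k)"
      by (subst ennreal_mult[symmetric]) (auto simp: power_mult_distrib[symmetric])
    finally show ?thesis by (simp add: mult_2)
  qed
  have "(\<integral>\<^sup>+x. (\<Sum>k. ennreal \<bar>X (r k) x - X (r (Suc k)) x\<bar>) \<partial>M)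
      = (\<Sum>k. \<integral>\<^sup>+x. ennreal \<bar>X (r k) x - X (r (Suc k)) x\<bar> \<partial>M)"
    by (rule nn_integral_suminf) simp
  also have "\<dots> \<le> (\<Sum>k. 2 * ennreal ((1/2) ^ k))"
    by (rule suminf_le) (use L1 in auto)
  also have "\<dots> = 2 * ennreal (\<Sum>k. (1/2) ^ k)"
    by (subst ennreal_suminf_cmult) (simp add: suminf_ennreal2 summable_geometric)
  also have "\<dots> < \<infinity>" by (simp add: ennreal_mult_less_top)
  finally have fin: "(\<integral>\<^sup>+x. (\<Sum>k. ennreal \<bar>X (r k) x - X (r (Suc k)) x\<bar>) \<partial>M) \<noteq> \<infinity>"
    by simp
  have "AE x in M. (\<Sum>k. ennreal \<bar>X (r k) x - X (r (Suc k)) x\<bar>) \<noteq> \<infinity>"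
    by (rule nn_integral_PInf_AE[OF _ fin]) measurable
  moreover have "convergent (\<lambda>k. X (r k) x)"
    if "(\<Sum>k. ennreal \<bar>X (r k) x - X (r (Suc k)) x\<bar>) \<noteq> \<infinity>" for x
  proof (rule summable_increments_convergent)
    show "summable (\<lambda>k. \<bar>X (r k) x - X (r (Suc k)) x\<bar>)"
      by (rule summable_suminf_not_top) (use that in auto)
  qed
  ultimately have conv: "AE x in M. convergent (\<lambda>k. X (r k) x)"
    by (auto elim: eventually_mono)
  define Y where "Y x = lim (\<lambda>k. X (r k) x)" for x
  have YN: "Y \<in> borel_measurable N"
    unfolding Y_def using X(1) by measurable
  then have [measurable]: "Y \<in> borel_measurable M"
    using sub measurable_from_subalg by blast
  have bound: "sq_norm M (\<lambda>x. X n x - Y x) \<le> c n" for n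
  proof -
    have lim: "ennreal ((X n x - Y x)\<^sup>2) = liminf (\<lambda>k. ennreal ((X n x - X (r k) x)\<^sup>2))"
      if "convergent (\<lambda>k. X (r k) x)" for x
    proof -
      have "(\<lambda>k. X (r k) x) \<longlonglongrightarrow> Y x" using that by (simp add: Y_def convergent_LIMSEQ_iff)
      then have "(\<lambda>k. ennreal ((X n x - X (r k) x)\<^sup>2)) \<longlonglongrightarrow> ennreal ((X n x - Y x)\<^sup>2)"
        by (intro tendsto_ennrealI tendsto_intros)
      then show ?thesis by (rule lim_imp_Liminf[OF sequentially_bot, symmetric])
    qed
    have "sq_norm M (\<lambda>x. X n x - Y x)
        = (\<integral>\<^sup>+x. liminf (\<lambda>k. ennreal ((X n x - X (r k) x)\<^sup>2)) \<partial>M)"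
      unfolding sq_norm_def
      by (rule nn_integral_cong_AE) (rule eventually_mono[OF conv lim])
    also have "\<dots> \<le> liminf (\<lambda>k. \<integral>\<^sup>+x. ennreal ((X n x - X (r k) x)\<^sup>2) \<partial>M)"
      by (rule nn_integral_liminf) simp
    also have "\<dots> \<le> c n"
    proof (rule order_trans[OF Liminf_le_Limsup Limsup_bounded])
      show "\<forall>\<^sub>F k in sequentially. (\<integral>\<^sup>+x. ennreal ((X n x - X (r k) x)\<^sup>2) \<partial>M) \<le> c n"
        unfolding sq_norm_def[symmetric]
        using eventually_ge_at_top[of n]
        by eventually_elim (rule Cauchy, rule order_trans, assumption, rule r_ge(2))
    qed simp
    finally show ?thesis .
  qed
  have "\<exists>n. c n < \<infinity>"
    using order_tendstoD(2)[OF c, of \<infinity>] by (auto simp: eventually_sequentially)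
  then obtain n where "c n < \<infinity>" by blast
  then have "sq_norm M (\<lambda>x. X n x - Y x) < \<infinity>"
    using bound[of n] by (rule order_le_less_trans[rotated])
  then have "square_integrable M (\<lambda>x. X n x - Y x)"
    by (simp add: square_integrable_iff)
  from square_integrable_diff[OF X(2)[of n] this] have "square_integrable M Y" by simp
  then have "tendsto_L2 M X Y sequentially"
    using tendsto_0_ennreal_le[OF c, of "\<lambda>n. sq_norm M (\<lambda>x. X n x - Y x)"] bound X(2)
    by (subst tendsto_L2_iff) auto
  then show thesis using that YN by blast
qed

section \<open>Independence of past and increment\<close>

context wiener_process
begin

abbreviation \<F> :: "real \<Rightarrow> 'a measure" where
  "\<F> \<equiv> natural_filtration M w"

lemma space_filtration [simp]: "space (\<F> t) = space M"
  unfolding natural_filtration_def by (rule space_measure_of) auto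

lemma sets_filtration:
  "sets (\<F> t) = sigma_sets (space M) {w r -` A \<inter> space M | r A. 0 \<le> r \<and> r \<le> t \<and> A \<in> sets borel}"
  unfolding natural_filtration_def by (rule sets_measure_of) auto

lemma w_measurable_filtration: "0 \<le> r \<Longrightarrow> r \<le> t \<Longrightarrow> w r \<in> borel_measurable (\<F> t)"
  by (rule measurableI) (auto simp: sets_filtration intro!: sigma_sets.Basic)

lemma subalgebra_filtration: "subalgebra M (\<F> t)"
proof -
  have "sigma_sets (space M) {w r -` A \<inter> space M | r A. 0 \<le> r \<and> r \<le> t \<and> A \<in> sets borel} \<subseteq> events"
    by (rule sets.sigma_sets_subset) (auto intro: measurable_sets random_variable_w)
  then show ?thesis by (simp add: subalgebra_def sets_filtration)
qed

lemma measurable_filtrationD: "f \<in> borel_measurable (\<F> t) \<Longrightarrow> f \<in> borel_measurable M"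
  by (rule measurable_from_subalg[OF subalgebra_filtration])

lemma sets_filtration_mono: "s \<le> t \<Longrightarrow> sets (\<F> s) \<subseteq> sets (\<F> t)"
  unfolding sets_filtration by (rule sigma_sets_mono') force

lemma measurable_filtration_mono:
  "f \<in> borel_measurable (\<F> s) \<Longrightarrow> s \<le> t \<Longrightarrow> f \<in> borel_measurable (\<F> t)"
  using sets_filtration_mono[of s t] by (auto simp: measurable_def)

text \<open>
  Independence is only given for the increments along a finite increasing sequence of times. Positions at finitely
  many times before \<open>s\<close> are sums of such increments because the path starts at zero almost surely.
\<close>

lemma increment_indep_cylinder:
  assumes st: "0 \<le> s" "s \<le> t" and K: "finite K" "K \<subseteq> {0..s}"
    and A: "\<And>r. A r \<in> sets borel" and B: "B \<in> sets borel"
  shows "prob ({\<omega> \<in> space M. \<forall>r\<in>K. w r \<omega> \<in> A r} \<inter> ((\<lambda>\<omega>. w t \<omega> - w s \<omega>) -` B \<inter> space M))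
    = prob {\<omega> \<in> space M. \<forall>r\<in>K. w r \<omega> \<in> A r} * prob ((\<lambda>\<omega>. w t \<omega> - w s \<omega>) -` B \<inter> space M)"
    (is "prob (?E \<inter> ?G) = _")
proof -
  \<comment> \<open>the times at which increments are taken; the last one is the increment from \<open>s\<close> to \<open>t\<close>\<close>
  define L where "L = 0 # sorted_list_of_set K @ [s, t]"
  define n where "n = Suc (length (sorted_list_of_set K))"
  \<comment> \<open>constant beyond the end of the list, so as to be increasing on all of the natural numbers\<close>
  define \<tau> where "\<tau> i = L ! min i (Suc n)" for i
  define D where "D i \<omega> = w (\<tau> (Suc i)) \<omega> - w (\<tau> i) \<omega>" for i \<omega>
  have len: "length L = Suc (Suc n)" by (simp add: L_def n_def)
  have "sorted L"
    using st K by (auto simp: L_def sorted_append)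
  then have "mono \<tau>"
    unfolding \<tau>_def by (intro monoI sorted_nth_mono) (auto simp: len)
  moreover have \<tau>0: "\<tau> 0 = 0" by (simp add: \<tau>_def L_def)
  moreover have \<tau>n: "\<tau> n = s" "\<tau> (Suc n) = t"
    by (auto simp: \<tau>_def L_def n_def nth_append)
  ultimately have ind: "indep_vars (\<lambda>_. borel) D {..<Suc n}"
    unfolding D_def by (intro independent_increments) auto
  have "\<exists>j\<le>n. \<tau> j = r" if "r \<in> K" for r
  proof -
    have "r \<in> set (sorted_list_of_set K)" using that K by simp
    then obtain j where j: "j < length (sorted_list_of_set K)" "sorted_list_of_set K ! j = r"
      by (auto simp: in_set_conv_nth)
    then have "\<tau> (Suc j) = r" by (simp add: \<tau>_def L_def n_def nth_append)
    then show ?thesis using j by (intro exI[of _ "Suc j"]) (simp add: n_def)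
  qed
  then obtain idx where idx: "\<And>r. r \<in> K \<Longrightarrow> idx r \<le> n \<and> \<tau> (idx r) = r" by metis
  have tele: "(\<Sum>i<idx r. D i \<omega>) = w r \<omega> - w 0 \<omega>" if "r \<in> K" for r \<omega>
    using sum_lessThan_telescope[of "\<lambda>i. w (\<tau> i) \<omega>" "idx r"] idx[OF that] \<tau>0 by (simp add: D_def)
  define P where "P = (\<Pi>\<^sub>M i\<in>{..<n}. borel :: real measure)"
  define Q where "Q = (\<Pi>\<^sub>M i\<in>{n}. borel :: real measure)"
  define C where "C = {f \<in> space P. \<forall>r\<in>K. (\<Sum>i<idx r. f i) \<in> A r}"
  define C' where "C' = {f \<in> space Q. f n \<in> B}"
  have "{f \<in> space P. (\<Sum>i<idx r. f i) \<in> A r} \<in> sets P" if "r \<in> K" for r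
  proof -
    have "(\<lambda>f. \<Sum>i<idx r. f i) \<in> borel_measurable P"
      unfolding P_def using idx[OF that]
      by (intro borel_measurable_sum measurable_component_singleton) auto
    from measurable_sets[OF this A[of r]] show ?thesis
      by (simp add: vimage_def Int_def conj_commute)
  qed
  then have C: "C \<in> sets P"
    unfolding C_def using K(1) by (intro sets.sets_Collect_finite_All) auto
  have "(\<lambda>f. f n) \<in> borel_measurable Q"
    unfolding Q_def by (rule measurable_component_singleton) simp
  from measurable_sets[OF this B] have C': "C' \<in> sets Q"
    by (simp add: C'_def vimage_def Int_def conj_commute)
  let ?X = "\<lambda>\<omega>. restrict (\<lambda>i. D i \<omega>) {..<n}" and ?Y = "\<lambda>\<omega>. restrict (\<lambda>i. D i \<omega>) {n}"
  have XY: "indep_var P ?X Q ?Y"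
    unfolding P_def Q_def by (rule indep_var_restrict[OF ind]) auto
  then have rv [measurable]: "?X \<in> measurable M P" "?Y \<in> measurable M Q"
    by (auto simp: indep_var_eq)
  have YG: "?Y -` C' \<inter> space M = ?G"
    using measurable_space[OF rv(2)] by (auto simp: C'_def D_def \<tau>n)
  have XE: "AE \<omega> in M. \<omega> \<in> ?X -` C \<inter> space M \<longleftrightarrow> \<omega> \<in> ?E"
    using start_zero AE_space
  proof eventually_elim
    case (elim \<omega>)
    have "(\<Sum>i<idx r. ?X \<omega> i) = w r \<omega>" if "r \<in> K" for r
    proof -
      have "(\<Sum>i<idx r. ?X \<omega> i) = (\<Sum>i<idx r. D i \<omega>)"
        using idx[OF that] by (intro sum.cong) auto
      then show ?thesis using tele[OF that] elim by simp
    qed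
    then show ?case using elim measurable_space[OF rv(1), of \<omega>] by (simp add: C_def)
  qed
  have E: "?E \<in> events"
  proof (rule sets.sets_Collect_finite_All[OF _ K(1)])
    fix r assume "r \<in> K"
    then have "w r \<in> borel_measurable M" using K(2) by (intro random_variable_w) auto
    from measurable_sets[OF this A[of r]] show "{\<omega> \<in> space M. w r \<omega> \<in> A r} \<in> events"
      by (simp add: vimage_def Int_def conj_commute)
  qed
  have G: "?G \<in> events" using C' rv(2) YG[symmetric] by (auto intro: measurable_sets)
  have XC: "?X -` C \<inter> space M \<in> events" using C rv(1) by (rule measurable_sets[rotated])
  have "prob (?E \<inter> ?G) = prob ((?X -` C \<inter> space M) \<inter> ?G)"
    by (rule finite_measure_eq_AE) (use XE E G XC in auto)
  also have "(?X -` C \<inter> space M) \<inter> ?G = (\<lambda>\<omega>. (?X \<omega>, ?Y \<omega>)) -` (C \<times> C') \<inter> space M"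
    unfolding YG[symmetric] by auto
  also have "prob \<dots> = prob (?X -` C \<inter> space M) * prob ?G"
    unfolding indep_varD[OF XY C C'] YG ..
  also have "prob (?X -` C \<inter> space M) = prob ?E"
    by (rule finite_measure_eq_AE) (use XE E XC in auto)
  finally show ?thesis .
qed

text \<open>
  Cylinder events form an intersection-stable generator of the past.
\<close>

lemma increment_indep_past:
  assumes st: "0 \<le> s" "s \<le> t" and X: "X \<in> borel_measurable (\<F> s)"
  shows "indep_var borel X borel (\<lambda>\<omega>. w t \<omega> - w s \<omega>)"
proof -
  let ?\<Delta> = "\<lambda>\<omega>. w t \<omega> - w s \<omega>"
  define cyl where "cyl = {{\<omega> \<in> space M. \<forall>r\<in>K. w r \<omega> \<in> A r} | K A.
    finite K \<and> K \<subseteq> {0..s} \<and> (\<forall>r. A r \<in> sets (borel :: real measure))}"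
  define pre where "pre = {?\<Delta> -` B \<inter> space M | B. B \<in> sets borel}"
  have [measurable]: "w t \<in> borel_measurable M" "w s \<in> borel_measurable M"
    using st by (auto intro: random_variable_w)
  have "Int_stable cyl"
  proof (rule Int_stableI)
    fix a b assume "a \<in> cyl" "b \<in> cyl"
    then obtain K A K' A' where *:
      "a = {\<omega> \<in> space M. \<forall>r\<in>K. w r \<omega> \<in> A r}" "finite K" "K \<subseteq> {0..s}" "\<And>r. A r \<in> sets borel"
      "b = {\<omega> \<in> space M. \<forall>r\<in>K'. w r \<omega> \<in> A' r}" "finite K'" "K' \<subseteq> {0..s}" "\<And>r. A' r \<in> sets borel"
      unfolding cyl_def by blast
    define A'' where "A'' r = (if r \<in> K then A r else UNIV) \<inter> (if r \<in> K' then A' r else UNIV)" for r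
    have "a \<inter> b = {\<omega> \<in> space M. \<forall>r\<in>K \<union> K'. w r \<omega> \<in> A'' r}"
      unfolding * A''_def by auto
    moreover have "A'' r \<in> sets borel" for r using * by (auto simp: A''_def)
    ultimately show "a \<inter> b \<in> cyl"
      unfolding cyl_def using *(2,3,6,7) by (intro CollectI exI[of _ "K \<union> K'"] exI[of _ A'']) simp
  qed
  moreover have "Int_stable pre"
  proof (rule Int_stableI)
    fix a b assume "a \<in> pre" "b \<in> pre"
    then obtain B B' where "a = ?\<Delta> -` B \<inter> space M" "b = ?\<Delta> -` B' \<inter> space M" "B \<in> sets borel" "B' \<in> sets borel"
      unfolding pre_def by blast
    then show "a \<inter> b \<in> pre" unfolding pre_def by (intro CollectI exI[of _ "B \<inter> B'"]) auto
  qed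
  moreover have "cyl \<subseteq> events"
    unfolding cyl_def
  proof safe
    fix K and A :: "real \<Rightarrow> real set"
    assume K: "finite K" "K \<subseteq> {0..s}" and A: "\<forall>r. A r \<in> sets borel"
    show "{\<omega> \<in> space M. \<forall>r\<in>K. w r \<omega> \<in> A r} \<in> events"
    proof (rule sets.sets_Collect_finite_All[OF _ K(1)])
      fix r assume "r \<in> K"
      then have "w r \<in> borel_measurable M" using K(2) by (intro random_variable_w) auto
      from measurable_sets[OF this, of "A r"] A show "{\<omega> \<in> space M. w r \<omega> \<in> A r} \<in> events"
        by (simp add: vimage_def Int_def conj_commute)
    qed
  qed
  moreover have "pre \<subseteq> events"
    unfolding pre_def by (auto intro!: measurable_sets)
  moreover have "prob (a \<inter> b) = prob a * prob b" if a: "a \<in> cyl" and b: "b \<in> pre" for a b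
  proof -
    obtain K A where "a = {\<omega> \<in> space M. \<forall>r\<in>K. w r \<omega> \<in> A r}" "finite K" "K \<subseteq> {0..s}" "\<And>r. A r \<in> sets borel"
      using a unfolding cyl_def by blast
    moreover obtain B where "b = ?\<Delta> -` B \<inter> space M" "B \<in> sets borel"
      using b unfolding pre_def by blast
    ultimately show ?thesis using increment_indep_cylinder[OF st, of K A B] by simp
  qed
  ultimately have ind: "indep_set (sigma_sets (space M) cyl) (sigma_sets (space M) pre)"
    by (intro indep_set_sigma_sets indep_setI)
  have gen: "{w r -` A \<inter> space M | r A. 0 \<le> r \<and> r \<le> s \<and> A \<in> sets borel} \<subseteq> cyl"
  proof safe
    fix r and A :: "real set" assume "0 \<le> r" "r \<le> s" "A \<in> sets borel"
    then show "w r -` A \<inter> space M \<in> cyl"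
      unfolding cyl_def by (intro CollectI exI[of _ "{r}"] exI[of _ "\<lambda>_. A"]) auto
  qed
  have "{X -` A \<inter> space M | A. A \<in> sets borel} \<subseteq> sets (\<F> s)"
    using measurable_sets[OF X] by auto
  also have "\<dots> \<subseteq> sigma_sets (space M) cyl"
    unfolding sets_filtration by (rule sigma_sets_mono') (rule gen)
  finally have "sigma_sets (space M) {X -` A \<inter> space M | A. A \<in> sets borel} \<subseteq> sigma_sets (space M) cyl"
    by (rule sigma_sets_mono)
  then have "indep_set (sigma_sets (space M) {X -` A \<inter> space M | A. A \<in> sets borel}) (sigma_sets (space M) pre)"
    using ind unfolding indep_sets2_eq by blast
  then show ?thesis
    unfolding indep_var_eq pre_def using measurable_filtrationD[OF X] by simp
qed

lemma increment_power:
  assumes "0 \<le> s" "s \<le> t"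
  shows increment_power_integrable: "integrable M (\<lambda>\<omega>. (w t \<omega> - w s \<omega>) ^ k)" (is ?int)
    and increment_power_even:
      "expectation (\<lambda>\<omega>. (w t \<omega> - w s \<omega>) ^ (2 * k)) = fact (2 * k) / (2 ^ k * fact k) * (t - s) ^ k" (is ?even)
    and increment_expectation: "expectation (\<lambda>\<omega>. w t \<omega> - w s \<omega>) = 0" (is ?centred)
proof -
  have "?int \<and> ?even \<and> ?centred"
  proof (cases "s = t")
    case True
    then show ?thesis by (cases "k = 0") (auto simp: power_0_left prob_space)
  next
    case False
    then have st: "s < t" using assms by simp
    note d = gaussian_increments[OF assms(1) st]
    have pos: "0 < sqrt (t - s)" using st by simp
    have ?int
      using distributed_integrable[OF d, of "\<lambda>x. x ^ k"] integrable_normal_moment[OF pos, of 0 k] by simp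
    moreover have ?even
      using distributed_integral[OF d, of "\<lambda>x. x ^ (2 * k)"] integral_normal_moment_even[OF pos, of 0 k] st
      by (simp add: power_divide)
    moreover have ?centred
      using distributed_integral[OF d, of "\<lambda>x. x"] integral_normal_moment_odd[OF pos, of 0 0] by simp
    ultimately show ?thesis by blast
  qed
  then show ?int ?even ?centred by blast+
qed

text \<open>
  A continuous path is the pointwise limit of its values at a discretised time, and these are measurable since
  the discretised time takes countably many values. Stated for any \<open>\<sigma>\<close>-algebra for which the positions are
  measurable; both the full one and the information at time \<open>t\<close> are used.
\<close>

lemma jointly_measurable:
  assumes sp: "space N = space M" and N: "\<And>r. 0 \<le> r \<Longrightarrow> r \<le> t \<Longrightarrow> w r \<in> borel_measurable N"
    and t: "0 \<le> t"
  shows "(\<lambda>(r, \<omega>). w r \<omega>) \<in> borel_measurable (restrict_space borel {0..t} \<Otimes>\<^sub>M N)"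
proof (rule borel_measurable_LIMSEQ_real)
  \<comment> \<open>clipped to \<open>[0,t]\<close>, so that positions are evaluated only where they are known to be measurable\<close>
  define \<rho> :: "nat \<Rightarrow> real \<Rightarrow> real" where "\<rho> n r = min t (max 0 (of_int \<lfloor>real (Suc n) * r\<rfloor> / real (Suc n)))" for n r
  show "(\<lambda>n. case x of (r, \<omega>) \<Rightarrow> w (\<rho> n r) \<omega>) \<longlonglongrightarrow> (case x of (r, \<omega>) \<Rightarrow> w r \<omega>)"
    if x: "x \<in> space (restrict_space borel {0..t} \<Otimes>\<^sub>M N)" for x
  proof -
    obtain r \<omega> where r: "x = (r, \<omega>)" "0 \<le> r" "r \<le> t" "\<omega> \<in> space M"
      using x by (auto simp: space_pair_measure space_restrict_space sp)
    have "\<bar>\<rho> n r - r\<bar> \<le> 1 / real (Suc n)" for n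
    proof -
      let ?q = "of_int \<lfloor>real (Suc n) * r\<rfloor> / real (Suc n)"
      have "of_int \<lfloor>N * r\<rfloor> / N \<le> r \<and> r - 1 / N \<le> of_int \<lfloor>N * r\<rfloor> / N \<and> 0 \<le> of_int \<lfloor>N * r\<rfloor> / N"
        if N: "0 < N" for N :: real
      proof -
        have "of_int \<lfloor>N * r\<rfloor> \<le> N * r" "N * r - 1 \<le> of_int \<lfloor>N * r\<rfloor>"
          by linarith+
        moreover have "0 \<le> \<lfloor>N * r\<rfloor>" using N r(2) by simp
        ultimately show ?thesis
          using N divide_right_mono[of "N * r - 1" "of_int \<lfloor>N * r\<rfloor>" N]
          by (auto simp: pos_divide_le_eq mult.commute diff_divide_distrib)
      qed
      from this[of "real (Suc n)"] have "?q \<le> r" "r - 1 / real (Suc n) \<le> ?q" "0 \<le> ?q"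
        by auto
      then show ?thesis unfolding \<rho>_def using r by linarith
    qed
    then have "\<forall>n. norm (\<rho> n r - r) \<le> 1 / real (Suc n)" by simp
    from Lim_null_comparison[OF always_eventually[OF this] LIMSEQ_Suc[OF lim_1_over_n]]
    have "(\<lambda>n. \<rho> n r) \<longlonglongrightarrow> r" by (rule LIM_zero_cancel)
    then have "(\<lambda>n. w (\<rho> n r) \<omega>) \<longlonglongrightarrow> w r \<omega>"
      by (rule continuous_on_tendsto_compose[OF continuous_paths[OF r(4)]])
        (use r t in \<open>auto simp: \<rho>_def\<close>)
    then show ?thesis by (simp add: r)
  qed
  show "(\<lambda>x. case x of (r, \<omega>) \<Rightarrow> w (\<rho> n r) \<omega>) \<in> borel_measurable (restrict_space borel {0..t} \<Otimes>\<^sub>M N)" for n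
  proof -
    have *: "(\<lambda>x. w (min t (max 0 (of_int k / real (Suc n)))) (snd x))
        \<in> borel_measurable (restrict_space borel {0..t} \<Otimes>\<^sub>M N)" for k :: int
      by (rule measurable_compose[OF measurable_snd N]) (use t in auto)
    have id: "(\<lambda>r::real. r) \<in> borel_measurable (restrict_space borel {0..t})"
      by (rule measurable_restrict_space1) simp
    have g: "(\<lambda>x. \<lfloor>real (Suc n) * fst x\<rfloor>)
        \<in> measurable (restrict_space borel {0..t} \<Otimes>\<^sub>M N) (count_space UNIV)"
      by (rule measurable_compose[OF borel_measurable_times[OF borel_measurable_const
          measurable_compose[OF measurable_fst id]] measurable_real_floor])
    show ?thesis
      unfolding \<rho>_def case_prod_beta
      by (rule measurable_compose_countable[OF * g])
  qed
qed

end

section \<open>The isometry and uniqueness of the stochastic integral\<close>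

text \<open>
  The order of the factors is chosen so that integrating over time comes first, as in \<open>mean_square\<close>.
\<close>

definition path_measure :: "'a measure \<Rightarrow> real \<Rightarrow> ('a \<times> real) measure" where
  "path_measure M t = M \<Otimes>\<^sub>M restrict_space lborel {0..t}"

definition process_measurable :: "'a measure \<Rightarrow> real \<Rightarrow> (real \<Rightarrow> 'a \<Rightarrow> real) \<Rightarrow> bool" where
  "process_measurable M t v \<longleftrightarrow>
     (\<lambda>(r, \<omega>). v r \<omega>) \<in> borel_measurable (restrict_space borel {0..t} \<Otimes>\<^sub>M M)"

lemma process_measurable_path:
  assumes "process_measurable M t v"
  shows "(\<lambda>(\<omega>, r). v r \<omega>) \<in> borel_measurable (path_measure M t)"
proof -
  have "sets (restrict_space lborel {0..t} \<Otimes>\<^sub>M M) = sets (restrict_space borel {0..t} \<Otimes>\<^sub>M M)"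
    by (intro sets_pair_measure_cong sets_restrict_space_cong) simp_all
  then have "(\<lambda>(r, \<omega>). v r \<omega>) \<in> borel_measurable (restrict_space lborel {0..t} \<Otimes>\<^sub>M M)"
    using assms unfolding process_measurable_def by (simp cong: measurable_cong_sets)
  from measurable_pair_swap[OF this] show ?thesis
    by (simp add: path_measure_def case_prod_beta)
qed

lemma sigma_finite_restrict_lborel: "sigma_finite_measure (restrict_space lborel {0..t::real})"
  by (rule sigma_finite_measure_restrict_space) (auto intro: sigma_finite_lborel)

lemma mean_square_eq:
  assumes "process_measurable M t v"
  shows "mean_square M t v = sq_norm (path_measure M t) (\<lambda>(\<omega>, r). v r \<omega>)"
proof -
  interpret L: sigma_finite_measure "restrict_space lborel {0..t}"
    by (rule sigma_finite_restrict_lborel)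
  have m: "(\<lambda>x. ennreal ((case x of (\<omega>, r) \<Rightarrow> v r \<omega>)\<^sup>2)) \<in> borel_measurable (M \<Otimes>\<^sub>M restrict_space lborel {0..t})"
    using process_measurable_path[OF assms] unfolding path_measure_def by measurable
  show ?thesis
    unfolding mean_square_def sq_norm_def path_measure_def
    using L.nn_integral_fst[OF m] by (simp add: nn_integral_restrict_space)
qed

lemma process_measurable_diff:
  "process_measurable M t v \<Longrightarrow> process_measurable M t v' \<Longrightarrow> process_measurable M t (\<lambda>r \<omega>. v r \<omega> - v' r \<omega>)"
  unfolding process_measurable_def case_prod_beta by simp

text \<open>
  Approximate isometry survives limits: if two sequences of pairs are at equal distances and converge, then the
  distance of the limits on one side is controlled by the distance on the other side. It is used in both
  directions between random variables and integrands.
\<close>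

lemma sq_norm_quasi_isometry:
  assumes [measurable]: "X \<in> borel_measurable N" "X' \<in> borel_measurable N" "V \<in> borel_measurable P" "V' \<in> borel_measurable P"
    "\<And>k::nat. Xs k \<in> borel_measurable N" "\<And>k. Xs' k \<in> borel_measurable N"
    "\<And>k. Vs k \<in> borel_measurable P" "\<And>k. Vs' k \<in> borel_measurable P"
    and lim: "(\<lambda>k. sq_norm N (\<lambda>x. Xs k x - X x)) \<longlonglongrightarrow> 0" "(\<lambda>k. sq_norm N (\<lambda>x. Xs' k x - X' x)) \<longlonglongrightarrow> 0"
      "(\<lambda>k. sq_norm P (\<lambda>x. Vs k x - V x)) \<longlonglongrightarrow> 0" "(\<lambda>k. sq_norm P (\<lambda>x. Vs' k x - V' x)) \<longlonglongrightarrow> 0"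
    and iso: "\<And>k. sq_norm N (\<lambda>x. Xs k x - Xs' k x) = sq_norm P (\<lambda>x. Vs k x - Vs' k x)"
  shows "sq_norm N (\<lambda>x. X x - X' x) \<le> 16 * sq_norm P (\<lambda>x. V x - V' x)"
proof -
  let ?a = "\<lambda>k. sq_norm N (\<lambda>x. Xs k x - X x)" and ?b = "\<lambda>k. sq_norm N (\<lambda>x. Xs' k x - X' x)"
    and ?c = "\<lambda>k. sq_norm P (\<lambda>x. Vs k x - V x)" and ?d = "\<lambda>k. sq_norm P (\<lambda>x. Vs' k x - V' x)"
    and ?D = "sq_norm P (\<lambda>x. V x - V' x)"
  have "sq_norm N (\<lambda>x. X x - X' x) \<le> 2 * ?a k + 4 * ?b k + 8 * ?c k + 16 * ?d k + 16 * ?D" for k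
  proof -
    have 1: "sq_norm N (\<lambda>x. X x - X' x) \<le> 2 * ?a k + 2 * sq_norm N (\<lambda>x. Xs k x - X' x)"
      using sq_norm_triangle[of X N "Xs k" X'] by (simp add: sq_norm_diff_commute[of N X "Xs k"])
    have 2: "sq_norm N (\<lambda>x. Xs k x - X' x) \<le> 2 * ?b k + 2 * sq_norm P (\<lambda>x. Vs k x - Vs' k x)"
      using sq_norm_triangle[of "Xs k" N "Xs' k" X'] by (simp add: iso add.commute)
    have 3: "sq_norm P (\<lambda>x. Vs k x - Vs' k x) \<le> 2 * ?c k + 2 * sq_norm P (\<lambda>x. V x - Vs' k x)"
      by (rule sq_norm_triangle) measurable
    have 4: "sq_norm P (\<lambda>x. V x - Vs' k x) \<le> 2 * ?d k + 2 * ?D"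
      using sq_norm_triangle[of V P V' "Vs' k"] by (simp add: sq_norm_diff_commute[of P V' "Vs' k"] add.commute)
    have step: "p \<le> u + 2 * q' " if "p \<le> u + 2 * q" "q \<le> q'" for p q q' u :: ennreal
      using that by (meson add_left_mono mult_left_mono order_trans zero_le)
    have "sq_norm N (\<lambda>x. X x - X' x) \<le> 2 * ?a k + 2 * (2 * ?b k + 2 * (2 * ?c k + 2 * (2 * ?d k + 2 * ?D)))"
      by (rule step[OF 1 step[OF 2 step[OF 3 4]]])
    then show ?thesis by (simp add: distrib_left ac_simps flip: mult.assoc)
  qed
  moreover have "(\<lambda>k. 2 * ?a k + 4 * ?b k + 8 * ?c k + 16 * ?d k + 16 * ?D) \<longlonglongrightarrow> 2 * 0 + 4 * 0 + 8 * 0 + 16 * 0 + 16 * ?D"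
    by (intro tendsto_add ennreal_tendsto_cmult lim tendsto_const) simp_all
  ultimately show ?thesis
    using LIMSEQ_le_const[of _ "2 * 0 + 4 * 0 + 8 * 0 + 16 * 0 + 16 * ?D"] by fastforce
qed

lemma chain_mono:
  fixes \<tau> :: "nat \<Rightarrow> real"
  assumes "\<forall>i<n. \<tau> i \<le> \<tau> (Suc i)" "i \<le> j" "j \<le> n"
  shows "\<tau> i \<le> \<tau> j"
  using assms(2,3)
proof (induction j rule: dec_induct)
  case (step m)
  then show ?case using assms(1) by (auto intro: order_trans[of _ "\<tau> m"])
qed simp

context wiener_process
begin

lemma past_increment_product:
  fixes \<zeta> :: "'a \<Rightarrow> real" and g :: "real \<Rightarrow> real"
  assumes st: "0 \<le> s" "s \<le> t" and \<zeta>: "\<zeta> \<in> borel_measurable (\<F> s)" "integrable M \<zeta>"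
    and g: "g \<in> borel_measurable borel" "integrable M (\<lambda>\<omega>. g (w t \<omega> - w s \<omega>))"
  shows "integrable M (\<lambda>\<omega>. \<zeta> \<omega> * g (w t \<omega> - w s \<omega>))"
    and "expectation (\<lambda>\<omega>. \<zeta> \<omega> * g (w t \<omega> - w s \<omega>))
      = expectation \<zeta> * expectation (\<lambda>\<omega>. g (w t \<omega> - w s \<omega>))"
proof -
  have "indep_var borel ((\<lambda>x. x) \<circ> \<zeta>) borel (g \<circ> (\<lambda>\<omega>. w t \<omega> - w s \<omega>))"
    by (rule indep_var_compose[OF increment_indep_past[OF st \<zeta>(1)]]) (use g in auto)
  then have ind: "indep_var borel \<zeta> borel (\<lambda>\<omega>. g (w t \<omega> - w s \<omega>))"
    by (simp add: comp_def)
  show "integrable M (\<lambda>\<omega>. \<zeta> \<omega> * g (w t \<omega> - w s \<omega>))"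
    by (rule indep_var_integrable[OF ind \<zeta>(2) g(2)])
  show "expectation (\<lambda>\<omega>. \<zeta> \<omega> * g (w t \<omega> - w s \<omega>))
      = expectation \<zeta> * expectation (\<lambda>\<omega>. g (w t \<omega> - w s \<omega>))"
    by (rule indep_var_lebesgue_integral[OF ind \<zeta>(2) g(2)])
qed

text \<open>
  The admissible values of a step process from time \<open>s\<close> on.
\<close>

definition known_bounded :: "real \<Rightarrow> ('a \<Rightarrow> real) \<Rightarrow> bool" where
  "known_bounded s \<xi> \<longleftrightarrow> \<xi> \<in> borel_measurable (\<F> s) \<and> (\<exists>C. \<forall>\<omega>\<in>space M. \<bar>\<xi> \<omega>\<bar> \<le> C)"

lemma known_bounded_measurable:
  "known_bounded s \<xi> \<Longrightarrow> \<xi> \<in> borel_measurable M"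
  unfolding known_bounded_def using measurable_filtrationD by blast

lemma known_bounded_mono: "known_bounded s \<xi> \<Longrightarrow> s \<le> t \<Longrightarrow> known_bounded t \<xi>"
  unfolding known_bounded_def using measurable_filtration_mono by blast

lemma known_bounded_mult:
  assumes "known_bounded s \<xi>" "known_bounded s \<eta>"
  shows "known_bounded s (\<lambda>\<omega>. \<xi> \<omega> * \<eta> \<omega>)"
proof -
  obtain C D where CD: "\<And>\<omega>. \<omega> \<in> space M \<Longrightarrow> \<bar>\<xi> \<omega>\<bar> \<le> C" "\<And>\<omega>. \<omega> \<in> space M \<Longrightarrow> \<bar>\<eta> \<omega>\<bar> \<le> D"
    using assms unfolding known_bounded_def by blast
  have "\<bar>\<xi> \<omega> * \<eta> \<omega>\<bar> \<le> C * D" if "\<omega> \<in> space M" for \<omega>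
    unfolding abs_mult using CD[OF that] by (intro mult_mono) auto
  then show ?thesis using assms unfolding known_bounded_def by (auto intro!: borel_measurable_times)
qed

lemma known_bounded_integrable_mult:
  assumes \<xi>: "known_bounded s \<xi>" and f: "integrable M f"
  shows "integrable M (\<lambda>\<omega>. \<xi> \<omega> * f \<omega>)"
proof -
  obtain C where C: "\<And>\<omega>. \<omega> \<in> space M \<Longrightarrow> \<bar>\<xi> \<omega>\<bar> \<le> C"
    using \<xi> unfolding known_bounded_def by blast
  have [measurable]: "\<xi> \<in> borel_measurable M" using \<xi> by (rule known_bounded_measurable)
  show ?thesis
  proof (rule Bochner_Integration.integrable_bound)
    show "integrable M (\<lambda>\<omega>. C * f \<omega>)" using f by simp
    show "(\<lambda>\<omega>. \<xi> \<omega> * f \<omega>) \<in> borel_measurable M" using f by measurable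
    show "AE \<omega> in M. norm (\<xi> \<omega> * f \<omega>) \<le> norm (C * f \<omega>)"
    proof (rule AE_I2)
      fix \<omega> assume "\<omega> \<in> space M"
      from C[OF this] show "norm (\<xi> \<omega> * f \<omega>) \<le> norm (C * f \<omega>)"
        unfolding real_norm_def abs_mult by (intro mult_right_mono) auto
    qed
  qed
qed

lemma known_bounded_integrable: "known_bounded s \<xi> \<Longrightarrow> integrable M \<xi>"
  using known_bounded_integrable_mult[of s \<xi> "\<lambda>_. 1"] by simp

lemma increment_integrable:
  assumes "0 \<le> s" "s \<le> t"
  shows "integrable M (\<lambda>\<omega>. w t \<omega> - w s \<omega>)" "integrable M (\<lambda>\<omega>. (w t \<omega> - w s \<omega>)\<^sup>2)"
  using increment_power_integrable[OF assms, of 1] increment_power_integrable[OF assms, of 2] by simp_all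

lemma increment_variance:
  assumes "0 \<le> s" "s \<le> t"
  shows "expectation (\<lambda>\<omega>. (w t \<omega> - w s \<omega>)\<^sup>2) = t - s"
  using increment_power_even[OF assms, of 1] by simp

lemma past_increment_covariance:
  assumes t: "0 \<le> s" "s \<le> t" and \<zeta>: "known_bounded s \<zeta>"
  shows "integrable M (\<lambda>\<omega>. \<zeta> \<omega> * (w t \<omega> - w s \<omega>)\<^sup>2)"
    "expectation (\<lambda>\<omega>. \<zeta> \<omega> * (w t \<omega> - w s \<omega>)\<^sup>2) = expectation \<zeta> * (t - s)"
    "\<And>r r'. 0 \<le> r \<Longrightarrow> r \<le> r' \<Longrightarrow> r' \<le> s \<Longrightarrow> integrable M (\<lambda>\<omega>. \<zeta> \<omega> * (w r' \<omega> - w r \<omega>) * (w t \<omega> - w s \<omega>))"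
    "\<And>r r'. 0 \<le> r \<Longrightarrow> r \<le> r' \<Longrightarrow> r' \<le> s \<Longrightarrow> expectation (\<lambda>\<omega>. \<zeta> \<omega> * (w r' \<omega> - w r \<omega>) * (w t \<omega> - w s \<omega>)) = 0"
proof -
  have m: "\<zeta> \<in> borel_measurable (\<F> s)" using \<zeta> by (simp add: known_bounded_def)
  note i = known_bounded_integrable[OF \<zeta>]
  show "integrable M (\<lambda>\<omega>. \<zeta> \<omega> * (w t \<omega> - w s \<omega>)\<^sup>2)"
    "expectation (\<lambda>\<omega>. \<zeta> \<omega> * (w t \<omega> - w s \<omega>)\<^sup>2) = expectation \<zeta> * (t - s)"
    using past_increment_product[OF t m i, of power2] increment_integrable[OF t] increment_variance[OF t]
    by auto
  fix r r' assume r: "0 \<le> r" "r \<le> r'" "r' \<le> s"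
  have "(\<lambda>\<omega>. \<zeta> \<omega> * (w r' \<omega> - w r \<omega>)) \<in> borel_measurable (\<F> s)"
    using r by (intro borel_measurable_times borel_measurable_diff m w_measurable_filtration) auto
  moreover have "integrable M (\<lambda>\<omega>. \<zeta> \<omega> * (w r' \<omega> - w r \<omega>))"
    by (rule known_bounded_integrable_mult[OF \<zeta> increment_integrable(1)]) (use r in auto)
  ultimately show "integrable M (\<lambda>\<omega>. \<zeta> \<omega> * (w r' \<omega> - w r \<omega>) * (w t \<omega> - w s \<omega>))"
    "expectation (\<lambda>\<omega>. \<zeta> \<omega> * (w r' \<omega> - w r \<omega>) * (w t \<omega> - w s \<omega>)) = 0"
    using past_increment_product[OF t, of "\<lambda>\<omega>. \<zeta> \<omega> * (w r' \<omega> - w r \<omega>)" "\<lambda>x. x"]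
      increment_integrable[OF t] increment_expectation[OF t] by auto
qed

text \<open>
  The increments over two arbitrary intervals are correlated through the common part only. Allowing
  arbitrary pairs of intervals is what makes a common refinement of two partitions superfluous later.
\<close>

lemma increment_covariance:
  assumes ab: "0 \<le> a" "a \<le> b" and cd: "0 \<le> c" "c \<le> d"
    and \<xi>: "known_bounded a \<xi>" and \<eta>: "known_bounded c \<eta>"
  shows "has_bochner_integral M (\<lambda>\<omega>. (\<xi> \<omega> * (w b \<omega> - w a \<omega>)) * (\<eta> \<omega> * (w d \<omega> - w c \<omega>)))
    (expectation (\<lambda>\<omega>. \<xi> \<omega> * \<eta> \<omega>) * measure lborel ({a<..b} \<inter> {c<..d}))"
proof -
  have *: "has_bochner_integral M (\<lambda>\<omega>. (\<xi> \<omega> * (w b \<omega> - w a \<omega>)) * (\<eta> \<omega> * (w d \<omega> - w c \<omega>)))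
      (expectation (\<lambda>\<omega>. \<xi> \<omega> * \<eta> \<omega>) * measure lborel ({a<..b} \<inter> {c<..d}))"
    if ab: "0 \<le> a" "a \<le> b" and cd: "c \<le> d" and \<xi>: "known_bounded a \<xi>" and \<eta>: "known_bounded c \<eta>" and ac: "a \<le> c"
    for a b c d \<xi> \<eta>
  proof -
    have c0: "0 \<le> c" using ab ac by simp
    define \<zeta> where "\<zeta> \<omega> = \<xi> \<omega> * \<eta> \<omega>" for \<omega>
    have \<zeta>: "known_bounded c \<zeta>"
      unfolding \<zeta>_def by (intro known_bounded_mult known_bounded_mono[OF \<xi> ac] \<eta>)
    show ?thesis
    proof (cases "b \<le> c")
      case True
      have int: "{a<..b} \<inter> {c<..d} = {}" using True by auto
      show ?thesis
        unfolding int measure_empty mult_zero_right has_bochner_integral_iff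
        using past_increment_covariance(3,4)[OF c0 cd \<zeta> ab True] by (simp add: \<zeta>_def mult_ac)
    next
      case False
      \<comment> \<open>\<open>(c, m]\<close> is the common part of the two intervals; both increments are split at its ends\<close>
      define m where "m = min b d"
      have m: "c \<le> m" "0 \<le> m" "m \<le> b" "m \<le> d" using False cd c0 by (auto simp: m_def)
      have int: "{a<..b} \<inter> {c<..d} = {c<..m}" using ac by (auto simp: m_def)
      note \<zeta>m = known_bounded_mono[OF \<zeta> m(1)]
      have "(\<xi> \<omega> * (w b \<omega> - w a \<omega>)) * (\<eta> \<omega> * (w d \<omega> - w c \<omega>)) =
        \<zeta> \<omega> * (w c \<omega> - w a \<omega>) * (w d \<omega> - w c \<omega>) + \<zeta> \<omega> * (w m \<omega> - w c \<omega>)\<^sup>2 +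
        \<zeta> \<omega> * (w m \<omega> - w c \<omega>) * (w d \<omega> - w m \<omega>) + \<zeta> \<omega> * (w m \<omega> - w c \<omega>) * (w b \<omega> - w m \<omega>)" for \<omega>
      proof -
        have "(w b \<omega> - w m \<omega>) * (w d \<omega> - w m \<omega>) = 0" by (auto simp: m_def min_def)
        then show ?thesis
          unfolding \<zeta>_def power2_eq_square by algebra
      qed
      moreover have "has_bochner_integral M (\<lambda>\<omega>. \<zeta> \<omega> * (w c \<omega> - w a \<omega>) * (w d \<omega> - w c \<omega>) +
          \<zeta> \<omega> * (w m \<omega> - w c \<omega>)\<^sup>2 + \<zeta> \<omega> * (w m \<omega> - w c \<omega>) * (w d \<omega> - w m \<omega>) +
          \<zeta> \<omega> * (w m \<omega> - w c \<omega>) * (w b \<omega> - w m \<omega>)) (0 + expectation \<zeta> * (m - c) + 0 + 0)"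
        by (intro has_bochner_integral_add; unfold has_bochner_integral_iff)
          (use past_increment_covariance(3,4)[OF c0 cd \<zeta> ab(1) ac order_refl] past_increment_covariance(1,2)[OF c0 m(1) \<zeta>]
             past_increment_covariance(3,4)[OF m(2,4) \<zeta>m c0 m(1) order_refl]
             past_increment_covariance(3,4)[OF m(2,3) \<zeta>m c0 m(1) order_refl] in blast)+
      ultimately show ?thesis
        unfolding int using m by (simp add: \<zeta>_def[symmetric, abs_def])
    qed
  qed
  show ?thesis
  proof (cases "a \<le> c")
    case True
    then show ?thesis using *[OF ab cd(2) \<xi> \<eta>] by blast
  next
    case False
    then show ?thesis
      using *[OF cd ab(2) \<eta> \<xi>] by (simp add: mult.commute Int_commute)
  qed
qed

text \<open>
  The index set is any finite set and the intervals may overlap in any way. Hence the difference of two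
  step processes with unrelated partitions is covered: its index set is the disjoint union.
\<close>

lemma step_isometry:
  fixes a b :: "'k \<Rightarrow> real" and \<zeta> :: "'k \<Rightarrow> 'a \<Rightarrow> real"
  assumes A: "finite A" and ab: "\<And>k. k \<in> A \<Longrightarrow> 0 \<le> a k \<and> a k \<le> b k \<and> b k \<le> t"
    and \<zeta>: "\<And>k. k \<in> A \<Longrightarrow> known_bounded (a k) (\<zeta> k)"
  defines "V \<equiv> \<lambda>r \<omega>. \<Sum>k\<in>A. \<zeta> k \<omega> * indicator {a k<..b k} r"
    and "S \<equiv> \<lambda>\<omega>. \<Sum>k\<in>A. \<zeta> k \<omega> * (w (b k) \<omega> - w (a k) \<omega>)"
  shows "square_integrable M S" "mean_square M t V = sq_norm M S"
    "expectation S = 0" "process_measurable M t V"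
proof -
  define q where "q k l = measure lborel ({a k<..b k} \<inter> {a l<..b l})" for k l
  have S2: "has_bochner_integral M (\<lambda>\<omega>. (S \<omega>)\<^sup>2)
      (\<Sum>k\<in>A. \<Sum>l\<in>A. expectation (\<lambda>\<omega>. \<zeta> k \<omega> * \<zeta> l \<omega>) * q k l)"
    unfolding S_def power2_eq_square sum_product q_def
  proof (intro has_bochner_integral_sum)
    fix k l assume k: "k \<in> A" and l: "l \<in> A"
    show "has_bochner_integral M
        (\<lambda>\<omega>. \<zeta> k \<omega> * (w (b k) \<omega> - w (a k) \<omega>) * (\<zeta> l \<omega> * (w (b l) \<omega> - w (a l) \<omega>)))
        (expectation (\<lambda>\<omega>. \<zeta> k \<omega> * \<zeta> l \<omega>) * measure lborel ({a k<..b k} \<inter> {a l<..b l}))"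
      using increment_covariance[OF _ _ _ _ \<zeta>[OF k] \<zeta>[OF l]] ab[OF k] ab[OF l] by blast
  qed
  have int: "integrable M (\<lambda>\<omega>. \<zeta> k \<omega> * (w (b k) \<omega> - w (a k) \<omega>)) \<and>
    expectation (\<lambda>\<omega>. \<zeta> k \<omega> * (w (b k) \<omega> - w (a k) \<omega>)) = 0" if k: "k \<in> A" for k
  proof -
    have le: "0 \<le> a k" "a k \<le> b k" using ab[OF k] by blast+
    have m: "\<zeta> k \<in> borel_measurable (\<F> (a k))" using \<zeta>[OF k] by (simp add: known_bounded_def)
    note p = past_increment_product[OF le m known_bounded_integrable[OF \<zeta>[OF k]], of "\<lambda>x. x"]
    show ?thesis
      using p increment_integrable(1)[OF le] increment_expectation[OF le] by simp
  qed
  have Sm: "S \<in> borel_measurable M"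
    unfolding S_def using int by (intro borel_measurable_sum borel_measurable_integrable) blast
  show "expectation S = 0"
    unfolding S_def using int by (subst Bochner_Integration.integral_sum) auto
  show sq: "square_integrable M S"
    unfolding square_integrable_def using S2 Sm by (auto simp: has_bochner_integral_iff)
  define Q where "Q \<omega> = (\<Sum>k\<in>A. \<Sum>l\<in>A. \<zeta> k \<omega> * \<zeta> l \<omega> * q k l)" for \<omega>
  have V2: "has_bochner_integral lborel (\<lambda>r. (V r \<omega>)\<^sup>2) (Q \<omega>)" for \<omega>
  proof -
    have "has_bochner_integral lborel (\<lambda>r. \<Sum>k\<in>A. \<Sum>l\<in>A. \<zeta> k \<omega> * \<zeta> l \<omega> * indicator ({a k<..b k} \<inter> {a l<..b l}) r) (Q \<omega>)"
      unfolding q_def Q_def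
    proof (intro has_bochner_integral_sum has_bochner_integral_mult_right has_bochner_integral_real_indicator)
      fix k l assume "k \<in> A" "l \<in> A"
      have "emeasure lborel ({a k<..b k} \<inter> {a l<..b l}) \<le> emeasure lborel {a k<..b k}"
        by (intro emeasure_mono) auto
      also have "\<dots> < \<infinity>" using ab[OF \<open>k \<in> A\<close>] by simp
      finally show "emeasure lborel ({a k<..b k} \<inter> {a l<..b l}) < \<infinity>" .
    qed auto
    also have "(\<lambda>r. \<Sum>k\<in>A. \<Sum>l\<in>A. \<zeta> k \<omega> * \<zeta> l \<omega> * indicator ({a k<..b k} \<inter> {a l<..b l}) r) = (\<lambda>r. (V r \<omega>)\<^sup>2)"
      unfolding V_def power2_eq_square sum_product
      by (intro ext sum.cong refl) (simp only: indicator_inter_arith mult_ac)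
    finally show ?thesis .
  qed
  have inner: "(\<integral>\<^sup>+r\<in>{0..t}. ennreal ((V r \<omega>)\<^sup>2) \<partial>lborel) = ennreal (Q \<omega>)" for \<omega>
  proof -
    have "(\<integral>\<^sup>+r\<in>{0..t}. ennreal ((V r \<omega>)\<^sup>2) \<partial>lborel) = (\<integral>\<^sup>+r. ennreal ((V r \<omega>)\<^sup>2) \<partial>lborel)"
    proof (rule nn_integral_cong)
      fix r
      have "V r \<omega> = 0" if "r \<notin> {0..t}"
        unfolding V_def
      proof (rule sum.neutral, rule ballI)
        fix k assume "k \<in> A"
        from ab[OF this] that show "\<zeta> k \<omega> * indicator {a k<..b k} r = 0" by (auto simp: indicator_def)
      qed
      then show "ennreal ((V r \<omega>)\<^sup>2) * indicator {0..t} r = ennreal ((V r \<omega>)\<^sup>2)"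
        by (auto simp: indicator_def)
    qed
    also have "\<dots> = ennreal (\<integral>r. (V r \<omega>)\<^sup>2 \<partial>lborel)"
      by (rule nn_integral_eq_integral) (use V2[of \<omega>] in \<open>auto simp: has_bochner_integral_iff\<close>)
    finally show ?thesis using V2[of \<omega>] by (simp add: has_bochner_integral_iff)
  qed
  have nonneg: "0 \<le> Q \<omega>" for \<omega>
    using has_bochner_integral_integral_eq[OF V2[of \<omega>]] by (metis integral_nonneg_AE AE_I2 zero_le_power2)
  have "has_bochner_integral M Q (\<Sum>k\<in>A. \<Sum>l\<in>A. expectation (\<lambda>\<omega>. \<zeta> k \<omega> * \<zeta> l \<omega>) * q k l)"
    unfolding Q_def
  proof (intro has_bochner_integral_sum has_bochner_integral_mult_left has_bochner_integral_integrable)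
    fix k l assume "k \<in> A" "l \<in> A"
    then show "integrable M (\<lambda>\<omega>. \<zeta> k \<omega> * \<zeta> l \<omega>)"
      using \<zeta> by (intro known_bounded_integrable_mult[OF \<zeta>] known_bounded_integrable)
  qed
  then have "(\<integral>\<^sup>+\<omega>. ennreal (Q \<omega>) \<partial>M) = ennreal (expectation (\<lambda>\<omega>. (S \<omega>)\<^sup>2))"
    using S2 nonneg by (subst nn_integral_eq_integral) (auto simp: has_bochner_integral_iff)
  then show "mean_square M t V = sq_norm M S"
    unfolding mean_square_def inner sq_norm_eq_integral[OF sq] .
  show "process_measurable M t V"
    unfolding process_measurable_def V_def case_prod_beta
  proof (intro borel_measurable_sum borel_measurable_times)
    fix k assume "k \<in> A"
    then show "(\<lambda>x. \<zeta> k (snd x)) \<in> borel_measurable (restrict_space borel {0..t} \<Otimes>\<^sub>M M)"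
      using known_bounded_measurable[OF \<zeta>] by (intro measurable_compose[OF measurable_snd]) auto
    have "(\<lambda>r. indicator {a k<..b k} r :: real) \<in> borel_measurable (restrict_space borel {0..t})"
      by (rule measurable_restrict_space1) simp
    then show "(\<lambda>x. indicator {a k<..b k} (fst x) :: real) \<in> borel_measurable (restrict_space borel {0..t} \<Otimes>\<^sub>M M)"
      by (rule measurable_compose[OF measurable_fst])
  qed
qed

lemma simple_integralE:
  assumes "has_simple_integral M w t V S"
  obtains n :: nat and \<tau> \<xi> where
    "\<And>i. i < n \<Longrightarrow> 0 \<le> \<tau> i \<and> \<tau> i \<le> \<tau> (Suc i) \<and> \<tau> (Suc i) \<le> t"
    "\<And>i. i < n \<Longrightarrow> known_bounded (\<tau> i) (\<xi> i)"
    "V = (\<lambda>r \<omega>. \<Sum>i<n. \<xi> i \<omega> * indicator {\<tau> i<..\<tau> (Suc i)} r)"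
    "S = (\<lambda>\<omega>. \<Sum>i<n. \<xi> i \<omega> * (w (\<tau> (Suc i)) \<omega> - w (\<tau> i) \<omega>))"
proof -
  obtain n :: nat and \<tau> \<xi> where h: "0 \<le> \<tau> 0" "\<tau> n \<le> t" "\<forall>i<n. \<tau> i \<le> \<tau> (Suc i)"
    "\<forall>i<n. \<xi> i \<in> borel_measurable (\<F> (\<tau> i)) \<and> (\<exists>C. \<forall>\<omega>\<in>space M. \<bar>\<xi> i \<omega>\<bar> \<le> C)"
    "V = (\<lambda>r \<omega>. \<Sum>i<n. \<xi> i \<omega> * indicator {\<tau> i<..\<tau> (Suc i)} r)"
    "S = (\<lambda>\<omega>. \<Sum>i<n. \<xi> i \<omega> * (w (\<tau> (Suc i)) \<omega> - w (\<tau> i) \<omega>))"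
    using assms unfolding has_simple_integral_def by blast
  show thesis
  proof (rule that[of n \<tau> \<xi>])
    fix i assume i: "i < n"
    show "0 \<le> \<tau> i \<and> \<tau> i \<le> \<tau> (Suc i) \<and> \<tau> (Suc i) \<le> t"
      using chain_mono[OF h(3), of 0 i] chain_mono[OF h(3), of "Suc i" n] h(1,2,3) i by auto
    show "known_bounded (\<tau> i) (\<xi> i)" using h(4) i by (simp add: known_bounded_def)
  qed (fact h)+
qed

lemma simple_integral_properties:
  assumes "has_simple_integral M w t V S"
  shows "square_integrable M S" "expectation S = 0" "process_measurable M t V"
proof -
  obtain n :: nat and \<tau> \<xi> where h:
    "\<And>i. i < n \<Longrightarrow> 0 \<le> \<tau> i \<and> \<tau> i \<le> \<tau> (Suc i) \<and> \<tau> (Suc i) \<le> t"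
    "\<And>i. i < n \<Longrightarrow> known_bounded (\<tau> i) (\<xi> i)"
    "V = (\<lambda>r \<omega>. \<Sum>i<n. \<xi> i \<omega> * indicator {\<tau> i<..\<tau> (Suc i)} r)"
    "S = (\<lambda>\<omega>. \<Sum>i<n. \<xi> i \<omega> * (w (\<tau> (Suc i)) \<omega> - w (\<tau> i) \<omega>))"
    by (rule simple_integralE[OF assms]) (rule that)
  note s = step_isometry[of "{..<n}" \<tau> "\<lambda>i. \<tau> (Suc i)" t \<xi>, OF finite_lessThan]
  show "square_integrable M S" "expectation S = 0" "process_measurable M t V"
    unfolding h(3,4) by (rule s; use h(1,2) in blast)+
qed

lemma simple_integral_isometry:
  assumes "has_simple_integral M w t V S" "has_simple_integral M w t V' S'"
  shows "sq_norm M (\<lambda>\<omega>. S \<omega> - S' \<omega>) = mean_square M t (\<lambda>r \<omega>. V r \<omega> - V' r \<omega>)"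
proof -
  obtain n :: nat and \<tau> \<xi> where h:
    "\<And>i. i < n \<Longrightarrow> 0 \<le> \<tau> i \<and> \<tau> i \<le> \<tau> (Suc i) \<and> \<tau> (Suc i) \<le> t"
    "\<And>i. i < n \<Longrightarrow> known_bounded (\<tau> i) (\<xi> i)"
    "V = (\<lambda>r \<omega>. \<Sum>i<n. \<xi> i \<omega> * indicator {\<tau> i<..\<tau> (Suc i)} r)"
    "S = (\<lambda>\<omega>. \<Sum>i<n. \<xi> i \<omega> * (w (\<tau> (Suc i)) \<omega> - w (\<tau> i) \<omega>))"
    by (rule simple_integralE[OF assms(1)]) (rule that)
  obtain n' :: nat and \<tau>' \<xi>' where h':
    "\<And>i. i < n' \<Longrightarrow> 0 \<le> \<tau>' i \<and> \<tau>' i \<le> \<tau>' (Suc i) \<and> \<tau>' (Suc i) \<le> t"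
    "\<And>i. i < n' \<Longrightarrow> known_bounded (\<tau>' i) (\<xi>' i)"
    "V' = (\<lambda>r \<omega>. \<Sum>i<n'. \<xi>' i \<omega> * indicator {\<tau>' i<..\<tau>' (Suc i)} r)"
    "S' = (\<lambda>\<omega>. \<Sum>i<n'. \<xi>' i \<omega> * (w (\<tau>' (Suc i)) \<omega> - w (\<tau>' i) \<omega>))"
    by (rule simple_integralE[OF assms(2)]) (rule that)
  define A where "A = {..<n} <+> {..<n'}"
  define a where "a = case_sum \<tau> \<tau>'"
  define b where "b = case_sum (\<lambda>i. \<tau> (Suc i)) (\<lambda>i. \<tau>' (Suc i))"
  define \<zeta> where "\<zeta> = case_sum \<xi> (\<lambda>i \<omega>. - \<xi>' i \<omega>)"
  have V: "(\<lambda>r \<omega>. V r \<omega> - V' r \<omega>) = (\<lambda>r \<omega>. \<Sum>k\<in>A. \<zeta> k \<omega> * indicator {a k<..b k} r)"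
    unfolding h(3) h'(3) A_def a_def b_def \<zeta>_def
    by (subst sum.Plus) (simp_all add: sum_negf comp_def)
  have S: "(\<lambda>\<omega>. S \<omega> - S' \<omega>) = (\<lambda>\<omega>. \<Sum>k\<in>A. \<zeta> k \<omega> * (w (b k) \<omega> - w (a k) \<omega>))"
    unfolding h(4) h'(4) A_def a_def b_def \<zeta>_def
    by (subst sum.Plus) (simp_all add: sum_negf comp_def)
  have neg: "known_bounded s (\<lambda>\<omega>. - \<eta> \<omega>)" if "known_bounded s \<eta>" for s \<eta>
    using that unfolding known_bounded_def by auto
  have ab: "0 \<le> a k \<and> a k \<le> b k \<and> b k \<le> t" "known_bounded (a k) (\<zeta> k)" if "k \<in> A" for k
    using that h(1,2) h'(1,2) neg by (auto simp: A_def a_def b_def \<zeta>_def)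
  have "finite A" by (simp add: A_def)
  from step_isometry(2)[OF this ab] show ?thesis unfolding V S by simp
qed

lemma has_ito_integralE:
  assumes "has_ito_integral M w t v I"
  obtains V S where "process_measurable M t v" "I \<in> borel_measurable M"
    "\<And>k::nat. has_simple_integral M w t (V k) (S k)"
    "(\<lambda>k. sq_norm (path_measure M t) (\<lambda>x. (case x of (\<omega>, r) \<Rightarrow> V k r \<omega>) - (case x of (\<omega>, r) \<Rightarrow> v r \<omega>))) \<longlonglongrightarrow> 0"
    "(\<lambda>k. sq_norm M (\<lambda>\<omega>. S k \<omega> - I \<omega>)) \<longlonglongrightarrow> 0"
proof -
  obtain V S where h: "\<And>k::nat. has_simple_integral M w t (V k) (S k)"
    "(\<lambda>k. mean_square M t (\<lambda>r \<omega>. v r \<omega> - V k r \<omega>)) \<longlonglongrightarrow> 0" "tendsto_L2 M S I sequentially"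
    using assms unfolding has_ito_integral_def by blast
  have v: "process_measurable M t v"
    using assms unfolding has_ito_integral_def ito_integrand_def process_measurable_def by blast
  have "mean_square M t (\<lambda>r \<omega>. v r \<omega> - V k r \<omega>)
      = sq_norm (path_measure M t) (\<lambda>x. (case x of (\<omega>, r) \<Rightarrow> V k r \<omega>) - (case x of (\<omega>, r) \<Rightarrow> v r \<omega>))" for k
    unfolding mean_square_eq[OF process_measurable_diff[OF v simple_integral_properties(3)[OF h(1)]]]
    by (subst sq_norm_diff_commute) (simp add: case_prod_beta')
  with h v tendsto_L2_D[OF h(3)] show thesis
    by (intro that[of V S]) (simp_all add: square_integrable_iff)
qed

text \<open>
  The integral and its integrand determine each other's distances up to a factor. The first bound gives
  well-definedness and continuity of the integral, the second uniqueness of the integrand.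
\<close>

lemma ito_comparison:
  assumes "has_ito_integral M w t v I" "has_ito_integral M w t v' I'"
  shows "sq_norm M (\<lambda>\<omega>. I \<omega> - I' \<omega>) \<le> 16 * mean_square M t (\<lambda>r \<omega>. v r \<omega> - v' r \<omega>)" (is ?le)
    and "mean_square M t (\<lambda>r \<omega>. v r \<omega> - v' r \<omega>) \<le> 16 * sq_norm M (\<lambda>\<omega>. I \<omega> - I' \<omega>)" (is ?ge)
proof -
  obtain V S where h: "process_measurable M t v" "I \<in> borel_measurable M"
    "\<And>k::nat. has_simple_integral M w t (V k) (S k)"
    "(\<lambda>k. sq_norm (path_measure M t) (\<lambda>x. (case x of (\<omega>, r) \<Rightarrow> V k r \<omega>) - (case x of (\<omega>, r) \<Rightarrow> v r \<omega>))) \<longlonglongrightarrow> 0"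
    "(\<lambda>k. sq_norm M (\<lambda>\<omega>. S k \<omega> - I \<omega>)) \<longlonglongrightarrow> 0"
    by (rule has_ito_integralE[OF assms(1)]) (rule that)
  obtain V' S' where h': "process_measurable M t v'" "I' \<in> borel_measurable M"
    "\<And>k::nat. has_simple_integral M w t (V' k) (S' k)"
    "(\<lambda>k. sq_norm (path_measure M t) (\<lambda>x. (case x of (\<omega>, r) \<Rightarrow> V' k r \<omega>) - (case x of (\<omega>, r) \<Rightarrow> v' r \<omega>))) \<longlonglongrightarrow> 0"
    "(\<lambda>k. sq_norm M (\<lambda>\<omega>. S' k \<omega> - I' \<omega>)) \<longlonglongrightarrow> 0"
    by (rule has_ito_integralE[OF assms(2)]) (rule that)
  note s = simple_integral_properties[OF h(3)] and s' = simple_integral_properties[OF h'(3)]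
  have ms: "mean_square M t (\<lambda>r \<omega>. v r \<omega> - v' r \<omega>)
      = sq_norm (path_measure M t) (\<lambda>x. (case x of (\<omega>, r) \<Rightarrow> v r \<omega>) - (case x of (\<omega>, r) \<Rightarrow> v' r \<omega>))"
    unfolding mean_square_eq[OF process_measurable_diff[OF h(1) h'(1)]] by (simp add: case_prod_beta')
  have iso: "sq_norm M (\<lambda>\<omega>. S k \<omega> - S' k \<omega>)
    = sq_norm (path_measure M t) (\<lambda>x. (case x of (\<omega>, r) \<Rightarrow> V k r \<omega>) - (case x of (\<omega>, r) \<Rightarrow> V' k r \<omega>))" for k
    unfolding simple_integral_isometry[OF h(3) h'(3)] mean_square_eq[OF process_measurable_diff[OF s(3) s'(3)]]
    by (simp add: case_prod_beta')
  have m: "S k \<in> borel_measurable M" "S' k \<in> borel_measurable M" for k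
    using s(1) s'(1) by (simp_all add: square_integrable_iff)
  note pm = process_measurable_path[OF h(1)] process_measurable_path[OF h'(1)]
    process_measurable_path[OF s(3)] process_measurable_path[OF s'(3)]
  show ?le
    unfolding ms by (rule sq_norm_quasi_isometry[OF h(2) h'(2) pm(1,2) m pm(3,4) h(5) h'(5) h(4) h'(4) iso])
  show ?ge
    unfolding ms by (rule sq_norm_quasi_isometry[OF pm(1,2) h(2) h'(2) pm(3,4) m h(4) h'(4) h(5) h'(5) iso[symmetric]])
qed

lemma ito_integral_unique:
  assumes "has_ito_integral M w t v I" "has_ito_integral M w t v I'"
  shows "AE \<omega> in M. I \<omega> = I' \<omega>"
proof -
  have [measurable]: "I \<in> borel_measurable M" "I' \<in> borel_measurable M"
    using assms has_ito_integralE by blast+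
  have "sq_norm M (\<lambda>\<omega>. I \<omega> - I' \<omega>) = 0"
    using ito_comparison(1)[OF assms] by (simp add: mean_square_def)
  then show ?thesis by (subst (asm) sq_norm_0_iff) auto
qed

lemma ito_integrand_unique:
  assumes "has_ito_integral M w t v I" "has_ito_integral M w t v' I"
  shows "AE \<omega> in M. AE r in lborel. r \<in> {0..t} \<longrightarrow> v r \<omega> = v' r \<omega>"
proof -
  interpret L: sigma_finite_measure "restrict_space lborel {0..t}"
    by (rule sigma_finite_restrict_lborel)
  interpret P: pair_sigma_finite M "restrict_space lborel {0..t}" ..
  have v: "process_measurable M t v" "process_measurable M t v'"
    using assms has_ito_integralE by blast+
  note d = process_measurable_diff[OF this]
  have "mean_square M t (\<lambda>r \<omega>. v r \<omega> - v' r \<omega>) = 0"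
    using ito_comparison(2)[OF assms] by (simp add: sq_norm_def)
  then have "AE x in path_measure M t. (case x of (\<omega>, r) \<Rightarrow> v r \<omega> - v' r \<omega>) = 0"
    unfolding mean_square_eq[OF d] sq_norm_0_iff[OF process_measurable_path[OF d]] .
  then have "AE \<omega> in M. AE r in restrict_space lborel {0..t}. v r \<omega> - v' r \<omega> = 0"
    unfolding path_measure_def by (drule_tac P.AE_pair) simp
  then show ?thesis
    by (simp add: AE_restrict_space_iff)
qed

lemma ito_integral_cong_AE:
  assumes "has_ito_integral M w t v I" "AE \<omega> in M. I \<omega> = I' \<omega>" "I' \<in> borel_measurable M"
  shows "has_ito_integral M w t v I'"
  using assms tendsto_L2_cong_limit[of M _ I sequentially I'] unfolding has_ito_integral_def by blast

lemma ito_integral_expectation: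
  assumes "has_ito_integral M w t v I"
  shows "expectation I = 0"
proof -
  obtain V S where h: "\<And>k::nat. has_simple_integral M w t (V k) (S k)" "tendsto_L2 M S I sequentially"
    using assms unfolding has_ito_integral_def by blast
  have "(\<lambda>k. expectation (S k)) \<longlonglongrightarrow> expectation I"
    by (rule tendsto_L2_expectation[OF h(2)])
  then show ?thesis
    using LIMSEQ_unique[OF _ tendsto_const[of 0]] simple_integral_properties(2)[OF h(1)] by simp
qed

text \<open>
  The integrals are a Cauchy sequence by comparison with the integrands. The approximating step processes for the limit
  are chosen diagonally.
\<close>

lemma ito_integral_limit:
  assumes I: "\<And>k::nat. has_ito_integral M w t (v k) (I k)" and I\<F>: "\<And>k. I k \<in> borel_measurable (\<F> t)"
    and v: "ito_integrand M w t v'"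
    and lim: "(\<lambda>k. mean_square M t (\<lambda>r \<omega>. v k r \<omega> - v' r \<omega>)) \<longlonglongrightarrow> 0"
  obtains J where "J \<in> borel_measurable (\<F> t)" "has_ito_integral M w t v' J"
proof -
  let ?P = "path_measure M t" and ?f = "\<lambda>v. \<lambda>(\<omega>, r). v r \<omega>"
  define d where "d k = mean_square M t (\<lambda>r \<omega>. v k r \<omega> - v' r \<omega>)" for k
  have I2: "square_integrable M (I k)" for k
    using I[of k] tendsto_L2_D(1) unfolding has_ito_integral_def by blast
  have pv: "process_measurable M t (v k)" for k
    by (rule has_ito_integralE[OF I])
  have pv': "process_measurable M t v'"
    using v unfolding ito_integrand_def process_measurable_def by blast
  have ms: "mean_square M t (\<lambda>r \<omega>. p r \<omega> - q r \<omega>) = sq_norm ?P (\<lambda>x. ?f p x - ?f q x)"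
    if "process_measurable M t p" "process_measurable M t q" for p q
    unfolding mean_square_eq[OF process_measurable_diff[OF that]] by (simp add: case_prod_beta')
  have tri: "mean_square M t (\<lambda>r \<omega>. p r \<omega> - q r \<omega>)
      \<le> 2 * mean_square M t (\<lambda>r \<omega>. p r \<omega> - o' r \<omega>) + 2 * mean_square M t (\<lambda>r \<omega>. o' r \<omega> - q r \<omega>)"
    if "process_measurable M t p" "process_measurable M t q" "process_measurable M t o'" for p q o'
    using that by (simp only: ms) (intro sq_norm_triangle process_measurable_path)
  have sym: "mean_square M t (\<lambda>r \<omega>. p r \<omega> - q r \<omega>) = mean_square M t (\<lambda>r \<omega>. q r \<omega> - p r \<omega>)" for p q
    by (simp add: mean_square_def power2_commute)
  \<comment> \<open>the supremum over the tail gives a bound depending on the smaller index only\<close>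
  have Cauchy: "sq_norm M (\<lambda>\<omega>. I n \<omega> - I m \<omega>) \<le> 64 * (SUP m\<in>{n..}. d m)" if "n \<le> m" for n m
  proof -
    let ?D = "SUP m\<in>{n..}. d m"
    have "d n \<le> ?D" "d m \<le> ?D" using that by (auto intro: SUP_upper)
    then have "2 * d n + 2 * d m \<le> 2 * ?D + 2 * ?D" by (intro add_mono mult_left_mono) auto
    moreover have "mean_square M t (\<lambda>r \<omega>. v n r \<omega> - v m r \<omega>) \<le> 2 * d n + 2 * d m"
      using tri[OF pv pv pv', of n m] by (simp add: d_def sym[of v' "v m"])
    ultimately have le: "16 * mean_square M t (\<lambda>r \<omega>. v n r \<omega> - v m r \<omega>) \<le> 16 * (2 * ?D + 2 * ?D)"
      by (intro mult_left_mono) (auto intro: order_trans)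
    have "16 * (2 * ?D + 2 * ?D) = 64 * ?D"
      by (simp add: distrib_left flip: mult.assoc distrib_right)
    then show ?thesis
      using order_trans[OF ito_comparison(1)[OF I[of n] I[of m]] le] by simp
  qed
  have "(\<lambda>n. SUP m\<in>{n..}. d m) \<longlonglongrightarrow> 0"
  proof (rule order_tendstoI)
    fix a :: ennreal assume "0 < a"
    then obtain b where b: "0 < b" "b < a" using dense by blast
    have "\<forall>\<^sub>F n in sequentially. d n < b"
      using order_tendstoD(2)[OF lim b(1)] by (simp add: d_def)
    then obtain N where N: "\<And>n. N \<le> n \<Longrightarrow> d n < b" by (auto simp: eventually_sequentially)
    show "\<forall>\<^sub>F n in sequentially. (SUP m\<in>{n..}. d m) < a"
      using eventually_ge_at_top[of N]
    proof eventually_elim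
      case (elim n)
      have "(SUP m\<in>{n..}. d m) \<le> b" by (rule SUP_least) (use N elim in \<open>force intro: less_imp_le\<close>)
      then show ?case using b(2) by simp
    qed
  qed simp
  from ennreal_tendsto_cmult[OF _ this, of 64]
  have c: "(\<lambda>n. 64 * (SUP m\<in>{n..}. d m)) \<longlonglongrightarrow> 0" by simp
  obtain J where J: "J \<in> borel_measurable (\<F> t)" "tendsto_L2 M I J sequentially"
    by (rule L2_complete[OF subalgebra_filtration I\<F> I2 Cauchy c])
  note J2 = tendsto_L2_D[OF J(2)]
  define close where "close k V S \<longleftrightarrow> has_simple_integral M w t V S \<and>
    mean_square M t (\<lambda>r \<omega>. v k r \<omega> - V r \<omega>) < ennreal (1 / real (Suc k)) \<and>
    sq_norm M (\<lambda>\<omega>. S \<omega> - I k \<omega>) < ennreal (1 / real (Suc k))" for k V S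
  have "\<exists>V S. close k V S" for k
  proof -
    obtain V S where h: "\<And>j::nat. has_simple_integral M w t (V j) (S j)"
      "(\<lambda>j. mean_square M t (\<lambda>r \<omega>. v k r \<omega> - V j r \<omega>)) \<longlonglongrightarrow> 0" "tendsto_L2 M S (I k) sequentially"
      using I[of k] unfolding has_ito_integral_def by blast
    have "0 < ennreal (1 / real (Suc k))" by simp
    then have "\<forall>\<^sub>F j in sequentially. close k (V j) (S j)"
      unfolding close_def
      by (intro eventually_conj always_eventually allI h(1) order_tendstoD(2)[OF h(2)]
          order_tendstoD(2)[OF tendsto_L2_D(3)[OF h(3)]])
    from eventually_happens'[OF sequentially_bot this] show ?thesis by blast
  qed
  then obtain V S where "\<And>k. close k (V k) (S k)" by metis
  then have VS: "\<And>k. has_simple_integral M w t (V k) (S k)"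
    "\<And>k. mean_square M t (\<lambda>r \<omega>. v k r \<omega> - V k r \<omega>) < ennreal (1 / real (Suc k))"
    "\<And>k. sq_norm M (\<lambda>\<omega>. S k \<omega> - I k \<omega>) < ennreal (1 / real (Suc k))"
    unfolding close_def by blast+
  note s = simple_integral_properties[OF VS(1)]
  have inv: "(\<lambda>k. ennreal (1 / real (Suc k))) \<longlonglongrightarrow> 0"
    using tendsto_ennrealI[OF LIMSEQ_Suc[OF lim_1_over_n]] by simp
  have a: "(\<lambda>k. mean_square M t (\<lambda>r \<omega>. v k r \<omega> - V k r \<omega>)) \<longlonglongrightarrow> 0" "(\<lambda>k. sq_norm M (\<lambda>\<omega>. S k \<omega> - I k \<omega>)) \<longlonglongrightarrow> 0"
    by (rule tendsto_0_ennreal_le[OF inv], rule always_eventually, rule allI, rule less_imp_le, rule VS)+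
  have "(\<lambda>k. mean_square M t (\<lambda>r \<omega>. v' r \<omega> - V k r \<omega>)) \<longlonglongrightarrow> 0"
  proof (rule tendsto_0_ennreal_le[OF tendsto_0_combine[OF lim a(1)]], rule always_eventually, rule allI)
    show "mean_square M t (\<lambda>r \<omega>. v' r \<omega> - V k r \<omega>)
      \<le> 2 * mean_square M t (\<lambda>r \<omega>. v k r \<omega> - v' r \<omega>) + 2 * mean_square M t (\<lambda>r \<omega>. v k r \<omega> - V k r \<omega>)" for k
      using tri[OF pv' s(3) pv] by (simp only: sym[of v'])
  qed
  moreover have "(\<lambda>k. sq_norm M (\<lambda>\<omega>. S k \<omega> - J \<omega>)) \<longlonglongrightarrow> 0"
    by (rule tendsto_0_ennreal_le[OF tendsto_0_combine[OF a(2) J2(3)]], rule always_eventually, rule allI,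
        rule sq_norm_triangle) (use s(1) I2 J2(1) in \<open>auto simp: square_integrable_iff\<close>)
  then have "tendsto_L2 M S J sequentially"
    using s(1) J2(1) by (subst tendsto_L2_iff) auto
  ultimately have "has_ito_integral M w t v' J"
    unfolding has_ito_integral_def using v VS(1) by blast
  then show thesis using that J(1) by blast
qed

end

section \<open>Sums along uniform grids\<close>

definition grid :: "real \<Rightarrow> nat \<Rightarrow> nat \<Rightarrow> real" where
  "grid t n i = real i * (t / real n)"

lemma grid_mono: "0 \<le> t \<Longrightarrow> i \<le> j \<Longrightarrow> grid t n i \<le> grid t n j"
  unfolding grid_def by (intro mult_right_mono) auto

lemma grid_bounds: "0 \<le> t \<Longrightarrow> i \<le> n \<Longrightarrow> 0 \<le> grid t n i \<and> grid t n i \<le> t"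
proof -
  assume "0 \<le> t" "i \<le> n"
  moreover from this have "real i * t \<le> real n * t" by (intro mult_right_mono) auto
  ultimately show ?thesis by (cases "n = 0") (auto simp: grid_def field_simps)
qed

lemma grid_Suc: "grid t n (Suc i) = grid t n i + t / real n"
  by (simp add: grid_def algebra_simps add_divide_distrib)

definition grid_step :: "real \<Rightarrow> nat \<Rightarrow> (real \<Rightarrow> real) \<Rightarrow> real \<Rightarrow> real" where
  "grid_step t n f r = (\<Sum>i<n. f (grid t n i) * indicator {grid t n i<..grid t n (Suc i)} r)"

text \<open>
  The value is taken at the left end of the cell containing \<open>r\<close>, which is why the point \<open>r = 0\<close>, lying in no cell, is excluded.
\<close>

lemma grid_step_eq:
  assumes "0 < r" "r \<le> t" "0 < n"
  obtains i where "i < n" "r - t / real n \<le> grid t n i" "grid t n i \<le> r" "grid_step t n f r = f (grid t n i)"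
proof -
  have t: "0 < t" using assms by simp
  define h where "h = t / real n"
  have h: "0 < h" using t assms by (simp add: h_def)
  define i where "i = nat (\<lceil>r / h\<rceil> - 1)"
  have ceil: "real_of_int \<lceil>r / h\<rceil> - 1 < r / h" "r / h \<le> real_of_int \<lceil>r / h\<rceil>" by linarith+
  have "0 < \<lceil>r / h\<rceil>" using assms h by simp
  then have ri: "real i = real_of_int \<lceil>r / h\<rceil> - 1" by (simp add: i_def)
  then have "real i < r / h" "r / h \<le> real i + 1" using ceil by linarith+
  then have i: "real i * h < r" "r \<le> (real i + 1) * h" using h by (simp_all add: pos_less_divide_eq pos_divide_le_eq)
  have "real i * h < real n * h" using i(1) assms by (simp add: h_def)
  then have "i < n" using h by simp
  have cell: "grid t n i < r" "r \<le> grid t n (Suc i)"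
    using i by (simp_all add: grid_def h_def add.commute)
  have "grid_step t n f r = (\<Sum>j<n. if j = i then f (grid t n i) else 0)"
    unfolding grid_step_def
  proof (rule sum.cong[OF refl])
    fix j
    consider "j = i" | "Suc j \<le> i" | "Suc i \<le> j" by linarith
    then show "f (grid t n j) * indicator {grid t n j<..grid t n (Suc j)} r = (if j = i then f (grid t n i) else 0)"
    proof cases
      case 2
      then have "grid t n (Suc j) < r" using grid_mono[of t "Suc j" i n] t cell by linarith
      then show ?thesis using 2 by simp
    next
      case 3
      then have "r \<le> grid t n j" using grid_mono[of t "Suc i" j n] t cell by linarith
      then show ?thesis using 3 by simp
    qed (use cell in simp)
  qed
  also have "\<dots> = f (grid t n i)" using \<open>i < n\<close> by simp
  finally show thesis
    using that[OF \<open>i < n\<close>] cell grid_Suc[of t n i] by simp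
qed

lemma grid_step_bounded:
  assumes "0 \<le> t" "0 < n" "r \<le> t" "\<And>i. i < n \<Longrightarrow> \<bar>f (grid t n i)\<bar> \<le> C" "0 \<le> C"
  shows "\<bar>grid_step t n f r\<bar> \<le> C"
proof (cases "0 < r")
  case True
  obtain i where "i < n" "grid_step t n f r = f (grid t n i)" by (rule grid_step_eq[OF True assms(3,2)])
  then show ?thesis using assms by simp
next
  case False
  have "grid_step t n f r = 0"
    unfolding grid_step_def
  proof (rule sum.neutral, rule ballI)
    fix i show "f (grid t n i) * indicator {grid t n i<..grid t n (Suc i)} r = 0"
      using False assms(1) by (auto simp: indicator_def grid_def zero_le_divide_iff not_less intro: order_trans)
  qed
  then show ?thesis using assms by simp
qed

lemma grid_step_tendsto:
  assumes f: "continuous_on {0..t} f" and r: "0 < r" "r \<le> t"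
  shows "(\<lambda>k. grid_step t (Suc k) f r) \<longlonglongrightarrow> f r"
proof -
  have "\<exists>i<Suc k. r - t / real (Suc k) \<le> grid t (Suc k) i \<and> grid t (Suc k) i \<le> r
      \<and> grid_step t (Suc k) f r = f (grid t (Suc k) i)" for k
    using grid_step_eq[OF r, of "Suc k" f] by (metis zero_less_Suc)
  then obtain i where i: "\<And>k. i k < Suc k" "\<And>k. r - t / real (Suc k) \<le> grid t (Suc k) (i k)"
    "\<And>k. grid t (Suc k) (i k) \<le> r" "\<And>k. grid_step t (Suc k) f r = f (grid t (Suc k) (i k))"
    by metis
  have "(\<lambda>k. t / real (Suc k)) \<longlonglongrightarrow> 0"
    using tendsto_mult[OF tendsto_const[of t] LIMSEQ_Suc[OF lim_1_over_n]] by simp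
  then have "(\<lambda>k. r - t / real (Suc k)) \<longlonglongrightarrow> r - 0" by (intro tendsto_diff tendsto_const)
  then have "(\<lambda>k. r - t / real (Suc k)) \<longlonglongrightarrow> r" by simp
  from tendsto_sandwich[OF _ _ this tendsto_const, of "\<lambda>k. grid t (Suc k) (i k)"]
  have "(\<lambda>k. grid t (Suc k) (i k)) \<longlonglongrightarrow> r" using i by simp
  then have "(\<lambda>k. f (grid t (Suc k) (i k))) \<longlonglongrightarrow> f r"
  proof (rule continuous_on_tendsto_compose[OF f])
    have "grid t (Suc k) (i k) \<in> {0..t}" for k
      using grid_bounds[of t "i k" "Suc k"] i(1)[of k] r by simp
    then show "\<forall>\<^sub>F k in sequentially. grid t (Suc k) (i k) \<in> {0..t}" by simp
  qed (use r in simp)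
  then show ?thesis by (simp add: i(4))
qed

lemma grid_step_integral:
  assumes "0 \<le> t"
  shows "(LINT r:{0..t}|lborel. grid_step t n f r) = (\<Sum>i<n. f (grid t n i) * (t / real n))"
proof -
  have 1: "has_bochner_integral lborel (\<lambda>r. \<Sum>i<n. f (grid t n i) * indicator {grid t n i<..grid t n (Suc i)} r)
      (\<Sum>i<n. f (grid t n i) * measure lborel {grid t n i<..grid t n (Suc i)})"
    by (intro has_bochner_integral_sum has_bochner_integral_mult_right has_bochner_integral_real_indicator)
      (use grid_mono[OF assms(1)] in auto)
  have 2: "measure lborel {grid t n i<..grid t n (Suc i)} = t / real n" for i
    using grid_mono[OF assms(1), of i "Suc i" n] by (simp add: grid_Suc)
  have 3: "indicator {0..t} r *\<^sub>R grid_step t n f r = grid_step t n f r" for r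
  proof -
    have "grid_step t n f r = 0" if "r \<notin> {0..t}"
      unfolding grid_step_def
    proof (rule sum.neutral, rule ballI)
      fix i assume "i \<in> {..<n}"
      then have "0 \<le> grid t n i" "grid t n (Suc i) \<le> t" using grid_bounds[OF assms(1)] by auto
      then show "f (grid t n i) * indicator {grid t n i<..grid t n (Suc i)} r = 0"
        using that by (auto simp: indicator_def)
    qed
    then show ?thesis by (auto simp: indicator_def)
  qed
  show ?thesis
    unfolding set_lebesgue_integral_def 3
    using has_bochner_integral_integral_eq[OF 1] unfolding 2 grid_step_def .
qed

lemma riemann_sum_tendsto:
  assumes t: "0 \<le> t" and f: "continuous_on {0..t} f" and C: "\<And>r. 0 \<le> r \<Longrightarrow> r \<le> t \<Longrightarrow> \<bar>f r\<bar> \<le> C"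
  shows "(\<lambda>k. \<Sum>i<Suc k. f (grid t (Suc k) i) * (t / real (Suc k))) \<longlonglongrightarrow> (LINT r:{0..t}|lborel. f r)"
proof -
  have C0: "0 \<le> C" using C[of 0] t by simp
  have meas: "set_borel_measurable lborel {0..t} f"
    using borel_integrable_atLeastAtMost'[OF f] by (auto simp: set_integrable_def set_borel_measurable_def)
  have "(\<lambda>k. LINT r|lborel. indicator {0..t} r *\<^sub>R grid_step t (Suc k) f r) \<longlonglongrightarrow> (LINT r|lborel. indicator {0..t} r *\<^sub>R f r)"
  proof (rule integral_dominated_convergence)
    show "integrable lborel (\<lambda>r. indicator {0..t} r * C)"
      by (intro integrable_mult_left integrable_real_indicator) (auto simp: emeasure_lborel_Icc_eq)
    show "(\<lambda>r. indicator {0..t} r *\<^sub>R f r) \<in> borel_measurable lborel"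
      using meas by (simp add: set_borel_measurable_def)
    show "(\<lambda>r. indicator {0..t} r *\<^sub>R grid_step t (Suc k) f r) \<in> borel_measurable lborel" for k
      unfolding grid_step_def by measurable
    have "(\<lambda>k. indicator {0..t} r *\<^sub>R grid_step t (Suc k) f r) \<longlonglongrightarrow> indicator {0..t} r *\<^sub>R f r" if "r \<noteq> 0" for r
    proof (cases "r \<in> {0..t}")
      case True
      then have "0 < r" "r \<le> t" using that by auto
      from grid_step_tendsto[OF f this] True show ?thesis by simp
    qed simp
    then show "AE r in lborel. (\<lambda>k. indicator {0..t} r *\<^sub>R grid_step t (Suc k) f r) \<longlonglongrightarrow> indicator {0..t} r *\<^sub>R f r"
      by (intro eventually_mono[OF AE_lborel_singleton[of 0]])
    have "\<bar>grid_step t (Suc k) f r\<bar> \<le> C" if "r \<le> t" for k r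
      using grid_bounds[OF t] that t C0 by (intro grid_step_bounded C) auto
    then show "AE r in lborel. norm (indicator {0..t} r *\<^sub>R grid_step t (Suc k) f r) \<le> indicator {0..t} r * C" for k
      by (intro AE_I2) (auto simp: indicator_def)
  qed
  then show ?thesis
    using grid_step_integral[OF t, of "Suc _" f] by (simp add: set_lebesgue_integral_def)
qed

section \<open>The stochastic integral representation of mollified local time\<close>

lemma finite_path_measure:
  assumes "finite_measure M"
  shows "finite_measure (path_measure M t)"
proof -
  interpret M: finite_measure M by fact
  interpret L: finite_measure "restrict_space lborel {0..t}"
    by (rule finite_measureI) (simp add: emeasure_restrict_space emeasure_lborel_Icc_eq)
  show ?thesis unfolding path_measure_def by (rule finite_measure_pair_measure) unfold_locales
qed

lemma heat_potential_even: "heat_potential \<epsilon> T (- x) = heat_potential \<epsilon> T x"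
  by (simp add: heat_potential_def heat_kernel_even)

lemma heat_potential_0: "heat_potential \<epsilon> 0 x = 0"
proof -
  have "AE \<sigma> in lborel. indicator {0..0} \<sigma> *\<^sub>R heat_kernel (\<epsilon> + \<sigma>) x = 0"
    using AE_lborel_singleton[of "0::real"] by eventually_elim simp
  then show ?thesis
    unfolding heat_potential_def set_lebesgue_integral_def by (rule integral_eq_zero_AE)
qed

context wiener_process
begin

abbreviation grid_increment :: "real \<Rightarrow> nat \<Rightarrow> nat \<Rightarrow> 'a \<Rightarrow> real" where
  "grid_increment t n i \<omega> \<equiv> w (grid t n (Suc i)) \<omega> - w (grid t n i) \<omega>"

lemma grid_le: "0 \<le> t \<Longrightarrow> 0 \<le> grid t n i" "0 \<le> t \<Longrightarrow> grid t n i \<le> grid t n (Suc i)"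
  using grid_mono[of t i "Suc i" n] by (auto simp: grid_def)

text \<open>
  A summand with larger index is a centred function of an increment that is independent of everything before, so
  mixed terms vanish and the variances add up.
\<close>

lemma martingale_sum_square:
  assumes t: "0 \<le> t"
    and \<xi>: "\<And>i. i < n \<Longrightarrow> known_bounded (grid t n i) (\<xi> i)"
    and C: "\<And>i \<omega>. i < n \<Longrightarrow> \<omega> \<in> space M \<Longrightarrow> \<bar>\<xi> i \<omega>\<bar> \<le> C"
    and g: "g \<in> borel_measurable borel"
    and gi: "\<And>i. integrable M (\<lambda>\<omega>. g (grid_increment t n i \<omega>))"
    and g2: "\<And>i. integrable M (\<lambda>\<omega>. (g (grid_increment t n i \<omega>))\<^sup>2)"
    and g0: "\<And>i. expectation (\<lambda>\<omega>. g (grid_increment t n i \<omega>)) = 0"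
    and gc: "\<And>i. expectation (\<lambda>\<omega>. (g (grid_increment t n i \<omega>))\<^sup>2) \<le> c"
  shows "sq_norm M (\<lambda>\<omega>. \<Sum>i<n. \<xi> i \<omega> * g (grid_increment t n i \<omega>)) \<le> ennreal (real n * (C\<^sup>2 * c))"
proof -
  define Y where "Y i \<omega> = \<xi> i \<omega> * g (grid_increment t n i \<omega>)" for i \<omega>
  define e where "e i = expectation (\<lambda>\<omega>. Y i \<omega> * Y i \<omega>)" for i
  have Yint: "integrable M (Y i)" if "i < n" for i
    unfolding Y_def by (rule known_bounded_integrable_mult[OF \<xi>[OF that] gi])
  have off: "has_bochner_integral M (\<lambda>\<omega>. Y i \<omega> * Y j \<omega>) 0" if ij: "i < j" and j: "j < n" for i j
  proof -
    have i: "i < n" using ij j by simp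
    have le: "grid t n (Suc i) \<le> grid t n j" "grid t n i \<le> grid t n j"
      using ij by (intro grid_mono t; simp)+
    have "(\<lambda>\<omega>. \<xi> j \<omega> * Y i \<omega>) \<in> borel_measurable (\<F> (grid t n j))"
      unfolding Y_def
    proof (intro borel_measurable_times measurable_compose[OF _ g] borel_measurable_diff w_measurable_filtration)
      show "\<xi> j \<in> borel_measurable (\<F> (grid t n j))" using \<xi>[OF j] by (simp add: known_bounded_def)
      show "\<xi> i \<in> borel_measurable (\<F> (grid t n j))"
        using known_bounded_mono[OF \<xi>[OF i], of "grid t n j"] le
        by (simp add: known_bounded_def)
    qed (use le grid_le(1)[OF t] in auto)
    from past_increment_product[OF grid_le[OF t] this known_bounded_integrable_mult[OF \<xi>[OF j] Yint[OF i]] g gi]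
    show ?thesis by (simp add: has_bochner_integral_iff Y_def mult_ac g0)
  qed
  have diag: "has_bochner_integral M (\<lambda>\<omega>. Y i \<omega> * Y i \<omega>) (e i)" "e i \<le> C\<^sup>2 * c" if i: "i < n" for i
  proof -
    have eq: "Y i \<omega> * Y i \<omega> = (\<xi> i \<omega> * \<xi> i \<omega>) * (g (grid_increment t n i \<omega>))\<^sup>2" for \<omega>
      by (simp add: Y_def power2_eq_square)
    have int: "integrable M (\<lambda>\<omega>. Y i \<omega> * Y i \<omega>)"
      unfolding eq by (rule known_bounded_integrable_mult[OF known_bounded_mult[OF \<xi>[OF i] \<xi>[OF i]] g2])
    then show "has_bochner_integral M (\<lambda>\<omega>. Y i \<omega> * Y i \<omega>) (e i)"
      unfolding e_def by (rule has_bochner_integral_integrable)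
    have "e i \<le> expectation (\<lambda>\<omega>. C\<^sup>2 * (g (grid_increment t n i \<omega>))\<^sup>2)"
      unfolding e_def
    proof (rule integral_mono[OF int])
      fix \<omega> assume "\<omega> \<in> space M"
      from power_mono[OF C[OF i this], of 2] have "\<xi> i \<omega> * \<xi> i \<omega> \<le> C\<^sup>2" by (simp add: power2_eq_square)
      then show "Y i \<omega> * Y i \<omega> \<le> C\<^sup>2 * (g (grid_increment t n i \<omega>))\<^sup>2"
        unfolding eq by (rule mult_right_mono) simp
    qed (use g2 in simp)
    also have "\<dots> \<le> C\<^sup>2 * c" using gc[of i] by (simp add: mult_left_mono)
    finally show "e i \<le> C\<^sup>2 * c" .
  qed
  have "has_bochner_integral M (\<lambda>\<omega>. Y i \<omega> * Y j \<omega>) (if j = i then e i else 0)" if "i < n" "j < n" for i j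
  proof -
    consider "i = j" | "i < j" | "j < i" by linarith
    then show ?thesis
    proof cases
      case 3
      then show ?thesis using off[OF 3 that(1)] by (simp add: mult.commute)
    qed (use diag off that in auto)
  qed
  then have "has_bochner_integral M (\<lambda>\<omega>. \<Sum>i<n. \<Sum>j<n. Y i \<omega> * Y j \<omega>) (\<Sum>i<n. \<Sum>j<n. if j = i then e i else 0)"
    by (intro has_bochner_integral_sum) auto
  also have "(\<Sum>i<n. \<Sum>j<n. if j = i then e i else 0) = (\<Sum>i<n. e i)" by simp
  also have "(\<lambda>\<omega>. \<Sum>i<n. \<Sum>j<n. Y i \<omega> * Y j \<omega>) = (\<lambda>\<omega>. (\<Sum>i<n. Y i \<omega>)\<^sup>2)"
    by (simp add: power2_eq_square sum_product)
  finally have main: "has_bochner_integral M (\<lambda>\<omega>. (\<Sum>i<n. Y i \<omega>)\<^sup>2) (\<Sum>i<n. e i)" .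
  then have "sq_norm M (\<lambda>\<omega>. \<Sum>i<n. Y i \<omega>) = ennreal (\<Sum>i<n. e i)"
    unfolding sq_norm_def by (subst nn_integral_eq_integral) (auto simp: has_bochner_integral_iff)
  also have "(\<Sum>i<n. e i) \<le> (\<Sum>i<n. C\<^sup>2 * c)" using diag(2) by (intro sum_mono) auto
  finally show ?thesis by (simp add: Y_def ennreal_leI)
qed

text \<open>
  No cancellation is needed here: by Cauchy-Schwarz the square of the sum costs a factor \<open>n\<close>, each summand contributes
  order \<open>h\<^sup>3\<close>, and \<open>n \<cdot> n \<cdot> h\<^sup>3\<close> is of order \<open>1/n\<close>.
\<close>

lemma remainder_sum_square:
  assumes t: "0 \<le> t"
    and R: "\<And>i \<omega>. i < n \<Longrightarrow> \<omega> \<in> space M \<Longrightarrow>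
      \<bar>R i \<omega>\<bar> \<le> C * (h\<^sup>2 + h * \<bar>grid_increment t n i \<omega>\<bar> + t * \<bar>grid_increment t n i \<omega>\<bar> ^ 3)"
    and h: "h = t / real n"
  shows "sq_norm M (\<lambda>\<omega>. \<Sum>i<n. R i \<omega>) \<le> ennreal ((real n)\<^sup>2 * (3 * C\<^sup>2 * (h ^ 4 + h ^ 3 + 15 * t\<^sup>2 * h ^ 3)))"
proof -
  let ?d = "grid_increment t n"
  define B where "B i \<omega> = 3 * C\<^sup>2 * (h ^ 4 + h\<^sup>2 * (?d i \<omega>) ^ 2 + t\<^sup>2 * (?d i \<omega>) ^ 6)" for i \<omega>
  have h0: "grid t n (Suc i) - grid t n i = h" for i by (simp add: grid_Suc h)
  have "expectation (\<lambda>\<omega>. (?d i \<omega>) ^ 6) = 15 * h ^ 3" "expectation (\<lambda>\<omega>. (?d i \<omega>) ^ 2) = h" for i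
    using increment_power_even[OF grid_le[OF t], of n i 3] increment_power_even[OF grid_le[OF t], of n i 1]
    by (simp_all add: h0 fact_numeral)
  then have m: "has_bochner_integral M (\<lambda>\<omega>. (?d i \<omega>) ^ 6) (15 * h ^ 3)"
      "has_bochner_integral M (\<lambda>\<omega>. (?d i \<omega>) ^ 2) h" for i
    using increment_power_integrable[OF grid_le[OF t], of n i 6] increment_power_integrable[OF grid_le[OF t], of n i 2]
    by (simp_all only: has_bochner_integral_iff simp_thms)
  have const: "has_bochner_integral M (\<lambda>_. h ^ 4) (h ^ 4)"
    by (simp add: has_bochner_integral_iff prob_space)
  have "has_bochner_integral M (B i) (3 * C\<^sup>2 * (h ^ 4 + h\<^sup>2 * h + t\<^sup>2 * (15 * h ^ 3)))" for i
    unfolding B_def by (intro has_bochner_integral_mult_right has_bochner_integral_add m const)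
  moreover have "h ^ 4 + h\<^sup>2 * h + t\<^sup>2 * (15 * h ^ 3) = h ^ 4 + h ^ 3 + 15 * t\<^sup>2 * h ^ 3"
    by (simp add: power2_eq_square power3_eq_cube)
  ultimately have B: "has_bochner_integral M (B i) (3 * C\<^sup>2 * (h ^ 4 + h ^ 3 + 15 * t\<^sup>2 * h ^ 3))" for i
    by simp
  have RB: "(R i \<omega>)\<^sup>2 \<le> B i \<omega>" if "i < n" "\<omega> \<in> space M" for i \<omega>
  proof -
    have three: "(a + b + c)\<^sup>2 \<le> 3 * (a\<^sup>2 + b\<^sup>2 + c\<^sup>2)" for a b c :: real
      using zero_le_power2[of "a - b"] zero_le_power2[of "b - c"] zero_le_power2[of "a - c"]
      by (simp add: power2_eq_square algebra_simps)
    have "(R i \<omega>)\<^sup>2 \<le> (C * (h\<^sup>2 + h * \<bar>?d i \<omega>\<bar> + t * \<bar>?d i \<omega>\<bar> ^ 3))\<^sup>2"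
      using power_mono[OF R[OF that], of 2] by simp
    also have "\<dots> = C\<^sup>2 * (h\<^sup>2 + h * \<bar>?d i \<omega>\<bar> + t * \<bar>?d i \<omega>\<bar> ^ 3)\<^sup>2" by (simp add: power_mult_distrib)
    also have "\<dots> \<le> C\<^sup>2 * (3 * ((h\<^sup>2)\<^sup>2 + (h * \<bar>?d i \<omega>\<bar>)\<^sup>2 + (t * \<bar>?d i \<omega>\<bar> ^ 3)\<^sup>2))"
      by (intro mult_left_mono three) simp
    also have "\<dots> = B i \<omega>"
    proof -
      have "(\<bar>x\<bar> ^ 3)\<^sup>2 = x ^ 6" for x :: real
        by (simp flip: power_mult)
      then show ?thesis by (simp add: B_def power_mult_distrib flip: power_mult)
    qed
    finally show ?thesis .
  qed
  have "sq_norm M (\<lambda>\<omega>. \<Sum>i<n. R i \<omega>) \<le> (\<integral>\<^sup>+\<omega>. ennreal (real n * (\<Sum>i<n. B i \<omega>)) \<partial>M)"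
    unfolding sq_norm_def
  proof (intro nn_integral_mono ennreal_leI)
    fix \<omega> assume \<omega>: "\<omega> \<in> space M"
    have "(\<Sum>i<n. R i \<omega>)\<^sup>2 \<le> (\<Sum>i<n. (R i \<omega>)\<^sup>2) * card {..<n}"
      by (rule sum_squared_le_sum_of_squares)
    also have "\<dots> \<le> (\<Sum>i<n. B i \<omega>) * card {..<n}"
      using RB \<omega> by (intro mult_right_mono sum_mono) auto
    finally show "(\<Sum>i<n. R i \<omega>)\<^sup>2 \<le> real n * (\<Sum>i<n. B i \<omega>)" by (simp add: mult.commute)
  qed
  also have "\<dots> = ennreal (real n * (\<Sum>i<n. 3 * C\<^sup>2 * (h ^ 4 + h ^ 3 + 15 * t\<^sup>2 * h ^ 3)))"
  proof -
    have "has_bochner_integral M (\<lambda>\<omega>. real n * (\<Sum>i<n. B i \<omega>))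
        (real n * (\<Sum>i<n. 3 * C\<^sup>2 * (h ^ 4 + h ^ 3 + 15 * t\<^sup>2 * h ^ 3)))"
      by (intro has_bochner_integral_mult_right has_bochner_integral_sum B)
    moreover have "0 \<le> real n * (\<Sum>i<n. B i \<omega>)" for \<omega>
      unfolding B_def using t by (intro mult_nonneg_nonneg sum_nonneg add_nonneg_nonneg) (auto simp: h)
    ultimately show ?thesis
      by (subst nn_integral_eq_integral) (auto simp: has_bochner_integral_iff)
  qed
  also have "real n * (\<Sum>i<n. 3 * C\<^sup>2 * (h ^ 4 + h ^ 3 + 15 * t\<^sup>2 * h ^ 3))
      = (real n)\<^sup>2 * (3 * C\<^sup>2 * (h ^ 4 + h ^ 3 + 15 * t\<^sup>2 * h ^ 3))"
    by (simp add: power2_eq_square)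
  finally show ?thesis .
qed

abbreviation occupation :: "real \<Rightarrow> real \<Rightarrow> real \<Rightarrow> 'a \<Rightarrow> real" where
  "occupation \<epsilon> u t \<omega> \<equiv> LINT r:{0..t}|lborel. heat_kernel \<epsilon> (w r \<omega> - u)"

abbreviation gradient_process :: "real \<Rightarrow> real \<Rightarrow> real \<Rightarrow> real \<Rightarrow> 'a \<Rightarrow> real" where
  "gradient_process \<epsilon> u t r \<omega> \<equiv> heat_gradient \<epsilon> (t - r) (w r \<omega> - u)"

text \<open>
  Step processes on half-open cells vanish at time zero; almost every time is positive.
\<close>

lemma AE_path_positive: "AE x in path_measure M t. fst x \<in> space M \<and> 0 < snd x \<and> snd x \<le> t"
proof -
  interpret L: sigma_finite_measure "restrict_space lborel {0..t}"
    by (rule sigma_finite_restrict_lborel)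
  interpret P: pair_sigma_finite M "restrict_space lborel {0..t}" ..
  have id: "(\<lambda>r::real. r) \<in> borel_measurable (restrict_space lborel {0..t})"
    by (rule measurable_restrict_space1) simp
  have snd: "(\<lambda>x. snd x) \<in> borel_measurable (M \<Otimes>\<^sub>M restrict_space lborel {0..t})"
    by (rule measurable_compose[OF measurable_snd id])
  have "AE r in restrict_space lborel {0..t}. r \<noteq> 0"
    by (subst AE_restrict_space_iff) (use AE_lborel_singleton[of 0] in \<open>auto elim: eventually_mono\<close>)
  then have "AE \<omega> in M. AE r in restrict_space lborel {0..t}. snd (\<omega>, r) \<noteq> 0" by simp
  then have "AE x in M \<Otimes>\<^sub>M restrict_space lborel {0..t}. snd x \<noteq> 0"
  proof (rule P.AE_pair_measure[rotated])
    show "{x \<in> space (M \<Otimes>\<^sub>M restrict_space lborel {0..t}). snd x \<noteq> 0} \<in> sets (M \<Otimes>\<^sub>M restrict_space lborel {0..t})"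
      using snd by measurable
  qed
  then show ?thesis
    unfolding path_measure_def using AE_space
    by eventually_elim (auto simp: space_pair_measure space_restrict_space)
qed

lemma gradient_process_adapted:
  "0 \<le> r \<Longrightarrow> gradient_process \<epsilon> u t r \<in> borel_measurable (\<F> r)"
  by (intro heat_gradient_measurable borel_measurable_diff borel_measurable_const w_measurable_filtration) auto

text \<open>
  The time interval and the probability are finite.
\<close>

lemma bounded_ito_integrand:
  assumes "process_measurable M t v" "\<And>r. 0 \<le> r \<Longrightarrow> r \<le> t \<Longrightarrow> v r \<in> borel_measurable (\<F> r)"
    and C: "\<And>r \<omega>. \<bar>v r \<omega>\<bar> \<le> C"
  shows "ito_integrand M w t v"
proof -
  have "square_integrable (path_measure M t) (\<lambda>(\<omega>, r). v r \<omega>)"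
    using C by (intro square_integrable_bounded[of _ _ C] finite_path_measure process_measurable_path assms)
      (auto intro: finite_measure_axioms)
  then show ?thesis
    using assms unfolding ito_integrand_def mean_square_eq[OF assms(1)] square_integrable_iff
    by (auto simp: process_measurable_def)
qed

context
  fixes t :: real assumes t: "0 \<le> t"
begin

lemma jointly_measurable_functionals:
  assumes sp: "space N = space M" and N: "\<And>r. 0 \<le> r \<Longrightarrow> r \<le> t \<Longrightarrow> w r \<in> borel_measurable N"
  shows "(\<lambda>(r, \<omega>). gradient_process \<epsilon> u t r \<omega>) \<in> borel_measurable (restrict_space borel {0..t} \<Otimes>\<^sub>M N)" (is ?gradient)
    and "(\<lambda>(r, \<omega>). heat_kernel \<epsilon> (w r \<omega> - u)) \<in> borel_measurable (restrict_space borel {0..t} \<Otimes>\<^sub>M N)" (is ?kernel)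
proof -
  have w: "(\<lambda>x. w (fst x) (snd x)) \<in> borel_measurable (restrict_space borel {0..t} \<Otimes>\<^sub>M N)"
    using jointly_measurable[OF sp N t] by (simp add: case_prod_beta')
  have id: "(\<lambda>r::real. r) \<in> borel_measurable (restrict_space borel {0..t})"
    by (rule measurable_restrict_space1) simp
  have fst: "(\<lambda>x. fst x) \<in> borel_measurable (restrict_space borel {0..t} \<Otimes>\<^sub>M N)"
    by (rule measurable_compose[OF measurable_fst id])
  show ?gradient ?kernel
    unfolding case_prod_beta
    by (intro heat_gradient_measurable heat_kernel_measurable borel_measurable_diff borel_measurable_const w fst)+
qed

lemma gradient_process_measurable: "process_measurable M t (gradient_process \<epsilon> u t)"
  unfolding process_measurable_def by (rule jointly_measurable_functionals) (auto intro: random_variable_w)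

lemma occupation_measurable: "occupation \<epsilon> u t \<in> borel_measurable (\<F> t)"
proof -
  interpret L: sigma_finite_measure "restrict_space lborel {0..t}"
    by (rule sigma_finite_restrict_lborel)
  have "(\<lambda>(r, \<omega>). heat_kernel \<epsilon> (w r \<omega> - u)) \<in> borel_measurable (restrict_space borel {0..t} \<Otimes>\<^sub>M \<F> t)"
    by (rule jointly_measurable_functionals(2)) (auto intro: w_measurable_filtration)
  moreover have "sets (restrict_space lborel {0..t} \<Otimes>\<^sub>M \<F> t) = sets (restrict_space borel {0..t} \<Otimes>\<^sub>M \<F> t)"
    by (intro sets_pair_measure_cong sets_restrict_space_cong) simp_all
  ultimately have "(\<lambda>(r, \<omega>). heat_kernel \<epsilon> (w r \<omega> - u)) \<in> borel_measurable (restrict_space lborel {0..t} \<Otimes>\<^sub>M \<F> t)"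
    by (simp cong: measurable_cong_sets)
  from measurable_pair_swap[OF this]
  have "(\<lambda>(\<omega>, r). heat_kernel \<epsilon> (w r \<omega> - u)) \<in> borel_measurable (\<F> t \<Otimes>\<^sub>M restrict_space lborel {0..t})"
    by (simp add: case_prod_beta')
  from L.borel_measurable_lebesgue_integral[OF this] show ?thesis
    by (subst (asm) integral_restrict_space) (simp_all add: set_lebesgue_integral_def)
qed

lemma path_continuous: "\<omega> \<in> space M \<Longrightarrow> continuous_on {0..t} (\<lambda>r. w r \<omega>)"
  by (rule continuous_on_subset[OF continuous_paths]) auto

lemma occupied_kernel_continuous:
  assumes "\<omega> \<in> space M"
  shows "continuous_on {0..t} (\<lambda>r. heat_kernel \<epsilon> (w r \<omega> - u))"
proof -
  have "continuous_on UNIV (heat_kernel \<epsilon>)"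
    by (rule DERIV_continuous_on) (rule has_field_derivative_at_within[OF heat_kernel_DERIV])
  from continuous_on_compose2[OF this continuous_on_diff[OF path_continuous[OF assms] continuous_on_const]]
  show ?thesis by simp
qed

lemma gradient_process_continuous:
  assumes \<epsilon>: "0 < \<epsilon>" and \<omega>: "\<omega> \<in> space M"
  shows "continuous_on {0..t} (\<lambda>r. gradient_process \<epsilon> u t r \<omega>)"
proof -
  obtain C where C: "0 \<le> C" "\<And>s x. \<epsilon> \<le> s \<Longrightarrow> \<bar>heat_kernel_x s x\<bar> \<le> C" "\<And>s x. \<epsilon> \<le> s \<Longrightarrow> \<bar>heat_kernel_xx s x\<bar> \<le> C"
    using heat_kernel_derivatives_bounded[OF \<epsilon>] by metis
  let ?g = "\<lambda>r. gradient_process \<epsilon> u t r \<omega>" and ?b = "\<lambda>r s. C * \<bar>r - s\<bar> + C * \<bar>w r \<omega> - w s \<omega>\<bar> * t"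
  have le: "\<bar>?g r - ?g s\<bar> \<le> ?b r s"
    if r: "r \<in> {0..t}" and s: "s \<in> {0..t}" for r s
  proof -
    have *: "\<bar>?g r - ?g s\<bar> \<le> ?b r s"
      if "0 \<le> r" "r \<le> s" "s \<le> t" for r s
    proof -
      have "\<bar>?g r - ?g s\<bar>
          \<le> C * ((t - r) - (t - s)) + C * \<bar>(w r \<omega> - u) - (w s \<omega> - u)\<bar> * (t - s)"
        by (rule heat_gradient_lipschitz[OF \<epsilon> C(2,3)]) (use that in auto)
      also have "\<dots> \<le> ?b r s"
        using that C(1) by (intro add_mono mult_mono) auto
      finally show ?thesis .
    qed
    show ?thesis
      using *[of r s] *[of s r] r s by (cases "r \<le> s") (auto simp: abs_minus_commute)
  qed
  show ?thesis
  proof (rule continuous_on_sequentiallyI)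
    fix r :: "nat \<Rightarrow> real" and s assume r: "\<forall>k. r k \<in> {0..t}" and s: "s \<in> {0..t}" and lim: "r \<longlonglongrightarrow> s"
    have "(\<lambda>k. w (r k) \<omega>) \<longlonglongrightarrow> w s \<omega>"
      by (rule continuous_on_tendsto_compose[OF path_continuous[OF \<omega>] lim s]) (use r in auto)
    then have "(\<lambda>k. ?b (r k) s) \<longlonglongrightarrow> ?b s s"
      by (intro tendsto_intros lim)
    then have lim0: "(\<lambda>k. ?b (r k) s) \<longlonglongrightarrow> 0" by simp
    have "\<forall>k. norm (?g (r k) - ?g s)
        \<le> ?b (r k) s"
      using le r s by simp
    from Lim_null_comparison[OF always_eventually[OF this] lim0] show "(\<lambda>k. ?g (r k)) \<longlonglongrightarrow> ?g s"
      by (rule LIM_zero_cancel)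
  qed
qed

lemma occupation_bounded:
  assumes C: "\<And>x. \<bar>heat_kernel \<epsilon> x\<bar> \<le> C" and \<omega>: "\<omega> \<in> space M"
  shows "\<bar>occupation \<epsilon> u t \<omega>\<bar> \<le> C * t"
  using set_integral_bound_const[OF t borel_integrable_atLeastAtMost'[OF occupied_kernel_continuous[OF \<omega>]] C] by simp

lemma occupation_square_integrable:
  assumes "0 < \<epsilon>"
  shows "square_integrable M (occupation \<epsilon> u t)"
proof -
  obtain C where "\<And>s x. \<epsilon> \<le> s \<Longrightarrow> \<bar>heat_kernel s x\<bar> \<le> C"
    using heat_kernel_derivatives_bounded[OF assms] by metis
  then show ?thesis
    by (intro square_integrable_bounded[of _ _ "C * t"] occupation_bounded measurable_filtrationD[OF occupation_measurable])
      (auto intro: finite_measure_axioms)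
qed

end

text \<open>
  Ito's formula for the potential along the path. Summing the one-step expansion over a grid telescopes on the left to
  minus the potential at time zero, since no time remains at the end. On the right stand the step approximation of the
  stochastic integral, a Riemann sum of the occupation integral, the compensated squares and the remainders.
\<close>

lemma occupation_ito:
  assumes t: "0 \<le> t" and \<epsilon>: "0 < \<epsilon>"
  shows "has_ito_integral M w t (gradient_process \<epsilon> u t) (\<lambda>\<omega>. occupation \<epsilon> u t \<omega> - heat_potential \<epsilon> t u)"
proof -
  obtain C where C: "0 \<le> C"
    "\<And>s x. \<epsilon> \<le> s \<Longrightarrow> \<bar>heat_kernel s x\<bar> \<le> C" "\<And>s x. \<epsilon> \<le> s \<Longrightarrow> \<bar>heat_kernel_x s x\<bar> \<le> C"
    "\<And>s x. \<epsilon> \<le> s \<Longrightarrow> \<bar>heat_kernel_xx s x\<bar> \<le> C" "\<And>s x. \<epsilon> \<le> s \<Longrightarrow> \<bar>heat_kernel_xxx s x\<bar> \<le> C"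
    by (rule heat_kernel_derivatives_bounded[OF \<epsilon>]) (rule that)
  let ?v = "gradient_process \<epsilon> u t" and ?X = "occupation \<epsilon> u t" and ?m = "heat_potential \<epsilon> t u"
  let ?\<tau> = "\<lambda>k. grid t (Suc k)" and ?d = "\<lambda>k. grid_increment t (Suc k)"
  define h where "h k = t / real (Suc k)" for k
  define x where "x k i \<omega> = w (?\<tau> k i) \<omega> - u" for k i \<omega>
  define V where "V k = (\<lambda>r \<omega>. \<Sum>i<Suc k. ?v (?\<tau> k i) \<omega> * indicator {?\<tau> k i<..?\<tau> k (Suc i)} r)" for k
  define S where "S k = (\<lambda>\<omega>. \<Sum>i<Suc k. ?v (?\<tau> k i) \<omega> * ?d k i \<omega>)" for k
  define R where "R k \<omega> = (\<Sum>i<Suc k. heat_kernel \<epsilon> (x k i \<omega>) * h k)" for k \<omega>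
  \<comment> \<open>the coefficient of the compensated square, known at the beginning of the step\<close>
  define a where "a k i \<omega> = heat_kernel (\<epsilon> + (t - ?\<tau> k i)) (x k i \<omega>) - heat_kernel \<epsilon> (x k i \<omega>)" for k i \<omega>
  define Q where "Q k \<omega> = (\<Sum>i<Suc k. a k i \<omega> * ((?d k i \<omega>)\<^sup>2 - h k))" for k \<omega>
  define U where "U k i \<omega> = heat_potential \<epsilon> (t - ?\<tau> k i) (x k i \<omega>)" for k i \<omega>
  \<comment> \<open>the error in the one-step expansion\<close>
  define rem where "rem k i \<omega> = U k (Suc i) \<omega> - U k i \<omega> - ?v (?\<tau> k i) \<omega> * ?d k i \<omega>
    + heat_kernel \<epsilon> (x k i \<omega>) * h k - a k i \<omega> * ((?d k i \<omega>)\<^sup>2 - h k)" for k i \<omega>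
  have h0: "0 \<le> h k" for k using t by (simp add: h_def)
  have \<tau>: "0 \<le> ?\<tau> k i" "?\<tau> k i \<le> ?\<tau> k (Suc i)" "?\<tau> k (Suc i) = ?\<tau> k i + h k" for k i
    by (rule grid_le[OF t], rule grid_le[OF t], simp only: grid_Suc h_def)
  have \<tau>t: "?\<tau> k i \<le> t" if "i \<le> Suc k" for k i using grid_bounds[OF t that] by simp
  have [measurable]: "w (?\<tau> k i) \<in> borel_measurable M" for k i
    by (intro random_variable_w \<tau>)
  have v_bound: "\<bar>?v r \<omega>\<bar> \<le> sqrt pi" for r \<omega> by (rule heat_gradient_bounded[OF \<epsilon>])
  have v_meas: "process_measurable M t ?v" by (rule gradient_process_measurable[OF t])
  have v_adapted: "?v r \<in> borel_measurable (\<F> r)" if "0 \<le> r" for r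
    using that by (rule gradient_process_adapted)
  have simple: "has_simple_integral M w t (V k) (S k)" for k
    unfolding has_simple_integral_def V_def S_def
  proof (intro exI[of _ "Suc k"] exI[of _ "?\<tau> k"] exI[of _ "\<lambda>i. ?v (?\<tau> k i)"] conjI allI impI refl)
    show "\<exists>C. \<forall>\<omega>\<in>space M. \<bar>?v (?\<tau> k i) \<omega>\<bar> \<le> C" for i using v_bound by blast
  qed (rule \<tau>(1) \<tau>(2) \<tau>t[OF order_refl] v_adapted[OF \<tau>(1)])+
  note Vm = simple_integral_properties(3)[OF simple]
  have V_lim: "(\<lambda>k. mean_square M t (\<lambda>r \<omega>. ?v r \<omega> - V k r \<omega>)) \<longlonglongrightarrow> 0"
  proof -
    have eq: "V k r \<omega> = grid_step t (Suc k) (\<lambda>r. ?v r \<omega>) r" for k r \<omega>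
      by (simp only: V_def grid_step_def)
    have "(\<lambda>k. sq_norm (path_measure M t) (\<lambda>y. (case y of (\<omega>, r) \<Rightarrow> V k r \<omega>) - (case y of (\<omega>, r) \<Rightarrow> ?v r \<omega>))) \<longlonglongrightarrow> 0"
    proof (rule sq_norm_bounded_convergence)
      show "finite_measure (path_measure M t)" by (rule finite_path_measure) (rule finite_measure_axioms)
      show "(\<lambda>(\<omega>, r). V k r \<omega>) \<in> borel_measurable (path_measure M t)" for k
        by (rule process_measurable_path[OF Vm])
      show "(\<lambda>(\<omega>, r). ?v r \<omega>) \<in> borel_measurable (path_measure M t)"
        by (rule process_measurable_path[OF v_meas])
      show "\<bar>case y of (\<omega>, r) \<Rightarrow> V k r \<omega>\<bar> \<le> sqrt pi" if y: "y \<in> space (path_measure M t)" for k y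
      proof -
        obtain \<omega> r where "y = (\<omega>, r)" "r \<le> t"
          using y by (auto simp: path_measure_def space_pair_measure space_restrict_space)
        then show ?thesis
          unfolding eq by (simp add: grid_step_bounded[OF t zero_less_Suc _ v_bound])
      qed
      show "AE y in path_measure M t. (\<lambda>k. case y of (\<omega>, r) \<Rightarrow> V k r \<omega>) \<longlonglongrightarrow> (case y of (\<omega>, r) \<Rightarrow> ?v r \<omega>)"
        using AE_path_positive
      proof eventually_elim
        case (elim y)
        then have "(\<lambda>k. grid_step t (Suc k) (\<lambda>r. ?v r (fst y)) (snd y)) \<longlonglongrightarrow> ?v (snd y) (fst y)"
          by (intro grid_step_tendsto gradient_process_continuous t \<epsilon>) auto
        then show ?case by (simp add: case_prod_beta' eq)
      qed
    qed
    then show ?thesis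
      unfolding mean_square_eq[OF process_measurable_diff[OF v_meas Vm]]
      by (subst (asm) sq_norm_diff_commute) (simp add: case_prod_beta')
  qed
  have Rm [measurable]: "R k \<in> borel_measurable M" for k
    unfolding R_def x_def by measurable
  have Qm [measurable]: "Q k \<in> borel_measurable M" for k
    unfolding Q_def a_def x_def by measurable
  have Sm [measurable]: "S k \<in> borel_measurable M" for k
    using simple_integral_properties(1)[OF simple] by (simp add: square_integrable_iff)
  have Xsq: "square_integrable M ?X" by (rule occupation_square_integrable[OF t \<epsilon>])
  then have Xm [measurable]: "?X \<in> borel_measurable M" by (simp add: square_integrable_iff)
  have R_lim: "(\<lambda>k. sq_norm M (\<lambda>\<omega>. R k \<omega> - ?X \<omega>)) \<longlonglongrightarrow> 0"
  proof (rule sq_norm_bounded_convergence)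
    show "finite_measure M" by (rule finite_measure_axioms)
    show "\<bar>R k \<omega>\<bar> \<le> C * t" for k \<omega>
    proof -
      have "\<bar>R k \<omega>\<bar> \<le> (\<Sum>i<Suc k. C * h k)"
        unfolding R_def
        by (intro order_trans[OF sum_abs] sum_mono) (use C(2) h0 in \<open>auto simp: abs_mult intro: mult_right_mono\<close>)
      also have "\<dots> = C * t" by (simp add: h_def)
      finally show ?thesis .
    qed
    show "AE \<omega> in M. (\<lambda>k. R k \<omega>) \<longlonglongrightarrow> ?X \<omega>"
      using AE_space
    proof eventually_elim
      case (elim \<omega>)
      show ?case
        unfolding R_def x_def h_def
        by (rule riemann_sum_tendsto[OF t occupied_kernel_continuous[OF t elim]]) (rule C(2)[OF order_refl])
    qed
  qed measurable
  have Q_bound: "sq_norm M (Q k) \<le> ennreal (8 * C\<^sup>2 * t\<^sup>2 * (1 / real (Suc k)))" for k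
  proof -
    have inc: "expectation (\<lambda>\<omega>. (?d k i \<omega>) ^ 4) = 3 * (h k)\<^sup>2" "expectation (\<lambda>\<omega>. (?d k i \<omega>)\<^sup>2) = h k"
      "integrable M (\<lambda>\<omega>. (?d k i \<omega>) ^ 4)" "integrable M (\<lambda>\<omega>. (?d k i \<omega>)\<^sup>2)" for i
      using increment_power_even[OF \<tau>(1,2), of k i 2] increment_power_even[OF \<tau>(1,2), of k i 1]
        increment_power_integrable[OF \<tau>(1,2), of k i 4] increment_power_integrable[OF \<tau>(1,2), of k i 2]
      by (simp_all add: \<tau>(3) fact_numeral)
    have sq: "((?d k i \<omega>)\<^sup>2 - h k)\<^sup>2 = (?d k i \<omega>) ^ 4 - 2 * h k * (?d k i \<omega>)\<^sup>2 + (h k)\<^sup>2" for i \<omega>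
      by (simp add: power2_eq_square power_numeral_reduce algebra_simps)
    have const: "has_bochner_integral M (\<lambda>_. c) c" for c :: real
      by (simp add: has_bochner_integral_iff prob_space)
    have m: "has_bochner_integral M (\<lambda>\<omega>. ((?d k i \<omega>)\<^sup>2 - h k)\<^sup>2) (3 * (h k)\<^sup>2 - 2 * h k * h k + (h k)\<^sup>2)"
      "has_bochner_integral M (\<lambda>\<omega>. (?d k i \<omega>)\<^sup>2 - h k) (h k - h k)" for i
      unfolding sq using inc[of i]
      by (intro has_bochner_integral_add has_bochner_integral_diff has_bochner_integral_mult_right const;
          simp only: has_bochner_integral_iff simp_thms)+
    have "sq_norm M (Q k) \<le> ennreal (real (Suc k) * ((2 * C)\<^sup>2 * (2 * (h k)\<^sup>2)))"
      unfolding Q_def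
    proof (rule martingale_sum_square[OF t])
      fix i assume i: "i < Suc k"
      have ge: "\<epsilon> \<le> \<epsilon> + (t - ?\<tau> k i)" using \<tau>t[of i k] i by simp
      show a: "\<bar>a k i \<omega>\<bar> \<le> 2 * C" for \<omega>
        unfolding a_def using C(2)[OF ge, of "x k i \<omega>"] C(2)[OF order_refl, of "x k i \<omega>"] by linarith
      have "w (?\<tau> k i) \<in> borel_measurable (\<F> (?\<tau> k i))" by (intro w_measurable_filtration \<tau>) simp
      then have "a k i \<in> borel_measurable (\<F> (?\<tau> k i))"
        unfolding a_def x_def
        by (intro borel_measurable_diff heat_kernel_measurable borel_measurable_const)
      then show "known_bounded (?\<tau> k i) (a k i)" unfolding known_bounded_def using a by blast
    next
      fix i
      show "integrable M (\<lambda>\<omega>. (?d k i \<omega>)\<^sup>2 - h k)" "integrable M (\<lambda>\<omega>. ((?d k i \<omega>)\<^sup>2 - h k)\<^sup>2)"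
        "expectation (\<lambda>\<omega>. (?d k i \<omega>)\<^sup>2 - h k) = 0"
        "expectation (\<lambda>\<omega>. ((?d k i \<omega>)\<^sup>2 - h k)\<^sup>2) \<le> 2 * (h k)\<^sup>2"
        using m[of i] unfolding has_bochner_integral_iff by (simp_all add: power2_eq_square[of "h k"])
    qed measurable
    also have "real (Suc k) * ((2 * C)\<^sup>2 * (2 * (h k)\<^sup>2)) = 8 * C\<^sup>2 * t\<^sup>2 * (1 / real (Suc k))"
      by (simp add: h_def power2_eq_square)
    finally show ?thesis .
  qed
  have rem_sum: "(\<Sum>i<Suc k. rem k i \<omega>) = R k \<omega> - Q k \<omega> - S k \<omega> - U k 0 \<omega>" for k \<omega>
  proof -
    have "(\<Sum>i<Suc k. U k (Suc i) \<omega> - U k i \<omega>) = U k (Suc k) \<omega> - U k 0 \<omega>"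
      by (rule sum_lessThan_telescope)
    moreover have "?\<tau> k (Suc k) = t" by (simp add: grid_def)
    then have "U k (Suc k) \<omega> = 0" by (simp add: U_def heat_potential_0)
    ultimately show ?thesis
      unfolding rem_def R_def Q_def S_def by (simp only: sum.distrib sum_subtractf)
  qed
  have rem_bound: "sq_norm M (\<lambda>\<omega>. \<Sum>i<Suc k. rem k i \<omega>)
      \<le> ennreal (3 * C\<^sup>2 * (t ^ 4 + t ^ 3 + 15 * t ^ 5) * (1 / real (Suc k)))" for k
  proof -
    have "sq_norm M (\<lambda>\<omega>. \<Sum>i<Suc k. rem k i \<omega>)
        \<le> ennreal ((real (Suc k))\<^sup>2 * (3 * C\<^sup>2 * (h k ^ 4 + h k ^ 3 + 15 * t\<^sup>2 * h k ^ 3)))"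
    proof (rule remainder_sum_square[OF t _ h_def])
      fix i \<omega> assume i: "i < Suc k"
      have le: "h k \<le> t - ?\<tau> k i" using \<tau>t[of "Suc i" k] i \<tau>(3)[of k i] by simp
      have eq: "x k (Suc i) \<omega> = x k i \<omega> + ?d k i \<omega>" "t - ?\<tau> k (Suc i) = t - ?\<tau> k i - h k"
        by (simp_all add: x_def \<tau>(3))
      have "\<bar>rem k i \<omega>\<bar> \<le> C * ((h k)\<^sup>2 + h k * \<bar>?d k i \<omega>\<bar> + (t - ?\<tau> k i) * \<bar>?d k i \<omega>\<bar> ^ 3)"
        unfolding rem_def U_def a_def eq x_def[symmetric]
        by (rule heat_potential_step[OF \<epsilon> C(3-5) h0 le])
      also have "\<dots> \<le> C * ((h k)\<^sup>2 + h k * \<bar>?d k i \<omega>\<bar> + t * \<bar>?d k i \<omega>\<bar> ^ 3)"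
        using C(1) \<tau>(1)[of k i] by (intro mult_left_mono add_left_mono mult_right_mono) auto
      finally show "\<bar>rem k i \<omega>\<bar> \<le> C * ((h k)\<^sup>2 + h k * \<bar>?d k i \<omega>\<bar> + t * \<bar>?d k i \<omega>\<bar> ^ 3)" .
    qed
    also have "(real (Suc k))\<^sup>2 * (3 * C\<^sup>2 * (h k ^ 4 + h k ^ 3 + 15 * t\<^sup>2 * h k ^ 3))
        \<le> 3 * C\<^sup>2 * (t ^ 4 + t ^ 3 + 15 * t ^ 5) * (1 / real (Suc k))"
    proof -
      define n where "n = real (Suc k)"
      have n: "1 \<le> n" by (simp add: n_def)
      have "n\<^sup>2 * (3 * C\<^sup>2 * ((t / n) ^ 4 + (t / n) ^ 3 + 15 * t\<^sup>2 * (t / n) ^ 3))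
          = 3 * C\<^sup>2 * (t ^ 4 * (1 / n) + t ^ 3 + 15 * t ^ 5) * (1 / n)"
        using n by (simp add: field_simps power2_eq_square power_numeral_reduce)
      also have "\<dots> \<le> 3 * C\<^sup>2 * (t ^ 4 * 1 + t ^ 3 + 15 * t ^ 5) * (1 / n)"
        using n t by (intro mult_right_mono mult_left_mono add_right_mono) auto
      finally show ?thesis by (simp add: h_def n_def)
    qed
    finally show ?thesis by (simp add: ennreal_leI)
  qed
  have S_bound: "sq_norm M (\<lambda>\<omega>. S k \<omega> - (?X \<omega> - ?m))
      \<le> 2 * sq_norm M (\<lambda>\<omega>. R k \<omega> - ?X \<omega>) + 2 * (2 * sq_norm M (Q k) + 2 * sq_norm M (\<lambda>\<omega>. \<Sum>i<Suc k. rem k i \<omega>))" for k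
  proof -
    \<comment> \<open>almost surely the sum of the errors; measurability is evident in this form\<close>
    let ?E = "\<lambda>\<omega>. R k \<omega> - Q k \<omega> - S k \<omega> - ?m"
    have "AE \<omega> in M. (\<Sum>i<Suc k. rem k i \<omega>) = ?E \<omega>"
      using start_zero
    proof eventually_elim
      case (elim \<omega>)
      then have "U k 0 \<omega> = ?m" by (simp add: U_def x_def grid_def heat_potential_even)
      then show ?case by (simp only: rem_sum)
    qed
    then have E: "sq_norm M (\<lambda>\<omega>. \<Sum>i<Suc k. rem k i \<omega>) = sq_norm M ?E" by (rule sq_norm_cong_AE)
    have "sq_norm M (\<lambda>\<omega>. S k \<omega> - (?X \<omega> - ?m)) = sq_norm M (\<lambda>\<omega>. (R k \<omega> - ?X \<omega>) + - (Q k \<omega> + ?E \<omega>))"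
      by (rule arg_cong[where f="sq_norm M"]) auto
    also have "\<dots> \<le> 2 * sq_norm M (\<lambda>\<omega>. R k \<omega> - ?X \<omega>) + 2 * sq_norm M (\<lambda>\<omega>. - (Q k \<omega> + ?E \<omega>))"
      by (rule sq_norm_add_le) measurable
    also have "\<dots> \<le> 2 * sq_norm M (\<lambda>\<omega>. R k \<omega> - ?X \<omega>) + 2 * (2 * sq_norm M (Q k) + 2 * sq_norm M ?E)"
      unfolding sq_norm_minus by (intro add_left_mono mult_left_mono sq_norm_add_le Qm Rm Sm borel_measurable_diff borel_measurable_const) simp
    finally show ?thesis unfolding E .
  qed
  have inv: "(\<lambda>k. ennreal (c * (1 / real (Suc k)))) \<longlonglongrightarrow> 0" for c
  proof -
    have "(\<lambda>k. c * (1 / real (Suc k))) \<longlonglongrightarrow> c * 0" by (intro tendsto_mult tendsto_const LIMSEQ_Suc lim_1_over_n)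
    then have "(\<lambda>k. ennreal (c * (1 / real (Suc k)))) \<longlonglongrightarrow> ennreal (c * 0)" by (rule tendsto_ennrealI)
    then show ?thesis by simp
  qed
  have "(\<lambda>k. sq_norm M (Q k)) \<longlonglongrightarrow> 0"
    by (rule tendsto_0_ennreal_le[OF inv]) (rule always_eventually, rule allI, rule Q_bound)
  moreover have "(\<lambda>k. sq_norm M (\<lambda>\<omega>. \<Sum>i<Suc k. rem k i \<omega>)) \<longlonglongrightarrow> 0"
    by (rule tendsto_0_ennreal_le[OF inv]) (rule always_eventually, rule allI, rule rem_bound)
  ultimately have "(\<lambda>k. 2 * sq_norm M (Q k) + 2 * sq_norm M (\<lambda>\<omega>. \<Sum>i<Suc k. rem k i \<omega>)) \<longlonglongrightarrow> 0"
    by (rule tendsto_0_combine)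
  from tendsto_0_combine[OF R_lim this]
  have "(\<lambda>k. sq_norm M (\<lambda>\<omega>. S k \<omega> - (?X \<omega> - ?m))) \<longlonglongrightarrow> 0"
    by (rule tendsto_0_ennreal_le) (rule always_eventually, rule allI, rule S_bound)
  moreover have "square_integrable M (\<lambda>\<omega>. ?X \<omega> - ?m)"
    by (intro square_integrable_diff Xsq) (simp add: square_integrable_def)
  ultimately have "tendsto_L2 M S (\<lambda>\<omega>. ?X \<omega> - ?m) sequentially"
    using simple_integral_properties(1)[OF simple] by (subst tendsto_L2_iff) auto
  moreover have "ito_integrand M w t ?v"
    by (rule bounded_ito_integrand[OF v_meas v_adapted v_bound])
  ultimately show ?thesis
    unfolding has_ito_integral_def using simple V_lim by blast
qed

end

section \<open>Removing the mollification\<close>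

context wiener_process
begin

context
  fixes t u :: real assumes t: "0 \<le> t"
begin

lemma gradient_process_tendsto:
  assumes e: "\<And>k. 0 < e k" "e \<longlonglongrightarrow> 0"
  shows "(\<lambda>k. mean_square M t (\<lambda>r \<omega>. gradient_process (e k) u t r \<omega> - gradient_process 0 u t r \<omega>)) \<longlonglongrightarrow> 0"
proof -
  note pm = gradient_process_measurable[OF t]
  have "(\<lambda>k. sq_norm (path_measure M t) (\<lambda>x. (case x of (\<omega>, r) \<Rightarrow> gradient_process (e k) u t r \<omega>)
      - (case x of (\<omega>, r) \<Rightarrow> gradient_process 0 u t r \<omega>))) \<longlonglongrightarrow> 0"
  proof (rule sq_norm_bounded_convergence)
    show "finite_measure (path_measure M t)" by (rule finite_path_measure) (rule finite_measure_axioms)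
    show "\<bar>case x of (\<omega>, r) \<Rightarrow> gradient_process (e k) u t r \<omega>\<bar> \<le> sqrt pi" for k x
      by (cases x) (simp add: heat_gradient_bounded[OF e(1)])
    show "AE x in path_measure M t. (\<lambda>k. case x of (\<omega>, r) \<Rightarrow> gradient_process (e k) u t r \<omega>)
        \<longlonglongrightarrow> (case x of (\<omega>, r) \<Rightarrow> gradient_process 0 u t r \<omega>)"
      by (intro AE_I2) (auto intro: heat_gradient_tendsto e)
  qed (rule process_measurable_path[OF pm])+
  then show ?thesis
    unfolding mean_square_eq[OF process_measurable_diff[OF pm pm]] by (simp add: case_prod_beta')
qed

text \<open>
  The uniform bound passes to the limit \<open>\<epsilon> \<rightarrow> 0\<close>.
\<close>

lemma gradient_process_ito_integrand: "ito_integrand M w t (gradient_process 0 u t)"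
proof (rule bounded_ito_integrand[OF gradient_process_measurable[OF t] gradient_process_adapted])
  fix r \<omega>
  have "(\<lambda>k. gradient_process (1 / real (Suc k)) u t r \<omega>) \<longlonglongrightarrow> gradient_process 0 u t r \<omega>"
    by (rule heat_gradient_tendsto[OF _ LIMSEQ_Suc[OF lim_1_over_n]]) simp
  from LIMSEQ_le_const2[OF tendsto_rabs[OF this]]
  show "\<bar>gradient_process 0 u t r \<omega>\<bar> \<le> sqrt pi" by (meson heat_gradient_bounded of_nat_0_less_iff zero_less_Suc zero_less_divide_1_iff)
qed

text \<open>
  The limit is first constructed along one sequence of scales; the comparison of integrals then gives convergence along every
  sequence, hence along the filter in the definition of local time.
\<close>

lemma local_time_ito:
  obtains J where "J \<in> borel_measurable (\<F> t)" "has_ito_integral M w t (gradient_process 0 u t) J"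
    "has_local_time M w u t (\<lambda>\<omega>. (LINT r:{0..t}|lborel. heat_kernel r u) + J \<omega>)"
proof -
  let ?m = "LINT r:{0..t}|lborel. heat_kernel r u"
  define I where "I \<epsilon> \<omega> = occupation \<epsilon> u t \<omega> - heat_potential \<epsilon> t u" for \<epsilon> \<omega>
  have I: "has_ito_integral M w t (gradient_process \<epsilon> u t) (I \<epsilon>)" if "0 < \<epsilon>" for \<epsilon>
    unfolding I_def by (rule occupation_ito[OF t that])
  have I\<F>: "I \<epsilon> \<in> borel_measurable (\<F> t)" for \<epsilon>
    unfolding I_def by (intro borel_measurable_diff occupation_measurable[OF t] borel_measurable_const)
  obtain J where J: "J \<in> borel_measurable (\<F> t)" "has_ito_integral M w t (gradient_process 0 u t) J"
  proof (rule ito_integral_limit)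
    show "has_ito_integral M w t (gradient_process (1 / real (Suc k)) u t) (I (1 / real (Suc k)))" for k
      by (rule I) simp
    show "(\<lambda>k. mean_square M t (\<lambda>r \<omega>. gradient_process (1 / real (Suc k)) u t r \<omega> - gradient_process 0 u t r \<omega>)) \<longlonglongrightarrow> 0"
      by (rule gradient_process_tendsto[OF _ LIMSEQ_Suc[OF lim_1_over_n]]) simp
  qed (rule I\<F> gradient_process_ito_integrand)+
  let ?Y = "\<lambda>\<omega>. ?m + J \<omega>"
  have J2: "square_integrable M J"
    using J(2) tendsto_L2_D(1) unfolding has_ito_integral_def by blast
  have Jm [measurable]: "J \<in> borel_measurable M" using J2 by (simp add: square_integrable_iff)
  have const: "square_integrable M (\<lambda>_. c)" for c :: real by (simp add: square_integrable_def)
  from square_integrable_diff[OF const[of ?m] square_integrable_diff[OF const[of 0] J2]]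
  have Y2: "square_integrable M ?Y" by simp
  have "((\<lambda>\<epsilon>. sq_norm M (\<lambda>\<omega>. occupation \<epsilon> u t \<omega> - ?Y \<omega>)) \<longlongrightarrow> 0) (at_right 0)"
    unfolding tendsto_at_iff_sequentially comp_def
  proof (intro allI impI)
    fix e :: "nat \<Rightarrow> real" assume "\<forall>k. e k \<in> {0<..} - {0}" and e0: "e \<longlonglongrightarrow> 0"
    then have e: "0 < e k" for k by auto
    have Im [measurable]: "I (e k) \<in> borel_measurable M" for k by (rule measurable_filtrationD[OF I\<F>])
    have "(\<lambda>k. 16 * mean_square M t (\<lambda>r \<omega>. gradient_process (e k) u t r \<omega> - gradient_process 0 u t r \<omega>)) \<longlonglongrightarrow> 16 * 0"
      by (intro ennreal_tendsto_cmult gradient_process_tendsto e e0) simp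
    then have A: "(\<lambda>k. 16 * mean_square M t (\<lambda>r \<omega>. gradient_process (e k) u t r \<omega> - gradient_process 0 u t r \<omega>)) \<longlonglongrightarrow> 0"
      by simp
    have "(\<lambda>k. (heat_potential (e k) t u - ?m)\<^sup>2) \<longlonglongrightarrow> (?m - ?m)\<^sup>2"
      by (intro tendsto_intros heat_potential_tendsto e e0 t)
    from tendsto_ennrealI[OF this]
    have B: "(\<lambda>k. sq_norm M (\<lambda>_. heat_potential (e k) t u - ?m)) \<longlonglongrightarrow> 0"
      by (simp add: sq_norm_def emeasure_space_1)
    show "(\<lambda>k. sq_norm M (\<lambda>\<omega>. occupation (e k) u t \<omega> - ?Y \<omega>)) \<longlonglongrightarrow> 0"
    proof (rule tendsto_0_ennreal_le[OF tendsto_0_combine[OF A B]], rule always_eventually, rule allI)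
      fix k
      have "sq_norm M (\<lambda>\<omega>. occupation (e k) u t \<omega> - ?Y \<omega>)
          = sq_norm M (\<lambda>\<omega>. (I (e k) \<omega> - J \<omega>) + (heat_potential (e k) t u - ?m))"
        by (rule arg_cong[where f="sq_norm M"]) (auto simp: I_def)
      also have "\<dots> \<le> 2 * sq_norm M (\<lambda>\<omega>. I (e k) \<omega> - J \<omega>) + 2 * sq_norm M (\<lambda>_. heat_potential (e k) t u - ?m)"
        by (rule sq_norm_add_le) measurable
      also have "\<dots> \<le> 2 * (16 * mean_square M t (\<lambda>r \<omega>. gradient_process (e k) u t r \<omega> - gradient_process 0 u t r \<omega>))
          + 2 * sq_norm M (\<lambda>_. heat_potential (e k) t u - ?m)"
        by (intro add_right_mono mult_left_mono ito_comparison(1)[OF I[OF e] J(2)]) simp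
      finally show "sq_norm M (\<lambda>\<omega>. occupation (e k) u t \<omega> - ?Y \<omega>) \<le> \<dots>" .
    qed
  qed
  moreover have "\<forall>\<^sub>F \<epsilon> in at_right 0. square_integrable M (occupation \<epsilon> u t)"
    using eventually_at_right_less[of 0] by eventually_elim (rule occupation_square_integrable[OF t])
  ultimately have "has_local_time M w u t ?Y"
    unfolding has_local_time_def using Y2 by (subst tendsto_L2_iff)
  then show thesis using that J by blast
qed

end

end

theorem lemma17:
  fixes M :: "'a measure" and w :: "real \<Rightarrow> 'a \<Rightarrow> real" and u t :: real
    and v :: "real \<Rightarrow> 'a \<Rightarrow> real"
  assumes "wiener_process M w" and "0 \<le> t"
  defines "v \<equiv> \<lambda>r \<omega>. LINT s:{r..t}|lborel. deriv (heat_kernel (s - r)) (w r \<omega> - u)"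
  shows "has_local_time M w u t (local_time M w u t) \<and>
         clark_representation M w t (local_time M w u t) v \<and>
         (AE \<omega> in M. local_time M w u t \<omega> =
            (LINT r:{0..t}|lborel. heat_kernel r u) + ito_integral M w t v \<omega>)"
proof -
  interpret wiener_process M w by fact
  let ?L = "local_time M w u t" and ?m = "LINT r:{0..t}|lborel. heat_kernel r u"
  have v: "v = gradient_process 0 u t"
    unfolding v_def heat_kernel_x_time_integral ..
  obtain J where J: "J \<in> borel_measurable (\<F> t)" "has_ito_integral M w t v J" "has_local_time M w u t (\<lambda>\<omega>. ?m + J \<omega>)"
    using local_time_ito[OF assms(2), of u] unfolding v by blast
  have L: "has_local_time M w u t ?L"
    unfolding local_time_def by (rule someI[of "has_local_time M w u t", OF J(3)])
  have LJ: "AE \<omega> in M. ?L \<omega> = ?m + J \<omega>"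
    using tendsto_L2_unique[OF L[unfolded has_local_time_def] J(3)[unfolded has_local_time_def]] by simp
  have L2: "square_integrable M ?L"
    by (rule tendsto_L2_D(1)[OF L[unfolded has_local_time_def]])
  have J2: "square_integrable M J"
    using J(2) tendsto_L2_D(1) unfolding has_ito_integral_def by blast
  have Lm [measurable]: "?L \<in> borel_measurable M" and Jm [measurable]: "J \<in> borel_measurable M"
    using L2 J2 by (simp_all add: square_integrable_iff)
  have "expectation ?L = expectation (\<lambda>\<omega>. ?m + J \<omega>)"
    by (rule integral_cong_AE) (use LJ in auto)
  also have "\<dots> = ?m"
    using integrable_square_integrable[OF J2] ito_integral_expectation[OF J(2)] by (simp add: prob_space)
  finally have EL: "expectation ?L = ?m" .
  have ito: "has_ito_integral M w t v (\<lambda>\<omega>. ?L \<omega> - expectation ?L)"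
    by (rule ito_integral_cong_AE[OF J(2)]) (use LJ in \<open>auto simp: EL\<close>)
  have "\<exists>\<beta>\<in>borel_measurable (\<F> t). AE \<omega> in M. ?L \<omega> = \<beta> \<omega>"
    using LJ J(1) by (intro bexI[of _ "\<lambda>\<omega>. ?m + J \<omega>"]) auto
  moreover have "AE \<omega> in M. AE r in lborel. r \<in> {0..t} \<longrightarrow> v' r \<omega> = v r \<omega>"
    if "has_ito_integral M w t v' (\<lambda>\<omega>. ?L \<omega> - expectation ?L)" for v'
    by (rule ito_integrand_unique[OF that ito])
  ultimately have "clark_representation M w t ?L v"
    unfolding clark_representation_def using L2 ito by blast
  moreover have "has_ito_integral M w t v (ito_integral M w t v)"
    unfolding ito_integral_def by (rule someI[of "has_ito_integral M w t v", OF J(2)])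
  from ito_integral_unique[OF this J(2)] LJ
  have "AE \<omega> in M. ?L \<omega> = ?m + ito_integral M w t v \<omega>" by eventually_elim simp
  ultimately show ?thesis using L by blast
qed

end
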